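(* Let $d\geq 1$ be an integer, let $t>0$ and let $V$ be a real-valued measurable function on $\mathbb{R}^d$ with $e^{-tV}\in L^1(\mathbb{R}^d)$. Then the lowest eigenvalue $E_0$ of the Schrödinger operator $-\Delta+V$ in $L^2(\mathbb{R}^d)$ satisfies $$ E_0 \geq - t^{-1} \ln\int_{\mathbb{R}^d} e^{-t V(x)}\,dx + d\,t^{-1} \left(1+ \tfrac12\ln(\pi t)\right) . $$ Moreover, equality holds if and only if there are $b\in\mathbb{R}^d$ and a constant $C\in\mathbb{R}$ such that $V(x)=t^{-2}|x-b|^2+C$ for almost every $x\in\mathbb{R}^d$.
   Context: The operator $-\Delta+V$ is understood in the sense of quadratic forms. Write $V_\pm=\max\{\pm V,0\}$. If $e^{-tV}\in L^1(\mathbb{R}^d)$ for some $t>0$, then $V_-$ is infinitesimally form bounded with respect to $-\Delta$, so $\int_{\mathbb{R}^d} V_-|\psi|^2\,dx<\infty$ for every $\psi\in H^1(\mathbb{R}^d)$; the form domain of $-\Delta+V$ is $\{\psi\in H^1(\mathbb{R}^d):\ \int_{\mathbb{R}^d} V_+|\psi|^2\,dx<\infty\}$ and the operator has compact resolvent. Its lowest eigenvalue is given by the variational principle $$ E_0=\inf\left\{\int_{\mathbb{R}^d}\left(|\nabla\psi|^2+V|\psi|^2\right)dx:\ \psi \text{ in the form domain},\ \|\psi\|_{L^2(\mathbb{R}^d)}=1\right\}, $$ with the convention $\inf\emptyset=+\infty$ (in which case the inequality is strict and trivially true). *)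

theory Defs
  imports "HOL-Analysis.Analysis"
begin

definition partial :: "'n \<Rightarrow> (real^'n::finite \<Rightarrow> real) \<Rightarrow> real^'n \<Rightarrow> real" where
  "partial i f x = frechet_derivative f (at x) (axis i 1)"

primrec C_k :: "nat \<Rightarrow> (real^'n::finite \<Rightarrow> real) \<Rightarrow> bool" where
  "C_k 0 f \<longleftrightarrow> continuous_on UNIV f"
| "C_k (Suc k) f \<longleftrightarrow> (\<forall>x. f differentiable (at x)) \<and> (\<forall>i. C_k k (partial i f))"

definition test_function :: "(real^'n::finite \<Rightarrow> real) \<Rightarrow> bool" where
  "test_function \<phi> \<longleftrightarrow> (\<forall>k. C_k k \<phi>) \<and> compact (closure {x. \<phi> x \<noteq> 0})"

text \<open>
  Functions, rather than classes modulo null sets, represent the elements of the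
  spaces \<open>L\<^sup>2\<close> and \<open>H\<^sup>1\<close>; wave functions are complex-valued.
\<close>

definition L2 :: "(real^'n::finite \<Rightarrow> complex) set" where
  "L2 = {\<psi>. \<psi> \<in> borel_measurable lebesgue \<and> integrable lebesgue (\<lambda>x. (cmod (\<psi> x))\<^sup>2)}"

definition L2_norm :: "(real^'n::finite \<Rightarrow> complex) \<Rightarrow> real" where
  "L2_norm \<psi> = sqrt (\<integral>x. (cmod (\<psi> x))\<^sup>2 \<partial>lebesgue)"

definition has_weak_partial ::
    "'n \<Rightarrow> (real^'n::finite \<Rightarrow> complex) \<Rightarrow> (real^'n \<Rightarrow> complex) \<Rightarrow> bool" where
  "has_weak_partial i \<psi> g \<longleftrightarrow>
     (\<forall>\<phi>. test_function \<phi> \<longrightarrow>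
        (\<integral>x. partial i \<phi> x *\<^sub>R \<psi> x \<partial>lebesgue) = - (\<integral>x. \<phi> x *\<^sub>R g x \<partial>lebesgue))"

definition H1 :: "(real^'n::finite \<Rightarrow> complex) set" where
  "H1 = {\<psi> \<in> L2. \<forall>i. \<exists>g \<in> L2. has_weak_partial i \<psi> g}"

text \<open>The weak derivative is determined up to a null set, so the choice below does not
  affect integrals.\<close>

definition weak_partial :: "'n \<Rightarrow> (real^'n::finite \<Rightarrow> complex) \<Rightarrow> real^'n \<Rightarrow> complex" where
  "weak_partial i \<psi> = (SOME g. g \<in> L2 \<and> has_weak_partial i \<psi> g)"

definition form_domain :: "(real^'n::finite \<Rightarrow> real) \<Rightarrow> (real^'n \<Rightarrow> complex) set" where
  "form_domain V = {\<psi> \<in> H1. integrable lebesgue (\<lambda>x. max (V x) 0 * (cmod (\<psi> x))\<^sup>2)}"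

definition schroedinger_form :: "(real^'n::finite \<Rightarrow> real) \<Rightarrow> (real^'n \<Rightarrow> complex) \<Rightarrow> real" where
  "schroedinger_form V \<psi> =
     (\<integral>x. (\<Sum>i\<in>UNIV. (cmod (weak_partial i \<psi> x))\<^sup>2) + V x * (cmod (\<psi> x))\<^sup>2 \<partial>lebesgue)"

text \<open>
  The lowest eigenvalue of \<open>-\<Delta> + V\<close>, given by the variational principle. It is an extended
  real because the form domain may contain no normalized function, in which case the
  infimum is \<open>\<infinity>\<close>. If \<open>exp (- t * V)\<close> is integrable for some \<open>t > 0\<close>, the negative part
  of \<open>V\<close> is form bounded, so the integral in \<^const>\<open>schroedinger_form\<close> converges on the
  form domain.
\<close>

definition lowest_eigenvalue :: "(real^'n::finite \<Rightarrow> real) \<Rightarrow> ereal" where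
  "lowest_eigenvalue V =
     (INF \<psi> \<in> {\<psi> \<in> form_domain V. L2_norm \<psi> = 1}. ereal (schroedinger_form V \<psi>))"

end

(*
  Let m be the integral of f = exp (- t V) along a line in direction e, and T the monotone map on
  that line carrying the probability density f / m to the Gaussian g with density proportional to
  exp (- y^2 / t), so that T' = f / (m g(T)).  Since |d_e psi + T psi / t|^2 >= 0, integration by
  parts gives
     t int |d_e psi|^2 >= int (T' - T^2 / t) |psi|^2,
  and T' = 1 + ln T' + (T' - 1 - ln T') turns the right-hand side into
     int (ln (f / m) + 1 + ln (pi t) / 2) |psi|^2 + int (T' - 1 - ln T') |psi|^2.
  Applied successively to the marginals of f, one coordinate at a time, the terms ln (f / m)
  telescope to - t V - ln int f, which is the inequality, with a remainder.

  If equality holds, let the last coordinate to be integrated out be x_i.  A perturbation of V by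
  the bounded function min 1 (T' - 1 - ln T') leaves the infimum unchanged but would increase the
  lower bound unless T' = 1; hence every one-dimensional marginal of f is Gaussian with variance
  t / 2.  Then near-minimizers for V are near-minimizers for the harmonic potential W with the
  same marginals, hence also for (V + W) / 2.  The lower bound for (V + W) / 2 and the equality
  case of the Cauchy-Schwarz inequality for exp (- t V / 2) and exp (- t W / 2) yield
  V = W + const.
*)
theory Submission
  imports Defs "HOL-Probability.Distributions" "HOL-Real_Asymp.Real_Asymp"
begin

section \<open>Test functions\<close>

text \<open>The Gaussian exp (- y^2 / t) is the squared ground state of the oscillator y^2 / t^2, so
  T / t is the ground state drift pulled back by the transport, and nothing is lost when T is a
  translation. The estimate T' - 1 \<ge> ln T' involves the derivative along one line only. Treating
  one coordinate at a time therefore asks for no regularity in the other variables. Two obstacles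
  shape the proof. First, psi has weak derivatives only, and T is unbounded with a derivative only
  almost everywhere. Integration by parts is replaced by difference quotients, and T is made bounded
  by compressing probabilities from [0, 1] into [\<epsilon>, 1 - \<epsilon>]. Second, no minimizer
  is available in the case of equality, only near-minimizers that vary with the error. All
  information must pass through lower bounds for modified potentials, from which the wave function
  has disappeared. Gaussian marginals do not determine f, but the harmonic energy is a sum of
  one-coordinate terms, each controlled by one marginal.\<close>

lemma partial_eq:
  fixes f :: "real^'n::finite \<Rightarrow> real"
  assumes "(f has_derivative f') (at x)"
  shows "partial i f x = f' (axis i 1)"
  using frechet_derivative_at[OF assms] by (simp add: partial_def)

lemma C_k_mono_Suc: "C_k (Suc k) f \<Longrightarrow> C_k k f"
proof (induction k arbitrary: f)
  case 0
  then show ?case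
    by (auto intro!: differentiable_imp_continuous_on simp: differentiable_on_def differentiable_at_withinI)
next
  case (Suc k)
  then show ?case by (metis C_k.simps(2))
qed

lemma C_k_const: "C_k k (\<lambda>x::real^'n::finite. c)"
proof (induction k arbitrary: c)
  case (Suc k)
  have "partial i (\<lambda>x::real^'n. c) = (\<lambda>x. 0)" for i
    by (rule ext) (simp add: partial_eq[OF has_derivative_const])
  with Suc show ?case by simp
qed simp

lemma C_k_add:
  fixes f g :: "real^'n::finite \<Rightarrow> real"
  shows "C_k k f \<Longrightarrow> C_k k g \<Longrightarrow> C_k k (\<lambda>x. f x + g x)"
proof (induction k arbitrary: f g)
  case 0
  then show ?case by (auto intro: continuous_on_add)
next
  case (Suc k)
  have "partial i (\<lambda>x. f x + g x) = (\<lambda>x. partial i f x + partial i g x)" for i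
  proof
    fix x
    have "(f has_derivative frechet_derivative f (at x)) (at x)"
      "(g has_derivative frechet_derivative g (at x)) (at x)"
      using Suc.prems by (auto simp: frechet_derivative_works)
    then show "partial i (\<lambda>x. f x + g x) x = partial i f x + partial i g x"
      by (subst partial_eq[OF has_derivative_add]) (auto simp: partial_def)
  qed
  with Suc show ?case by auto
qed

lemma C_k_mult:
  fixes f g :: "real^'n::finite \<Rightarrow> real"
  shows "C_k k f \<Longrightarrow> C_k k g \<Longrightarrow> C_k k (\<lambda>x. f x * g x)"
proof (induction k arbitrary: f g)
  case 0
  then show ?case by (auto intro: continuous_on_mult)
next
  case (Suc k)
  have "partial i (\<lambda>x. f x * g x) = (\<lambda>x. f x * partial i g x + partial i f x * g x)" for i
  proof
    fix x
    have "(f has_derivative frechet_derivative f (at x)) (at x)"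
      "(g has_derivative frechet_derivative g (at x)) (at x)"
      using Suc.prems by (auto simp: frechet_derivative_works)
    then show "partial i (\<lambda>x. f x * g x) x = f x * partial i g x + partial i f x * g x"
      by (subst partial_eq[OF has_derivative_mult]) (auto simp: partial_def)
  qed
  with Suc show ?case
    using C_k_mono_Suc[OF Suc.prems(1)] C_k_mono_Suc[OF Suc.prems(2)]
    by (auto intro!: C_k_add)
qed

lemma C_k_prod:
  fixes f :: "'a \<Rightarrow> real^'n::finite \<Rightarrow> real"
  shows "(\<And>j. j \<in> J \<Longrightarrow> C_k k (f j)) \<Longrightarrow> C_k k (\<lambda>x. \<Prod>j\<in>J. f j x)"
  by (induction J rule: infinite_finite_induct) (auto intro: C_k_const C_k_mult)

text \<open>A smooth function of one variable enters as the sequence \<open>d\<close> of its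
  successive derivatives. The induction on \<open>k\<close> then only shifts the index
  \<open>n\<close>, and the chain rule contributes a constant factor.\<close>

lemma C_k_component:
  fixes d :: "nat \<Rightarrow> real \<Rightarrow> real"
  assumes d: "\<And>n x. (d n has_real_derivative d (Suc n) x) (at x)"
  shows "C_k k (\<lambda>x::real^'n::finite. d n (c * (x $ j) + a))"
proof (induction k arbitrary: n)
  case 0
  have "continuous_on UNIV (d n)"
    using d by (meson DERIV_continuous continuous_at_imp_continuous_on)
  then show ?case
    by (auto intro!: continuous_intros continuous_on_compose2[of UNIV "d n"])
next
  case (Suc k)
  have D: "((\<lambda>x::real^'n. d n (c * (x $ j) + a)) has_derivative
       (\<lambda>v. d (Suc n) (c * (x $ j) + a) * (c * (v $ j)))) (at x)" for x
    by (rule has_derivative_eq_rhs, rule has_derivative_compose[OF _ d[unfolded has_field_derivative_def]])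
       (auto intro!: derivative_eq_intros bounded_linear_imp_has_derivative bounded_linear_vec_nth simp: fun_eq_iff)
  have "partial i (\<lambda>x::real^'n. d n (c * (x $ j) + a)) =
      (\<lambda>x. d (Suc n) (c * (x $ j) + a) * (c * (axis i 1 $ j)))" for i
    by (rule ext) (rule partial_eq[OF D])
  moreover have "C_k k (\<lambda>x::real^'n. d (Suc n) (c * (x $ j) + a) * (c * (axis i 1 $ j)))" for i
    by (intro C_k_mult Suc.IH C_k_const)
  ultimately show ?case
    using D by (auto simp: differentiable_def)
qed

section \<open>A flat function and smooth bumps on boxes\<close>

fun flat_poly :: "nat \<Rightarrow> real poly" where
  "flat_poly 0 = 1"
| "flat_poly (Suc n) = [:0,0,1:] * (flat_poly n - pderiv (flat_poly n))"

text \<open>The \<open>n\<close>-th derivative of the function \<open>x \<mapsto> exp (- 1 / x)\<close>, extended by \<open>0\<close> to \<open>x \<le> 0\<close>.\<close>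

definition flat :: "nat \<Rightarrow> real \<Rightarrow> real" where
  "flat n x = (if x > 0 then poly (flat_poly n) (1 / x) * exp (- (1 / x)) else 0)"

lemma poly_times_exp_tendsto_0: "((\<lambda>y::real. poly p y * exp (- y)) \<longlongrightarrow> 0) at_top"
proof -
  have "((\<lambda>y::real. \<Sum>i\<le>degree p. coeff p i * (y ^ i / exp y)) \<longlongrightarrow> (\<Sum>i\<le>degree p. coeff p i * 0)) at_top"
    by (intro tendsto_intros tendsto_power_div_exp_0)
  then show ?thesis
    by (simp add: poly_altdef sum_distrib_right exp_minus divide_inverse mult.assoc)
qed

lemma flat_has_derivative: "(flat n has_real_derivative flat (Suc n) x) (at x)"
proof -
  consider "x > 0" | "x < 0" | "x = 0" by linarith
  then show ?thesis
  proof cases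
    case 1
    \<comment> \<open>With P = \<open>flat_poly n\<close>, the derivative of P(1/x) exp (-1/x) is
      (1/x)^2 (P - P')(1/x) exp (-1/x), which is the recursion defining
      \<open>flat_poly\<close>.\<close>
    have "((\<lambda>x. poly (flat_poly n) (1 / x) * exp (- (1 / x))) has_real_derivative flat (Suc n) x) (at x)"
      using 1 by (auto intro!: derivative_eq_intros poly_DERIV DERIV_chain2[OF poly_DERIV] simp: flat_def)
        (simp add: field_simps power2_eq_square)
    moreover have "eventually (\<lambda>y. poly (flat_poly n) (1 / y) * exp (- (1 / y)) = flat n y) (nhds x)"
      using eventually_nhds_in_open[of "{0<..}" x] 1
      by (auto simp: flat_def elim!: eventually_mono)
    ultimately show ?thesis
      by (subst (asm) DERIV_cong_ev[OF refl _ refl]) auto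
  next
    case 2
    have "((\<lambda>x. 0) has_real_derivative flat (Suc n) x) (at x)"
      using 2 by (auto simp: flat_def)
    moreover have "eventually (\<lambda>y. 0 = flat n y) (nhds x)"
      using eventually_nhds_in_open[of "{..<0}" x] 2
      by (auto simp: flat_def elim!: eventually_mono)
    ultimately show ?thesis
      by (subst (asm) DERIV_cong_ev[OF refl _ refl]) auto
  next
    case 3
    \<comment> \<open>\<open>pCons 0\<close> multiplies by the variable. After the substitution of
      \<open>inverse y\<close> this becomes the factor 1/y of the difference quotient at 0.\<close>
    have "((\<lambda>y. poly (pCons 0 (flat_poly n)) y * exp (- y)) \<longlongrightarrow> 0) at_top"
      by (rule poly_times_exp_tendsto_0)
    then have "((\<lambda>y. poly (pCons 0 (flat_poly n)) (inverse y) * exp (- inverse y)) \<longlongrightarrow> 0) (at_right 0)"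
      by (rule filterlim_compose[OF _ filterlim_inverse_at_top_right])
    then have R: "((\<lambda>y. flat n y / y) \<longlongrightarrow> 0) (at_right 0)"
      by (rule Lim_transform_eventually)
         (auto simp: eventually_at_filter flat_def field_simps)
    have L: "((\<lambda>y. flat n y / y) \<longlongrightarrow> 0) (at_left 0)"
      by (rule Lim_transform_eventually[of "\<lambda>y. 0"])
         (auto simp: eventually_at_filter flat_def)
    have "((\<lambda>y. flat n y / y) \<longlongrightarrow> 0) (at 0)"
      using L R by (simp add: filterlim_split_at)
    then show ?thesis
      using 3 by (simp add: has_field_derivative_iff flat_def)
  qed
qed

text \<open>\<open>m\<close> is a steepness parameter. Inside the box every factor has the form exp
  (- 1 / (m s)) with s > 0, so it tends to 1 as \<open>m\<close> grows, and the bumps approximate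
  the indicator of the open box.\<close>

definition box_bump :: "real \<Rightarrow> real^'n::finite \<Rightarrow> real^'n \<Rightarrow> real^'n \<Rightarrow> real" where
  "box_bump m a b x = (\<Prod>j\<in>UNIV. flat 0 (m * (x $ j) + - (m * a $ j)) * flat 0 (- m * (x $ j) + m * b $ j))"

lemma flat_0: "flat 0 x = (if x > 0 then exp (- (1 / x)) else 0)"
  by (simp add: flat_def)

lemma box_bump_eq:
  assumes "m > 0"
  shows "box_bump m a b x =
    (if x \<in> box a b then \<Prod>j\<in>UNIV. exp (- (1 / (m * (x $ j - a $ j)))) * exp (- (1 / (m * (b $ j - x $ j)))) else 0)"
proof -
  have 1: "m * x $ j + - (m * a $ j) = m * (x $ j - a $ j)" "- m * x $ j + m * b $ j = m * (b $ j - x $ j)" for j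
    by (auto simp: algebra_simps)
  show ?thesis
  proof (cases "x \<in> box a b")
    case True
    then show ?thesis using assms
      unfolding box_bump_def 1 by (auto intro!: prod.cong simp: flat_0 mem_box_cart zero_less_mult_iff)
  next
    case False
    then obtain j where "\<not> (a $ j < x $ j \<and> x $ j < b $ j)" by (auto simp: mem_box_cart)
    then have "flat 0 (m * (x $ j - a $ j)) * flat 0 (m * (b $ j - x $ j)) = 0"
      using assms by (auto simp: flat_0 zero_less_mult_iff)
    then show ?thesis
      using False unfolding box_bump_def 1 by (auto simp: prod_zero_iff)
  qed
qed

lemma test_functionI:
  assumes "\<And>k. C_k k \<phi>" "\<And>x. x \<notin> cbox a b \<Longrightarrow> \<phi> x = 0"
  shows "test_function \<phi>"
proof -
  have "closure {x. \<phi> x \<noteq> 0} \<subseteq> cbox a b"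
    using assms(2) by (intro closure_minimal closed_cbox) auto
  then show ?thesis
    using assms(1) unfolding test_function_def
    by (meson bounded_cbox bounded_subset closed_closure compact_eq_bounded_closed)
qed

lemma test_function_box_bump:
  assumes "m > 0"
  shows "test_function (box_bump m a b)"
proof (rule test_functionI)
  show "C_k k (box_bump m a b)" for k
    unfolding box_bump_def[abs_def] by (intro C_k_prod C_k_mult C_k_component flat_has_derivative)
  show "box_bump m a b x = 0" if "x \<notin> cbox a b" for x
    using that box_subset_cbox[of a b] by (auto simp: box_bump_eq[OF assms])
qed

lemma box_bump_nonneg: "m > 0 \<Longrightarrow> 0 \<le> box_bump m a b x"
  by (simp add: box_bump_eq prod_nonneg)

lemma box_bump_le: "m > 0 \<Longrightarrow> box_bump m a b x \<le> indicator (box a b) x"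
proof (cases "x \<in> box a b")
  case True
  assume "m > 0"
  then have "(\<Prod>j\<in>UNIV. exp (- (1 / (m * (x $ j - a $ j)))) * exp (- (1 / (m * (b $ j - x $ j))))) \<le> 1"
    using True by (intro prod_le_1) (auto intro!: mult_le_one simp: mem_box_cart less_imp_le)
  then show ?thesis using \<open>m > 0\<close> True by (simp add: box_bump_eq)
qed (simp add: box_bump_eq)

lemma box_bump_tendsto:
  "(\<lambda>m. box_bump (real (Suc m)) a b x) \<longlonglongrightarrow> indicator (box a b) x"
proof (cases "x \<in> box a b")
  case True
  have *: "(\<lambda>m. exp (- (1 / (real (Suc m) * c)))) \<longlonglongrightarrow> 1" for c
  proof -
    have "(\<lambda>m. exp (- (inverse (real (Suc m)) * (1 / c)))) \<longlonglongrightarrow> exp (- (0 * (1 / c)))"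
      by (intro tendsto_intros LIMSEQ_inverse_real_of_nat)
    then show ?thesis by (simp add: field_simps)
  qed
  have "(\<lambda>m. \<Prod>j\<in>UNIV. exp (- (1 / (real (Suc m) * (x $ j - a $ j)))) * exp (- (1 / (real (Suc m) * (b $ j - x $ j)))))
    \<longlonglongrightarrow> (\<Prod>j\<in>(UNIV::'a set). 1 * 1)"
    by (intro tendsto_intros *)
  then show ?thesis using True by (simp add: box_bump_eq del: of_nat_Suc)
qed (simp add: box_bump_eq)

lemma box_bump_measurable [measurable]: "box_bump m a b \<in> borel_measurable borel"
proof -
  have "flat 0 \<in> borel_measurable borel"
    unfolding flat_0[abs_def] by measurable
  then show ?thesis unfolding box_bump_def[abs_def] by measurable
qed

section \<open>The fundamental lemma of the calculus of variations\<close>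

lemma set_integrable_cbox_of_square:
  fixes w :: "real^'n::finite \<Rightarrow> complex"
  assumes w: "w \<in> borel_measurable lebesgue" and sq: "integrable lebesgue (\<lambda>x. (cmod (w x))\<^sup>2)"
  shows "set_integrable lebesgue (cbox a b) w"
  unfolding set_integrable_def
proof (rule Bochner_Integration.integrable_bound)
  show "integrable lebesgue (\<lambda>x. indicator (cbox a b) x + (cmod (w x))\<^sup>2)"
    using sq by (intro Bochner_Integration.integrable_add integrable_real_indicator) (auto simp: emeasure_lborel_cbox_eq)
  show "(\<lambda>x. indicat_real (cbox a b) x *\<^sub>R w x) \<in> borel_measurable lebesgue"
    by (intro borel_measurable_scaleR borel_measurable_indicator w) auto
  show "AE x in lebesgue. norm (indicat_real (cbox a b) x *\<^sub>R w x) \<le> norm (indicator (cbox a b) x + (cmod (w x))\<^sup>2)"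
  proof (rule AE_I2)
    fix x
    have "2 * cmod (w x) \<le> 1 + (cmod (w x))\<^sup>2"
      using sum_squares_bound[of 1 "cmod (w x)"] by simp
    then have "cmod (w x) \<le> 1 + (cmod (w x))\<^sup>2"
      using norm_ge_zero[of "w x"] by linarith
    then show "norm (indicat_real (cbox a b) x *\<^sub>R w x) \<le> norm (indicator (cbox a b) x + (cmod (w x))\<^sup>2)"
      by (auto simp: indicator_def)
  qed
qed

text \<open>Bumps approximating a box show that \<open>w\<close> has integral 0 over every box, and
  Lebesgue's differentiation theorem recovers \<open>w\<close> from these integrals almost
  everywhere.\<close>

lemma AE_eq_0_if_orthogonal_to_test_functions:
  fixes w :: "real^'n::finite \<Rightarrow> complex"
  assumes w: "w \<in> borel_measurable lebesgue" and sq: "integrable lebesgue (\<lambda>x. (cmod (w x))\<^sup>2)"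
    and test: "\<And>\<phi>. test_function \<phi> \<Longrightarrow> (LINT x|lebesgue. \<phi> x *\<^sub>R w x) = 0"
  shows "AE x in lebesgue. w x = 0"
proof -
  note loc = set_integrable_cbox_of_square[OF w sq]
  have int: "w integrable_on cbox a b" for a b
    using set_lebesgue_integral_eq_integral(1)[OF loc] .
  have zero: "integral (cbox a b) w = 0" for a b
  proof -
    have "(\<lambda>m. LINT x|lebesgue. box_bump (real (Suc m)) a b x *\<^sub>R w x)
        \<longlonglongrightarrow> (LINT x|lebesgue. indicator (box a b) x *\<^sub>R w x)"
    proof (rule integral_dominated_convergence)
      show "integrable lebesgue (\<lambda>x. indicator (cbox a b) x * cmod (w x))"
        using integrable_norm[OF loc[of a b, unfolded set_integrable_def]] by simp
      show "AE x in lebesgue. (\<lambda>m. box_bump (real (Suc m)) a b x *\<^sub>R w x) \<longlonglongrightarrow> indicator (box a b) x *\<^sub>R w x"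
        by (intro AE_I2 tendsto_intros box_bump_tendsto)
      have [simp]: "indicat_real (box a b) x \<le> indicator (cbox a b) x" for x
        using box_subset_cbox[of a b] by (auto simp: indicator_def)
      show "AE x in lebesgue. norm (box_bump (real (Suc m)) a b x *\<^sub>R w x) \<le> indicator (cbox a b) x * cmod (w x)" for m
        using box_bump_le[of "real (Suc m)" a b] box_bump_nonneg[of "real (Suc m)" a b]
        by (intro AE_I2) (auto intro!: mult_right_mono order_trans[OF box_bump_le] simp del: of_nat_Suc)
      show "(\<lambda>x. indicat_real (box a b) x *\<^sub>R w x) \<in> borel_measurable lebesgue"
        by (intro borel_measurable_scaleR borel_measurable_indicator w) auto
      show "(\<lambda>x. box_bump (real (Suc m)) a b x *\<^sub>R w x) \<in> borel_measurable lebesgue" for m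
        by (intro borel_measurable_scaleR w measurable_completion) auto
    qed
    then have "(LINT x|lebesgue. indicator (box a b) x *\<^sub>R w x) = 0"
      using test[OF test_function_box_bump[of "real (Suc _)" a b]] LIMSEQ_unique[OF _ tendsto_const] by simp
    moreover have "set_integrable lebesgue (box a b) w"
      by (rule set_integrable_subset[OF loc[of a b]]) (auto simp: box_subset_cbox)
    ultimately have "integral (box a b) w = 0"
      using set_lebesgue_integral_eq_integral(2)[of "box a b" w] by (simp add: set_lebesgue_integral_def)
    then show ?thesis by (simp add: integral_open_interval)
  qed
  obtain N where N: "negligible N"
       "\<And>x e. \<lbrakk>x \<notin> N; 0 < e\<rbrakk> \<Longrightarrow>
               \<exists>d>0. \<forall>h. 0 < h \<and> h < d \<longrightarrow>
                         norm(integral (cbox x (x + h *\<^sub>R One)) w /\<^sub>R h ^ DIM(real^'n) - w x) < e"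
    using integrable_ccontinuous_explicit[of w] int by metis
  have "w x = 0" if "x \<notin> N" for x
  proof (rule ccontr)
    assume "w x \<noteq> 0"
    from N(2)[OF that, of "norm (w x)"] this obtain d where
      d: "d > 0" "\<forall>h. 0 < h \<and> h < d \<longrightarrow>
        norm (integral (cbox x (x + h *\<^sub>R One)) w /\<^sub>R h ^ DIM(real^'n) - w x) < norm (w x)"
      by auto
    from d(1) d(2)[rule_format, of "d / 2"] show False by (simp add: zero)
  qed
  then show ?thesis
    using N(1) by (intro AE_I'[of N]) (auto simp: negligible_iff_null_sets)
qed

section \<open>Translations, lines and difference quotients\<close>

lemma nn_integral_lborel_translate:
  fixes c :: "'a::euclidean_space"
  assumes [measurable]: "f \<in> borel_measurable borel"
  shows "(\<integral>\<^sup>+x. f (x + c) \<partial>lborel) = (\<integral>\<^sup>+x. f x \<partial>lborel)"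
proof -
  have "(\<integral>\<^sup>+x. f x \<partial>lborel) = (\<integral>\<^sup>+x. f x \<partial>distr lborel borel ((+) c))"
    by (simp add: lborel_distr_plus)
  also have "\<dots> = (\<integral>\<^sup>+x. f (x + c) \<partial>lborel)"
    by (subst nn_integral_distr) (auto simp: add.commute)
  finally show ?thesis by simp
qed

lemma integral_lborel_translate:
  fixes c :: "'a::euclidean_space" and f :: "'a \<Rightarrow> 'b::{banach, second_countable_topology}"
  assumes [measurable]: "f \<in> borel_measurable borel"
  shows "(LBINT x. f (x + c)) = (LBINT x. f x)"
proof -
  have "(LBINT x. f x) = (\<integral>x. f x \<partial>distr lborel borel ((+) c))"
    by (simp add: lborel_distr_plus)
  also have "\<dots> = (LBINT x. f (x + c))"
    by (subst integral_distr) (auto simp: add.commute)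
  finally show ?thesis by simp
qed

lemma integrable_lborel_translate:
  fixes c :: "'a::euclidean_space" and f :: "'a \<Rightarrow> 'b::{banach, second_countable_topology}"
  assumes "integrable lborel f"
  shows "integrable lborel (\<lambda>x. f (x + c))"
proof -
  have [measurable]: "f \<in> borel_measurable borel" using assms by (auto dest: borel_measurable_integrable)
  have "integrable (distr lborel borel ((+) c)) f"
    using assms by (simp add: lborel_distr_plus)
  then show ?thesis
    by (subst (asm) integrable_distr_eq) (auto simp: add.commute)
qed

lemma AE_lborel_translate:
  fixes c :: "'a::euclidean_space"
  assumes "AE x in lborel. P x"
  shows "AE x in lborel. P (x + c)"
proof -
  have "AE x in distr lborel borel ((+) c). P x"
    using assms by (subst lborel_distr_plus)
  then have "AE x in lborel. P (c + x)"
    by (rule AE_distrD[rotated]) auto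
  then show ?thesis by (simp add: add.commute)
qed

text \<open>Fubini along the lines in direction \<open>e\<close>, without a choice of the other
  coordinates. Each line is parametrized from every one of its points, so that functions stay on the
  whole space, and the weight \<open>w\<close> accounts for the repetition.\<close>

lemma nn_integral_lines:
  fixes e :: "'a::euclidean_space"
  assumes [measurable]: "k \<in> borel_measurable borel" "w \<in> borel_measurable borel"
  shows "(\<integral>\<^sup>+x. (\<integral>\<^sup>+s. w s * k (x + s *\<^sub>R e) \<partial>lborel) \<partial>lborel) =
    (\<integral>\<^sup>+s. w s \<partial>lborel) * (\<integral>\<^sup>+x. k x \<partial>lborel)" (is "?L = ?R")
proof -
  have "?L = (\<integral>\<^sup>+s. (\<integral>\<^sup>+x. w s * k (x + s *\<^sub>R e) \<partial>lborel) \<partial>lborel)"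
    by (rule lborel_pair.Fubini') measurable
  also have "\<dots> = (\<integral>\<^sup>+s. w s * (\<integral>\<^sup>+x. k x \<partial>lborel) \<partial>lborel)"
    by (simp add: nn_integral_cmult nn_integral_lborel_translate)
  finally show ?thesis by (simp add: nn_integral_multc)
qed

lemma AE_lborel_lines:
  fixes e :: "'a::euclidean_space"
  assumes "AE x in lborel. P x"
  shows "AE x in lborel. AE s in lborel. P (x + s *\<^sub>R e)"
proof -
  obtain N where N: "{x. \<not> P x} \<subseteq> N" "emeasure lborel N = 0" "N \<in> sets borel"
    using AE_E[OF assms] by auto
  note [measurable] = N(3)
  have "(\<integral>\<^sup>+x. (\<integral>\<^sup>+s. 1 * indicator N (x + s *\<^sub>R e) \<partial>lborel) \<partial>lborel) =
    (\<integral>\<^sup>+s. 1 \<partial>(lborel::real measure)) * (\<integral>\<^sup>+x. indicator N x \<partial>lborel)"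
    by (rule nn_integral_lines) auto
  also have "\<dots> = 0" using N by simp
  finally have "AE x in lborel. (\<integral>\<^sup>+s. indicator N (x + s *\<^sub>R e) \<partial>lborel) = 0"
    by (subst (asm) nn_integral_0_iff_AE) auto
  then show ?thesis
  proof eventually_elim
    case (elim x)
    then have "AE s in lborel. indicator N (x + s *\<^sub>R e) = (0::ennreal)"
      by (subst (asm) nn_integral_0_iff_AE) auto
    then show ?case
      by eventually_elim (use N(1) in \<open>auto split: split_indicator_asm\<close>)
  qed
qed

text \<open>The converse of \<open>AE_lborel_lines\<close>. With weight 1 the iterated integral of
  an indicator over lines is infinity times the measure of the set, so its vanishing forces the
  measure to be 0.\<close>

lemma AE_lborel_of_lines:
  fixes e :: "'a::euclidean_space"
  assumes [measurable]: "Measurable.pred borel P"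
    and "AE x in lborel. AE s in lborel. P (x + s *\<^sub>R e)"
  shows "AE x in lborel. P x"
proof -
  have "AE x in lborel. (\<integral>\<^sup>+s. 1 * indicator {x. \<not> P x} (x + s *\<^sub>R e) \<partial>lborel) = 0"
    using assms(2)
  proof eventually_elim
    case (elim x)
    then show ?case
      by (subst nn_integral_0_iff_AE) (auto split: split_indicator elim!: eventually_mono)
  qed
  then have "(\<integral>\<^sup>+x. (\<integral>\<^sup>+s. 1 * indicator {x. \<not> P x} (x + s *\<^sub>R e) \<partial>lborel) \<partial>lborel) = 0"
    by (subst nn_integral_0_iff_AE) auto
  also have "(\<integral>\<^sup>+x. (\<integral>\<^sup>+s. 1 * indicator {x. \<not> P x} (x + s *\<^sub>R e) \<partial>lborel) \<partial>lborel) =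
    (\<integral>\<^sup>+s. 1 \<partial>(lborel::real measure)) * (\<integral>\<^sup>+x. indicator {x. \<not> P x} x \<partial>lborel)"
    by (rule nn_integral_lines) auto
  finally have "(\<integral>\<^sup>+x. indicator {x. \<not> P x} x \<partial>(lborel::'a measure)) = 0"
    by simp
  then have "AE x in lborel. indicator {x. \<not> P x} x = (0::ennreal)"
    by (subst (asm) nn_integral_0_iff_AE) auto
  then show ?thesis by eventually_elim (auto split: split_indicator_asm)
qed

section \<open>Translates and bounds of test functions\<close>

lemma partial_translate:
  fixes f :: "real^'n::finite \<Rightarrow> real"
  assumes "f differentiable (at (x + c))"
  shows "((\<lambda>y. f (y + c)) has_derivative frechet_derivative f (at (x + c))) (at x)"
    and "partial i (\<lambda>y. f (y + c)) x = partial i f (x + c)"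
proof -
  have "(f has_derivative frechet_derivative f (at (x + c))) (at (x + c))"
    using assms by (simp add: frechet_derivative_works)
  then show D: "((\<lambda>y. f (y + c)) has_derivative frechet_derivative f (at (x + c))) (at x)"
    by (rule has_derivative_compose[rotated, where g=f]) (auto intro!: derivative_eq_intros)
  then show "partial i (\<lambda>y. f (y + c)) x = partial i f (x + c)"
    by (subst partial_eq[OF D]) (simp add: partial_def)
qed

lemma C_k_translate:
  fixes f :: "real^'n::finite \<Rightarrow> real"
  shows "C_k k f \<Longrightarrow> C_k k (\<lambda>x. f (x + c))"
proof (induction k arbitrary: f)
  case 0
  then show ?case by (auto intro!: continuous_on_compose2[of UNIV f] continuous_intros)
next
  case (Suc k)
  then have "partial i (\<lambda>x. f (x + c)) = (\<lambda>x. partial i f (x + c))" for i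
    by (auto simp: fun_eq_iff partial_translate(2))
  moreover have "(\<lambda>x. f (x + c)) differentiable (at x)" for x
    using partial_translate(1)[of f x c] Suc.prems by (auto simp: differentiable_def)
  ultimately show ?case using Suc by auto
qed

lemma test_functionE:
  fixes \<phi> :: "real^'n::finite \<Rightarrow> real"
  assumes "test_function \<phi>"
  obtains a b C where "\<And>x. x \<notin> cbox a b \<Longrightarrow> \<phi> x = 0" "\<And>x i. x \<notin> cbox a b \<Longrightarrow> partial i \<phi> x = 0"
    "\<And>x. \<bar>\<phi> x\<bar> \<le> C" "\<And>x i. \<bar>partial i \<phi> x\<bar> \<le> C" "0 \<le> C"
proof -
  define K where "K = closure {x. \<phi> x \<noteq> 0}"
  have K: "compact K" and C: "\<And>k. C_k k \<phi>" using assms by (simp_all add: test_function_def K_def)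
  have "{x. \<phi> x \<noteq> 0} \<subseteq> K" unfolding K_def by (rule closure_subset)
  then have zero: "\<phi> x = 0" if "x \<notin> K" for x using that by blast
  have pzero: "partial i \<phi> x = 0" if "x \<notin> K" for x i
  proof -
    have "(\<phi> has_derivative (\<lambda>v. 0)) (at x)"
      by (rule has_derivative_transform_within_open[of "\<lambda>x. 0" _ _ _ "- K"])
         (use that zero K in \<open>auto intro: compact_imp_closed\<close>)
    then show ?thesis by (simp add: partial_eq)
  qed
  have cont: "continuous_on UNIV \<phi>" "continuous_on UNIV (partial i \<phi>)" for i
    using C[of 0] C[of "Suc 0"] by simp_all
  have bd: "\<exists>C. \<forall>x. \<bar>f x\<bar> \<le> C" if f: "continuous_on UNIV f" "\<And>x. x \<notin> K \<Longrightarrow> f x = 0" for f :: "real^'n \<Rightarrow> real"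
  proof -
    have "bounded (f ` K)"
      using compact_imp_bounded[OF compact_continuous_image[OF continuous_on_subset[OF f(1) subset_UNIV] K]] .
    then obtain B where "\<forall>y \<in> f ` K. \<bar>y\<bar> \<le> B" by (auto simp: bounded_real)
    then have "\<bar>f x\<bar> \<le> max B 0" for x
      using f(2)[of x] by (cases "x \<in> K") (auto intro: max.coboundedI1)
    then show ?thesis by blast
  qed
  obtain C0 where C0: "\<And>x. \<bar>\<phi> x\<bar> \<le> C0" using bd[OF cont(1) zero] by auto
  have "\<forall>i. \<exists>C. \<forall>x. \<bar>partial i \<phi> x\<bar> \<le> C" using bd[OF cont(2) pzero] by auto
  then obtain C1 where C1: "\<And>i x. \<bar>partial i \<phi> x\<bar> \<le> C1 i" by metis
  define C where "C = \<bar>C0\<bar> + (\<Sum>i\<in>UNIV. \<bar>C1 i\<bar>)"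
  have "\<bar>C1 i\<bar> \<le> (\<Sum>i\<in>UNIV. \<bar>C1 i\<bar>)" for i by (rule member_le_sum) auto
  moreover have "0 \<le> (\<Sum>i\<in>UNIV. \<bar>C1 i\<bar>)" by (rule sum_nonneg) simp
  ultimately have le: "C0 \<le> C" "C1 i \<le> C" "0 \<le> C" for i
    unfolding C_def by (smt (verit))+
  obtain a where a: "K \<subseteq> cbox (- a) a"
    using bounded_subset_cbox_symmetric[OF compact_imp_bounded[OF K]] by auto
  show thesis
  proof (rule that[of "-a" a C])
    show "\<phi> x = 0" "partial i \<phi> x = 0" if "x \<notin> cbox (- a) a" for x i
      using that a zero pzero by blast+
    show "\<bar>\<phi> x\<bar> \<le> C" "\<bar>partial i \<phi> x\<bar> \<le> C" for x i
      using C0 C1 le by (meson order_trans)+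
  qed (rule le)
qed

lemma test_function_translate:
  assumes "test_function \<phi>"
  shows "test_function (\<lambda>x. \<phi> (x + c))"
proof -
  obtain a b where ab: "\<And>x. x \<notin> cbox a b \<Longrightarrow> \<phi> x = 0" using test_functionE[OF assms] by metis
  show ?thesis
  proof (rule test_functionI)
    show "C_k k (\<lambda>x. \<phi> (x + c))" for k
      using assms by (intro C_k_translate) (auto simp: test_function_def)
    show "x \<notin> cbox (a - c) (b - c) \<Longrightarrow> \<phi> (x + c) = 0" for x
      by (rule ab) (auto simp: mem_box_cart algebra_simps)
  qed
qed

lemma test_function_measurable:
  assumes "test_function \<phi>"
  shows "\<phi> \<in> borel_measurable borel" "partial i \<phi> \<in> borel_measurable borel"
proof -
  have "C_k 0 \<phi>" "C_k (Suc 0) \<phi>" using assms unfolding test_function_def by blast+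
  then have "continuous_on UNIV \<phi>" "continuous_on UNIV (partial i \<phi>)" by simp_all
  then show "\<phi> \<in> borel_measurable borel" "partial i \<phi> \<in> borel_measurable borel"
    by (simp_all add: borel_measurable_continuous_onI)
qed

lemma test_function_DERIV_line:
  assumes "test_function \<phi>"
  shows "((\<lambda>s. \<phi> (x - s *\<^sub>R axis i 1)) has_real_derivative - partial i \<phi> (x - s *\<^sub>R axis i 1)) (at s)"
proof -
  let ?D = "frechet_derivative \<phi> (at (x - s *\<^sub>R axis i 1))"
  have "\<phi> differentiable (at (x - s *\<^sub>R axis i 1))"
  proof -
    have "C_k (Suc 0) \<phi>" using assms unfolding test_function_def by blast
    then show ?thesis by simp
  qed
  then have D: "(\<phi> has_derivative ?D) (at (x - s *\<^sub>R axis i 1))"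
    by (simp add: frechet_derivative_works)
  have "((\<lambda>s. \<phi> (x - s *\<^sub>R axis i 1)) has_derivative (\<lambda>v. ?D (- (v *\<^sub>R axis i 1)))) (at s)"
    by (rule has_derivative_compose[where g = \<phi> and f = "\<lambda>s. x - s *\<^sub>R axis i 1"])
       (auto intro!: derivative_eq_intros D)
  moreover have "?D (- (v *\<^sub>R axis i 1)) = - partial i \<phi> (x - s *\<^sub>R axis i 1) * v" for v
    using has_derivative_linear[OF D] by (simp add: partial_def linear_neg linear_scale)
  ultimately have "((\<lambda>s. \<phi> (x - s *\<^sub>R axis i 1)) has_derivative
      (\<lambda>v. - partial i \<phi> (x - s *\<^sub>R axis i 1) * v)) (at s)" by simp
  then show ?thesis by (simp only: has_field_derivative_def)
qed

section \<open>Increments of functions with a weak derivative\<close>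

lemma ex_borel_version:
  fixes w :: "'a::euclidean_space \<Rightarrow> complex"
  assumes "w \<in> borel_measurable lebesgue"
  obtains w' where "w' \<in> borel_measurable borel" "AE x in lborel. w x = w' x"
proof -
  have "(\<lambda>x. Re (w x)) \<in> borel_measurable lebesgue" "(\<lambda>x. Im (w x)) \<in> borel_measurable lebesgue"
    using assms by (auto intro: borel_measurable_continuous_on[OF _ assms] continuous_intros)
  from this[THEN completion_ex_borel_measurable_real]
  obtain u v where "u \<in> borel_measurable borel" "AE x in lborel. Re (w x) = u x"
    "v \<in> borel_measurable borel" "AE x in lborel. Im (w x) = v x" by auto
  then show thesis
    by (intro that[of "\<lambda>x. Complex (u x) (v x)"])
       (auto simp: complex_eq_iff intro!: borel_measurable_complex_iff[THEN iffD2])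
qed

text \<open>The Cauchy-Schwarz inequality against the constant 1 on the interval, by expanding the
  square of \<open>u\<close> minus its mean.\<close>

lemma square_integral_interval_le:
  fixes u :: "real \<Rightarrow> real"
  assumes [measurable]: "u \<in> borel_measurable borel" and h: "0 < h"
    and sq: "integrable lborel (\<lambda>s. indicator {0..h} s * (u s)\<^sup>2)"
  shows "integrable lborel (\<lambda>s. indicator {0..h} s * u s)"
    and "(LBINT s. indicator {0..h} s * u s)\<^sup>2 \<le> h * (LBINT s. indicator {0..h} s * (u s)\<^sup>2)"
proof -
  have one: "integrable lborel (indicat_real {0..h})" using h by (intro integrable_real_indicator) auto
  show int: "integrable lborel (\<lambda>s. indicator {0..h} s * u s)"
  proof (rule Bochner_Integration.integrable_bound[OF Bochner_Integration.integrable_add[OF one sq]])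
    have "\<bar>v\<bar> \<le> 1 + v\<^sup>2" for v :: real
      using sum_squares_bound[of 1 "\<bar>v\<bar>"] by simp
    then show "AE x in lborel. norm (indicat_real {0..h} x * u x) \<le> norm (indicat_real {0..h} x + indicat_real {0..h} x * (u x)\<^sup>2)"
      by (intro AE_I2) (auto simp: indicator_def)
  qed auto
  let ?A = "LBINT s. indicator {0..h} s * u s" and ?B = "LBINT s. indicator {0..h} s * (u s)\<^sup>2"
  define c where "c = ?A / h"
  have "0 \<le> (LBINT s. indicator {0..h} s * (u s - c)\<^sup>2)"
    by (intro Bochner_Integration.integral_nonneg) auto
  also have "\<dots> = (LBINT s. indicator {0..h} s * (u s)\<^sup>2 - 2 * c * (indicator {0..h} s * u s) + c\<^sup>2 * indicator {0..h} s)"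
    by (intro Bochner_Integration.integral_cong) (auto simp: power2_diff algebra_simps)
  also have "\<dots> = ?B - 2 * c * ?A + c\<^sup>2 * h"
    using int sq one h by simp
  also have "\<dots> = ?B - ?A\<^sup>2 / h"
    using h by (simp add: c_def field_simps power2_eq_square)
  finally show "?A\<^sup>2 \<le> h * ?B" using h by (simp add: field_simps)
qed

lemma norm_le_1_plus_square: "norm (v::'a::real_normed_vector) \<le> 1 + (norm v)\<^sup>2"
proof -
  have "2 * norm v \<le> 1 + (norm v)\<^sup>2" using sum_squares_bound[of 1 "norm v"] by simp
  then show ?thesis using norm_ge_zero[of v] by linarith
qed

lemma integrable_bounded_support:
  fixes k :: "'a::euclidean_space \<Rightarrow> complex"
  assumes [measurable]: "k \<in> borel_measurable borel" "B \<in> borel_measurable borel"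
    and sq: "integrable lborel (\<lambda>x. (cmod (k x))\<^sup>2)"
    and B: "\<And>x. \<bar>B x\<bar> \<le> C * indicator (cbox a b) x"
  shows "integrable lborel (\<lambda>x. B x *\<^sub>R k x)"
proof (rule Bochner_Integration.integrable_bound)
  show "integrable lborel (\<lambda>x. C * (indicator (cbox a b) x + (cmod (k x))\<^sup>2))"
    using sq by (intro Bochner_Integration.integrable_mult_right Bochner_Integration.integrable_add integrable_real_indicator)
       (auto simp: emeasure_lborel_cbox_eq)
  show "AE x in lborel. norm (B x *\<^sub>R k x) \<le> norm (C * (indicator (cbox a b) x + (cmod (k x))\<^sup>2))"
  proof (rule AE_I2)
    fix x
    have "0 \<le> C * indicator (cbox a b) x" using B[of x] by linarith
    then have "\<bar>B x\<bar> * cmod (k x) \<le> (C * indicator (cbox a b) x) * (1 + (cmod (k x))\<^sup>2)"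
      by (intro mult_mono B norm_le_1_plus_square) auto
    also have "\<dots> \<le> \<bar>C * (indicator (cbox a b) x + (cmod (k x))\<^sup>2)\<bar>"
      by (auto simp: indicator_def)
    finally show "norm (B x *\<^sub>R k x) \<le> norm (C * (indicator (cbox a b) x + (cmod (k x))\<^sup>2))" by simp
  qed
qed simp

text \<open>Supplies the joint integrability for the two uses of Fubini in
  \<open>weak_partial_increment\<close>. Since \<open>k\<close> is only square integrable, the
  majorant comes from |k| \<le> 1 + |k|^2 on the bounded support.\<close>

lemma integrable_pair_bounded_support:
  fixes k :: "'a::euclidean_space \<Rightarrow> complex" and B :: "real \<Rightarrow> 'a \<Rightarrow> real"
  assumes [measurable]: "k \<in> borel_measurable borel" "case_prod B \<in> borel_measurable (borel \<Otimes>\<^sub>M borel)"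
    and sq: "integrable lborel (\<lambda>x. (cmod (k x))\<^sup>2)"
    and C: "0 \<le> C" and h: "0 < h"
    and B: "\<And>s x. \<bar>B s x\<bar> \<le> C * (indicator {0..h} s * indicator (cbox a b) x)"
  shows "integrable (lborel \<Otimes>\<^sub>M lborel) (\<lambda>(s, x). B s x *\<^sub>R k (x + s *\<^sub>R c))"
proof (rule integrableI_bounded)
  have meas [measurable]: "(\<lambda>p. B (fst p) (snd p)) \<in> borel_measurable (lborel \<Otimes>\<^sub>M lborel)"
    using assms(2) by (simp add: case_prod_beta' measurable_cong_sets[OF sets_pair_measure_cong[OF sets_lborel sets_lborel]])
  show "(\<lambda>(s, x). B s x *\<^sub>R k (x + s *\<^sub>R c)) \<in> borel_measurable (lborel \<Otimes>\<^sub>M lborel)"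
    unfolding case_prod_beta' by measurable
  have le: "ennreal (norm (B s x *\<^sub>R k (x + s *\<^sub>R c))) \<le>
     ennreal C * (indicator {0..h} s * (indicator (cbox a b) x + ennreal ((cmod (k (x + s *\<^sub>R c)))\<^sup>2)))" for s x
  proof -
    have "\<bar>B s x\<bar> * cmod (k (x + s *\<^sub>R c)) \<le> C * (indicator {0..h} s * indicator (cbox a b) x) * (1 + (cmod (k (x + s *\<^sub>R c)))\<^sup>2)"
      using C by (intro mult_mono B norm_le_1_plus_square) auto
    also have "\<dots> \<le> C * (indicator {0..h} s * (indicator (cbox a b) x + (cmod (k (x + s *\<^sub>R c)))\<^sup>2))"
      using C by (auto simp: indicator_def)
    finally have "ennreal (norm (B s x *\<^sub>R k (x + s *\<^sub>R c))) \<le>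
       ennreal (C * (indicator {0..h} s * (indicator (cbox a b) x + (cmod (k (x + s *\<^sub>R c)))\<^sup>2)))"
      by (intro ennreal_leI) simp
    also have "\<dots> = ennreal C * (indicator {0..h} s * (indicator (cbox a b) x + ennreal ((cmod (k (x + s *\<^sub>R c)))\<^sup>2)))"
      using C by (auto simp: ennreal_mult' indicator_def ennreal_plus simp del: ennreal_1 simp flip: ennreal_1)
    finally show ?thesis .
  qed
  have "(\<integral>\<^sup>+p. ennreal (norm (case p of (s, x) \<Rightarrow> B s x *\<^sub>R k (x + s *\<^sub>R c))) \<partial>(lborel \<Otimes>\<^sub>M lborel)) =
     (\<integral>\<^sup>+s. \<integral>\<^sup>+x. ennreal (norm (B s x *\<^sub>R k (x + s *\<^sub>R c))) \<partial>lborel \<partial>lborel)"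
    by (subst lborel.nn_integral_fst[symmetric]) (simp_all add: case_prod_beta')
  also have "\<dots> \<le> (\<integral>\<^sup>+s. \<integral>\<^sup>+x. ennreal C * (indicator {0..h} s * (indicator (cbox a b) x + ennreal ((cmod (k (x + s *\<^sub>R c)))\<^sup>2))) \<partial>lborel \<partial>lborel)"
    by (intro nn_integral_mono le)
  also have "\<dots> = (\<integral>\<^sup>+s. ennreal C * (indicator {0..h} s * (emeasure lborel (cbox a b) + (\<integral>\<^sup>+x. ennreal ((cmod (k x))\<^sup>2) \<partial>lborel))) \<partial>lborel)"
    by (intro nn_integral_cong)
       (simp add: nn_integral_cmult nn_integral_add nn_integral_lborel_translate[of "\<lambda>x. ennreal ((cmod (k x))\<^sup>2)"])
  also have "\<dots> = ennreal C * (ennreal h * (emeasure lborel (cbox a b) + (\<integral>\<^sup>+x. ennreal ((cmod (k x))\<^sup>2) \<partial>lborel)))"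
    using h by (simp add: nn_integral_cmult nn_integral_multc)
  also have "\<dots> < \<infinity>"
    using sq by (auto simp: integrable_iff_bounded emeasure_lborel_cbox_eq ennreal_mult_less_top)
  finally show "(\<integral>\<^sup>+p. ennreal (norm (case p of (s, x) \<Rightarrow> B s x *\<^sub>R k (x + s *\<^sub>R c))) \<partial>(lborel \<Otimes>\<^sub>M lborel)) < \<infinity>" .
qed

text \<open>Almost everywhere \<psi>(x + h e) - \<psi>(x) is the integral \<open>G\<close> of
  \<open>g\<close> over the segment from x to x + h e. Cauchy-Schwarz on the segment and Fubini then
  bound the square integral. The identity is obtained in weak form: its error \<open>w\<close> is
  orthogonal to all test functions.\<close>

lemma weak_partial_increment:
  fixes \<psi> g :: "real^'n::finite \<Rightarrow> complex"
  assumes [measurable]: "\<psi> \<in> borel_measurable borel" "g \<in> borel_measurable borel"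
    and sq: "integrable lborel (\<lambda>x. (cmod (\<psi> x))\<^sup>2)" "integrable lborel (\<lambda>x. (cmod (g x))\<^sup>2)"
    and weak: "\<And>\<phi>. test_function \<phi> \<Longrightarrow>
        (LBINT x. partial i \<phi> x *\<^sub>R \<psi> x) = - (LBINT x. \<phi> x *\<^sub>R g x)"
    and h: "0 < h"
  defines "e \<equiv> axis i 1 :: real^'n"
  defines "G \<equiv> \<lambda>x. LBINT s. indicator {0..h} s *\<^sub>R g (x + s *\<^sub>R e)"
  shows "(\<integral>\<^sup>+x. ennreal ((cmod (\<psi> (x + h *\<^sub>R e) - \<psi> x))\<^sup>2) \<partial>lborel) \<le> ennreal (h\<^sup>2 * (LBINT x. (cmod (g x))\<^sup>2))"
proof -
  have [measurable]: "G \<in> borel_measurable borel"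
    unfolding G_def by measurable
  have slab: "(\<integral>\<^sup>+x. (\<integral>\<^sup>+s. indicator {0..h} s * ennreal ((cmod (g (x + s *\<^sub>R e)))\<^sup>2) \<partial>lborel) \<partial>lborel) =
     ennreal (h * (LBINT x. (cmod (g x))\<^sup>2))"
    using h sq(2)
    by (subst nn_integral_lines[of "\<lambda>x. ennreal ((cmod (g x))\<^sup>2)" "indicator {0..h}"])
       (auto simp: ennreal_mult nn_integral_eq_integral)
  have fin: "AE x in lborel. (\<integral>\<^sup>+s. indicator {0..h} s * ennreal ((cmod (g (x + s *\<^sub>R e)))\<^sup>2) \<partial>lborel) \<noteq> \<infinity>"
    by (rule nn_integral_PInf_AE) (auto simp: slab)
  have Gle: "AE x in lborel. ennreal ((cmod (G x))\<^sup>2) \<le> ennreal h * (\<integral>\<^sup>+s. indicator {0..h} s * ennreal ((cmod (g (x + s *\<^sub>R e)))\<^sup>2) \<partial>lborel)"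
    using fin
  proof eventually_elim
    case (elim x)
    have eq: "indicator {0..h} s * ennreal ((cmod (g (x + s *\<^sub>R e)))\<^sup>2) = ennreal (indicator {0..h} s * (cmod (g (x + s *\<^sub>R e)))\<^sup>2)" for s
      by (auto simp: indicator_def)
    have int: "integrable lborel (\<lambda>s. indicator {0..h} s * (cmod (g (x + s *\<^sub>R e)))\<^sup>2)"
      using elim by (intro integrableI_nonneg) (auto simp: eq top.not_eq_extremum)
    have "cmod (G x) \<le> (LBINT s. indicator {0..h} s * cmod (g (x + s *\<^sub>R e)))"
      unfolding G_def by (rule order_trans[OF integral_norm_bound]) simp
    then have "(cmod (G x))\<^sup>2 \<le> (LBINT s. indicator {0..h} s * cmod (g (x + s *\<^sub>R e)))\<^sup>2"
      by (intro power_mono) auto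
    also have "\<dots> \<le> h * (LBINT s. indicator {0..h} s * (cmod (g (x + s *\<^sub>R e)))\<^sup>2)"
      using int h by (intro square_integral_interval_le(2)) measurable
    finally have "ennreal ((cmod (G x))\<^sup>2) \<le> ennreal (h * (LBINT s. indicator {0..h} s * (cmod (g (x + s *\<^sub>R e)))\<^sup>2))"
      by (rule ennreal_leI)
    also have "\<dots> = ennreal h * (\<integral>\<^sup>+s. ennreal (indicator {0..h} s * (cmod (g (x + s *\<^sub>R e)))\<^sup>2) \<partial>lborel)"
      using h int by (subst nn_integral_eq_integral) (auto simp: ennreal_mult')
    finally show ?case by (simp add: eq)
  qed
  have Gsq: "(\<integral>\<^sup>+x. ennreal ((cmod (G x))\<^sup>2) \<partial>lborel) \<le> ennreal (h\<^sup>2 * (LBINT x. (cmod (g x))\<^sup>2))"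
  proof -
    have "(\<integral>\<^sup>+x. ennreal ((cmod (G x))\<^sup>2) \<partial>lborel) \<le>
       (\<integral>\<^sup>+x. ennreal h * (\<integral>\<^sup>+s. indicator {0..h} s * ennreal ((cmod (g (x + s *\<^sub>R e)))\<^sup>2) \<partial>lborel) \<partial>lborel)"
      by (rule nn_integral_mono_AE[OF Gle])
    also have "\<dots> = ennreal h * ennreal (h * (LBINT x. (cmod (g x))\<^sup>2))"
      by (subst nn_integral_cmult) (simp_all add: slab)
    also have "\<dots> = ennreal (h\<^sup>2 * (LBINT x. (cmod (g x))\<^sup>2))"
      using h by (simp add: ennreal_mult[symmetric] power2_eq_square mult.assoc)
    finally show ?thesis .
  qed
  have Gint: "integrable lborel (\<lambda>x. (cmod (G x))\<^sup>2)"
    using Gsq by (intro integrableI_nonneg) (auto intro: le_less_trans)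
  define w where "w = (\<lambda>x. \<psi> (x + h *\<^sub>R e) - \<psi> x - G x)"
  have [measurable]: "w \<in> borel_measurable borel" unfolding w_def by measurable
  have shift: "integrable lborel (\<lambda>x. (cmod (\<psi> (x + h *\<^sub>R e)))\<^sup>2)"
    by (rule integrable_lborel_translate[OF sq(1)])
  have wint: "integrable lborel (\<lambda>x. (cmod (w x))\<^sup>2)"
  proof (rule Bochner_Integration.integrable_bound)
    show "integrable lborel (\<lambda>x. 3 * ((cmod (\<psi> (x + h *\<^sub>R e)))\<^sup>2 + (cmod (\<psi> x))\<^sup>2 + (cmod (G x))\<^sup>2))"
      by (intro Bochner_Integration.integrable_mult_right Bochner_Integration.integrable_add shift sq Gint)
    have "(cmod (u - v - z))\<^sup>2 \<le> 3 * ((cmod u)\<^sup>2 + (cmod v)\<^sup>2 + (cmod z)\<^sup>2)" for u v z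
    proof -
      have "cmod (u - v - z) \<le> cmod u + cmod v + cmod z"
        using norm_triangle_ineq4[of "u - v" z] norm_triangle_ineq4[of u v] by linarith
      then have "(cmod (u - v - z))\<^sup>2 \<le> (cmod u + cmod v + cmod z)\<^sup>2" by (intro power_mono) auto
      also have "\<dots> \<le> 3 * ((cmod u)\<^sup>2 + (cmod v)\<^sup>2 + (cmod z)\<^sup>2)"
        using zero_le_power2[of "cmod u - cmod v"] zero_le_power2[of "cmod u - cmod z"] zero_le_power2[of "cmod v - cmod z"]
        by (simp add: power2_eq_square algebra_simps)
      finally show ?thesis .
    qed
    then show "AE x in lborel. norm ((cmod (w x))\<^sup>2) \<le> norm (3 * ((cmod (\<psi> (x + h *\<^sub>R e)))\<^sup>2 + (cmod (\<psi> x))\<^sup>2 + (cmod (G x))\<^sup>2))"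
      unfolding w_def by (intro AE_I2) auto
  qed simp
  have orth: "(LBINT x. \<phi> x *\<^sub>R w x) = 0" if \<phi>: "test_function \<phi>" for \<phi>
  proof -
    obtain a b C where C: "\<And>x. x \<notin> cbox a b \<Longrightarrow> \<phi> x = 0" "\<And>x i. x \<notin> cbox a b \<Longrightarrow> partial i \<phi> x = 0"
      "\<And>x. \<bar>\<phi> x\<bar> \<le> C" "\<And>x i. \<bar>partial i \<phi> x\<bar> \<le> C" "0 \<le> C"
      using test_functionE[OF \<phi>] by metis
    have [measurable]: "\<phi> \<in> borel_measurable borel" "partial i \<phi> \<in> borel_measurable borel"
      by (rule test_function_measurable[OF \<phi>])+
    have bd: "\<bar>\<phi> x\<bar> \<le> C * indicator (cbox a b) x" for x
      using C(1,3)[of x] by (auto simp: indicator_def)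
    have in_box: "x \<in> cbox a (b + h *\<^sub>R e)" if "x - s *\<^sub>R e \<in> cbox a b" "0 \<le> s" "s \<le> h" for x s
    proof -
      have "a $ j \<le> x $ j \<and> x $ j \<le> b $ j + h * e $ j" for j
      proof -
        have "0 \<le> s * e $ j" "s * e $ j \<le> h * e $ j"
          using that by (auto simp: e_def axis_def)
        moreover have "a $ j \<le> x $ j - s * e $ j" "x $ j - s * e $ j \<le> b $ j"
          using that(1) by (simp_all add: mem_box_cart)
        ultimately show ?thesis by linarith
      qed
      then show ?thesis by (simp add: mem_box_cart)
    qed
    have bd': "\<bar>indicator {0..h} s * partial i \<phi> (x - s *\<^sub>R e)\<bar> \<le> C * (indicator {0..h} s * indicator (cbox a (b + h *\<^sub>R e)) x)" for s x
      using C(4)[of i "x - s *\<^sub>R e"] C(2)[of "x - s *\<^sub>R e" i] in_box[of x s] C(5)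
      by (auto simp: indicator_def)
    have bd'': "\<bar>\<phi> (x - h *\<^sub>R e)\<bar> \<le> C * indicator (cbox a (b + h *\<^sub>R e)) x" for x
      using C(1,3)[of "x - h *\<^sub>R e"] in_box[of x h] h by (auto simp: indicator_def)
    have i1: "integrable lborel (\<lambda>x. \<phi> x *\<^sub>R \<psi> x)" "integrable lborel (\<lambda>x. \<phi> x *\<^sub>R G x)"
       "integrable lborel (\<lambda>x. \<phi> x *\<^sub>R \<psi> (x + h *\<^sub>R e))"
      using bd by (auto intro!: integrable_bounded_support sq Gint shift)
    have i2: "integrable lborel (\<lambda>x. \<phi> (x - h *\<^sub>R e) *\<^sub>R \<psi> x)"
      using bd'' by (auto intro!: integrable_bounded_support sq)
    have F1: "(LBINT x. \<phi> x *\<^sub>R G x) = (LBINT s. indicator {0..h} s *\<^sub>R (LBINT x. \<phi> x *\<^sub>R g (x + s *\<^sub>R e)))"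
    proof -
      have "integrable (lborel \<Otimes>\<^sub>M lborel) (\<lambda>(s, x). (indicator {0..h} s * \<phi> x) *\<^sub>R g (x + s *\<^sub>R e))"
        by (rule integrable_pair_bounded_support[where C=C and h=h and a=a and b=b])
           (use bd C(5) h sq in \<open>auto simp: abs_mult indicator_def\<close>)
      from lborel_pair.Fubini_integral[OF this]
      have "(LBINT x. LBINT s. (indicator {0..h} s * \<phi> x) *\<^sub>R g (x + s *\<^sub>R e)) =
        (LBINT s. LBINT x. (indicator {0..h} s * \<phi> x) *\<^sub>R g (x + s *\<^sub>R e))" .
      moreover have "(LBINT s. (indicator {0..h} s * \<phi> x) *\<^sub>R g (x + s *\<^sub>R e)) = \<phi> x *\<^sub>R G x" for x
        unfolding G_def by (subst Bochner_Integration.integral_scaleR_right[symmetric]) (simp add: mult.commute)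
      moreover have "(LBINT x. (indicator {0..h} s * \<phi> x) *\<^sub>R g (x + s *\<^sub>R e)) =
          indicator {0..h} s *\<^sub>R (LBINT x. \<phi> x *\<^sub>R g (x + s *\<^sub>R e))" for s
        by (subst Bochner_Integration.integral_scaleR_right[symmetric]) simp
      ultimately show ?thesis by simp
    qed
    \<comment> \<open>The increment is moved onto the test function, where it is a classical
      integral of the derivative along the segment.\<close>
    have F2: "(LBINT x. (\<phi> (x - h *\<^sub>R e) - \<phi> x) *\<^sub>R \<psi> x) =
      (LBINT s. indicator {0..h} s *\<^sub>R - (LBINT x. partial i \<phi> (x - s *\<^sub>R e) *\<^sub>R \<psi> x))"
    proof -
      have "integrable (lborel \<Otimes>\<^sub>M lborel) (\<lambda>(s, x). (indicator {0..h} s * partial i \<phi> (x - s *\<^sub>R e)) *\<^sub>R \<psi> (x + s *\<^sub>R 0))"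
        by (rule integrable_pair_bounded_support[where C=C and h=h and a=a and b="b + h *\<^sub>R e"])
           (use bd' C(5) h sq in auto)
      from lborel_pair.Fubini_integral[OF this]
      have "(LBINT x. LBINT s. (indicator {0..h} s * partial i \<phi> (x - s *\<^sub>R e)) *\<^sub>R \<psi> x) =
        (LBINT s. LBINT x. (indicator {0..h} s * partial i \<phi> (x - s *\<^sub>R e)) *\<^sub>R \<psi> x)" by simp
      moreover have "(LBINT s. (indicator {0..h} s * partial i \<phi> (x - s *\<^sub>R e)) *\<^sub>R \<psi> x) =
          - ((\<phi> (x - h *\<^sub>R e) - \<phi> x) *\<^sub>R \<psi> x)" for x
      proof -
        have cont: "isCont (\<lambda>s. - partial i \<phi> (x - s *\<^sub>R e)) s" for s
        proof -
          have "continuous_on UNIV (partial i \<phi>)"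
            using \<phi> unfolding test_function_def by (metis C_k.simps)
          then show ?thesis
            by (intro continuous_intros continuous_at_compose[of _ "\<lambda>s. x - s *\<^sub>R e" "partial i \<phi>", unfolded o_def])
               (auto simp: continuous_on_eq_continuous_at)
        qed
        have "has_bochner_integral lborel (\<lambda>s. - partial i \<phi> (x - s *\<^sub>R e) * indicator {0..h} s)
           (\<phi> (x - h *\<^sub>R e) - \<phi> (x - 0 *\<^sub>R e))"
          using h cont test_function_DERIV_line[OF \<phi>, of x i]
          by (intro has_bochner_integral_FTC_Icc_real) (auto simp: e_def)
        then have "(LBINT s. - (indicator {0..h} s * partial i \<phi> (x - s *\<^sub>R e))) = \<phi> (x - h *\<^sub>R e) - \<phi> x"
          by (subst (asm) has_bochner_integral_iff) (simp add: mult.commute)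
        then have "(LBINT s. indicator {0..h} s * partial i \<phi> (x - s *\<^sub>R e)) = - (\<phi> (x - h *\<^sub>R e) - \<phi> x)"
          by simp
        moreover have "integrable lborel (\<lambda>s. indicator {0..h} s * partial i \<phi> (x - s *\<^sub>R e))"
          using \<open>has_bochner_integral lborel _ _\<close>[THEN has_bochner_integral_minus]
          by (auto simp: has_bochner_integral_iff mult.commute)
        ultimately show ?thesis
          by (subst Bochner_Integration.integral_scaleR_left) (auto simp: scaleR_diff_left)
      qed
      moreover have "(LBINT x. (indicator {0..h} s * partial i \<phi> (x - s *\<^sub>R e)) *\<^sub>R \<psi> x) =
         - (indicator {0..h} s *\<^sub>R - (LBINT x. partial i \<phi> (x - s *\<^sub>R e) *\<^sub>R \<psi> x))" for s
        by (simp add: Bochner_Integration.integral_scaleR_right[symmetric] del: Bochner_Integration.integral_scaleR_right)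
      ultimately have "- (LBINT x. (\<phi> (x - h *\<^sub>R e) - \<phi> x) *\<^sub>R \<psi> x) =
        (LBINT s. indicator {0..h} s *\<^sub>R (LBINT x. partial i \<phi> (x - s *\<^sub>R e) *\<^sub>R \<psi> x))" by simp
      from iffD1[OF minus_equation_iff this] show ?thesis
        unfolding scaleR_minus_right Bochner_Integration.integral_minus by (rule sym)
    qed
    \<comment> \<open>The weak derivative is tested with a translate of \<open>\<phi>\<close>; a
      change of variables then moves the shift onto \<open>g\<close>.\<close>
    have inner: "- (LBINT x. partial i \<phi> (x - s *\<^sub>R e) *\<^sub>R \<psi> x) = (LBINT x. \<phi> x *\<^sub>R g (x + s *\<^sub>R e))" for s
    proof -
      have "C_k (Suc 0) \<phi>" using \<phi> unfolding test_function_def by blast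
      then have "partial i (\<lambda>x. \<phi> (x + - (s *\<^sub>R e))) y = partial i \<phi> (y - s *\<^sub>R e)" for y
        by (subst partial_translate(2)) auto
      then have "partial i (\<lambda>x. \<phi> (x + - (s *\<^sub>R e))) = (\<lambda>x. partial i \<phi> (x - s *\<^sub>R e))" ..
      with weak[OF test_function_translate[OF \<phi>, of "- (s *\<^sub>R e)"]]
      have "- (LBINT x. partial i \<phi> (x - s *\<^sub>R e) *\<^sub>R \<psi> x) = (LBINT x. \<phi> (x - s *\<^sub>R e) *\<^sub>R g x)" by simp
      also have "\<dots> = (LBINT x. \<phi> (x + s *\<^sub>R e - s *\<^sub>R e) *\<^sub>R g (x + s *\<^sub>R e))"
        by (rule integral_lborel_translate[symmetric]) measurable
      finally show ?thesis by simp
    qed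
    have "(LBINT x. \<phi> x *\<^sub>R w x) = (LBINT x. \<phi> x *\<^sub>R \<psi> (x + h *\<^sub>R e)) - (LBINT x. \<phi> x *\<^sub>R \<psi> x) - (LBINT x. \<phi> x *\<^sub>R G x)"
      using i1 by (simp add: w_def scaleR_diff_right)
    also have "(LBINT x. \<phi> x *\<^sub>R \<psi> (x + h *\<^sub>R e)) = (LBINT x. \<phi> (x - h *\<^sub>R e) *\<^sub>R \<psi> x)"
      using integral_lborel_translate[of "\<lambda>x. \<phi> (x - h *\<^sub>R e) *\<^sub>R \<psi> x" "h *\<^sub>R e"] by simp
    also have "\<dots> - (LBINT x. \<phi> x *\<^sub>R \<psi> x) = (LBINT x. (\<phi> (x - h *\<^sub>R e) - \<phi> x) *\<^sub>R \<psi> x)"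
      using i1 i2 by (simp add: scaleR_diff_left)
    also have "\<dots> = (LBINT x. \<phi> x *\<^sub>R G x)"
      unfolding F1 F2 inner ..
    finally show ?thesis by simp
  qed
  have "AE x in lebesgue. w x = 0"
  proof (rule AE_eq_0_if_orthogonal_to_test_functions)
    show "w \<in> borel_measurable lebesgue" by (rule measurable_completion) simp
    show "integrable lebesgue (\<lambda>x. (cmod (w x))\<^sup>2)" using wint by (simp add: integrable_completion)
    fix \<phi> :: "real^'n \<Rightarrow> real" assume \<phi>: "test_function \<phi>"
    have [measurable]: "\<phi> \<in> borel_measurable borel" by (rule test_function_measurable[OF \<phi>])
    show "(LINT x|lebesgue. \<phi> x *\<^sub>R w x) = 0"
      using orth[OF \<phi>] by (simp add: integral_completion)
  qed
  then have "AE x in lborel. w x = 0" by (simp add: AE_completion_iff)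
  then have "AE x in lborel. \<psi> (x + h *\<^sub>R e) - \<psi> x = G x"
    by eventually_elim (simp add: w_def)
  then have "(\<integral>\<^sup>+x. ennreal ((cmod (\<psi> (x + h *\<^sub>R e) - \<psi> x))\<^sup>2) \<partial>lborel) = (\<integral>\<^sup>+x. ennreal ((cmod (G x))\<^sup>2) \<partial>lborel)"
    by (intro nn_integral_cong_AE) auto
  with Gsq show ?thesis by simp
qed

text \<open>\<open>\<psi>'\<close> is a Borel representative of \<open>\<psi>\<close>. Composition
  with (x, s) \<mapsto> x + s e preserves Borel measurability, whereas for a Lebesgue measurable
  function measurability on the product can fail.\<close>

lemma has_weak_partial_increment:
  fixes \<psi> \<psi>' g :: "real^'n::finite \<Rightarrow> complex"
  assumes L2: "\<psi> \<in> L2" "g \<in> L2" and weak: "has_weak_partial i \<psi> g"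
    and [measurable]: "\<psi>' \<in> borel_measurable borel" and eq: "AE x in lborel. \<psi> x = \<psi>' x"
    and h: "0 < h"
  shows "(\<integral>\<^sup>+x. ennreal ((cmod (\<psi>' (x + h *\<^sub>R axis i 1) - \<psi>' x))\<^sup>2) \<partial>lborel) \<le>
    ennreal (h\<^sup>2 * (LINT x|lebesgue. (cmod (g x))\<^sup>2))"
proof -
  have [measurable]: "\<psi> \<in> borel_measurable lebesgue" "g \<in> borel_measurable lebesgue" using L2 by (auto simp: L2_def)
  obtain g' where g' [measurable]: "g' \<in> borel_measurable borel" "AE x in lborel. g x = g' x"
    using ex_borel_version[of g] by auto
  note ae = AE_completion[OF eq] AE_completion[OF g'(2)]
  have m [measurable]: "g' \<in> borel_measurable lebesgue" "\<psi>' \<in> borel_measurable lebesgue"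
    by (auto intro: measurable_completion)
  have "integrable lebesgue (\<lambda>x. (cmod (\<psi>' x))\<^sup>2)"
    by (rule integrable_cong_AE_imp[of _ "\<lambda>x. (cmod (\<psi> x))\<^sup>2"]) (use L2 ae(1) in \<open>auto simp: L2_def elim!: eventually_mono\<close>)
  moreover have "integrable lebesgue (\<lambda>x. (cmod (g' x))\<^sup>2)"
    by (rule integrable_cong_AE_imp[of _ "\<lambda>x. (cmod (g x))\<^sup>2"]) (use L2 ae(2) in \<open>auto simp: L2_def elim!: eventually_mono\<close>)
  ultimately have sq: "integrable lborel (\<lambda>x. (cmod (\<psi>' x))\<^sup>2)" "integrable lborel (\<lambda>x. (cmod (g' x))\<^sup>2)"
    by (simp_all add: integrable_completion)
  have "(LINT x|lebesgue. (cmod (g x))\<^sup>2) = (LINT x|lebesgue. (cmod (g' x))\<^sup>2)"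
    by (rule integral_cong_AE) (use ae(2) in \<open>auto elim!: eventually_mono\<close>)
  also have "\<dots> = (LBINT x. (cmod (g' x))\<^sup>2)" by (simp add: integral_completion)
  finally have eqint: "(LINT x|lebesgue. (cmod (g x))\<^sup>2) = (LBINT x. (cmod (g' x))\<^sup>2)" .
  show ?thesis unfolding eqint
  proof (rule weak_partial_increment[OF _ _ sq _ h])
    fix \<phi> :: "real^'n \<Rightarrow> real" assume \<phi>: "test_function \<phi>"
    have [measurable]: "\<phi> \<in> borel_measurable borel" "partial i \<phi> \<in> borel_measurable borel"
      by (rule test_function_measurable[OF \<phi>])+
    have m' [measurable]: "\<phi> \<in> borel_measurable lebesgue" "partial i \<phi> \<in> borel_measurable lebesgue"
      by (auto intro: measurable_completion)
    have "(LBINT x. partial i \<phi> x *\<^sub>R \<psi>' x) = (LINT x|lebesgue. partial i \<phi> x *\<^sub>R \<psi>' x)"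
      by (simp add: integral_completion)
    also have "\<dots> = (LINT x|lebesgue. partial i \<phi> x *\<^sub>R \<psi> x)"
      by (rule integral_cong_AE) (use ae(1) in \<open>auto elim!: eventually_mono\<close>)
    also have "\<dots> = - (LINT x|lebesgue. \<phi> x *\<^sub>R g x)"
      using weak \<phi> by (simp add: has_weak_partial_def)
    also have "(LINT x|lebesgue. \<phi> x *\<^sub>R g x) = (LINT x|lebesgue. \<phi> x *\<^sub>R g' x)"
      by (rule integral_cong_AE) (use ae(2) in \<open>auto elim!: eventually_mono\<close>)
    also have "\<dots> = (LBINT x. \<phi> x *\<^sub>R g' x)"
      by (simp add: integral_completion)
    finally show "(LBINT x. partial i \<phi> x *\<^sub>R \<psi>' x) = - (LBINT x. \<phi> x *\<^sub>R g' x)" .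
  qed simp_all
qed

section \<open>The Gaussian distribution function and differentiation along lines\<close>

text \<open>The normal density of mean 0 and variance t/2. It is the square of the normalized ground
  state of the one-dimensional oscillator with potential y^2 / t^2, which is why it is the target of
  the transport.\<close>

definition gauss :: "real \<Rightarrow> real \<Rightarrow> real" where
  "gauss t y = exp (- y\<^sup>2 / t) / sqrt (pi * t)"

definition gauss_cdf :: "real \<Rightarrow> real \<Rightarrow> real" where
  "gauss_cdf t y = (LBINT s. indicator {..y} s * gauss t s)"

text \<open>The value 0 outside the open unit interval is a default that keeps the function Borel
  measurable.\<close>

definition gauss_quantile :: "real \<Rightarrow> real \<Rightarrow> real" where
  "gauss_quantile t p = (if p \<in> {0<..<1} then the_inv (gauss_cdf t) p else 0)"

lemma gauss_pos: "t > 0 \<Longrightarrow> gauss t y > 0"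
  by (simp add: gauss_def)

lemma gauss_eq_normal_density: "t > 0 \<Longrightarrow> gauss t y = normal_density 0 (sqrt (t / 2)) y"
  by (simp add: gauss_def normal_density_def)

lemma gauss_integrable: "t > 0 \<Longrightarrow> integrable lborel (gauss t)"
  using gauss_eq_normal_density[of t] integrable_normal_density[of "sqrt (t / 2)" 0]
  by (simp cong: Bochner_Integration.integrable_cong)

lemma gauss_integral: "t > 0 \<Longrightarrow> (LBINT y. gauss t y) = 1"
  using gauss_eq_normal_density[of t] integral_normal_density[of "sqrt (t / 2)" 0]
  by (simp cong: Bochner_Integration.integral_cong)

lemma continuous_gauss: "t > 0 \<Longrightarrow> continuous_on A (gauss t)"
  unfolding gauss_def by (intro continuous_intros) auto

lemma gauss_measurable [measurable]: "gauss t \<in> borel_measurable borel"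
  unfolding gauss_def by measurable

lemma indicator_atMost_split:
  "a \<le> y \<Longrightarrow> indicator {..y} (s::real) = (indicator {..a} s + indicator {a<..y} s :: real)"
  by (auto simp: indicator_def)

lemma integral_atMost_diff:
  fixes f :: "real \<Rightarrow> real"
  assumes f: "integrable lborel f" and "a \<le> y"
  shows "(LBINT s. indicator {..y} s * f s) - (LBINT s. indicator {..a} s * f s) =
    (LBINT s. indicator {a<..y} s * f s)"
proof -
  have i: "integrable lborel (\<lambda>s. indicator A s * f s)" if "A \<in> sets borel" for A
    using integrable_mult_indicator[OF _ f, of A] that by simp
  show ?thesis
    by (subst indicator_atMost_split[OF assms(2)]) (simp add: distrib_right i)
qed

text \<open>The fundamental theorem of calculus for a density with a continuous version. Starting at
  y - 1 reduces the half-line to a compact interval.\<close>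

lemma integral_atMost_has_derivative:
  fixes f g :: "real \<Rightarrow> real"
  assumes f: "integrable lborel f" and g: "continuous_on UNIV g" and eq: "AE s in lborel. f s = g s"
  shows "((\<lambda>y. LBINT s. indicator {..y} s * f s) has_real_derivative g y) (at y)"
proof -
  define F where "F = (\<lambda>y. LBINT s. indicator {..y} s * f s)"
  have [measurable]: "f \<in> borel_measurable borel" "g \<in> borel_measurable borel"
    using f g by (auto dest: borel_measurable_integrable intro: borel_measurable_continuous_onI)
  have F: "F z = F (y - 1) + integral {y - 1..z} g" if "y - 1 \<le> z" for z
  proof -
    have "F z - F (y - 1) = (LBINT s. indicator {y - 1<..z} s * f s)"
      unfolding F_def by (rule integral_atMost_diff[OF f that])
    also have "\<dots> = (LBINT s. indicator {y - 1..z} s * g s)"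
      using eq AE_lborel_singleton[of "y - 1"]
      by (intro integral_cong_AE) (auto elim!: eventually_elim2 simp: indicator_def)
    also have "\<dots> = (LINT s:{y - 1..z}|lborel. g s)"
      by (simp add: set_lebesgue_integral_def)
    also have "\<dots> = integral {y - 1..z} g"
      by (rule set_borel_integral_eq_integral)
         (intro borel_integrable_atLeastAtMost' continuous_on_subset[OF g] subset_UNIV)
    finally show ?thesis by simp
  qed
  have "((\<lambda>z. integral {y - 1..z} g) has_real_derivative g y) (at y within {y - 1..y + 1})"
    by (intro integral_has_real_derivative continuous_on_subset[OF g]) auto
  moreover have "at y within {y - 1..y + 1} = at y"
    by (rule at_within_interior) auto
  ultimately have "((\<lambda>z. F (y - 1) + integral {y - 1..z} g) has_real_derivative g y) (at y)"
    using DERIV_add[OF DERIV_const] by (metis add_0)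
  then have "(F has_real_derivative g y) (at y)"
  proof (rule has_field_derivative_transform_within_open)
    show "open {y - 1<..}" "y \<in> {y - 1<..}" by auto
    show "F (y - 1) + integral {y - 1..z} g = F z" if "z \<in> {y - 1<..}" for z
      using that by (intro F[symmetric]) simp
  qed
  then show ?thesis by (simp add: F_def)
qed

context
  fixes t :: real
  assumes t: "t > 0"
begin

lemma gauss_cdf_has_derivative: "(gauss_cdf t has_real_derivative gauss t y) (at y)"
  unfolding gauss_cdf_def[abs_def]
  by (rule integral_atMost_has_derivative) (auto intro: gauss_integrable continuous_gauss t)

lemma gauss_cdf_strict_mono: "x < y \<Longrightarrow> gauss_cdf t x < gauss_cdf t y"
  by (rule DERIV_pos_imp_increasing) (auto intro!: exI gauss_cdf_has_derivative gauss_pos t)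

lemma gauss_cdf_inj: "inj (gauss_cdf t)"
  by (rule injI) (metis gauss_cdf_strict_mono less_irrefl linorder_neqE_linordered_idom)

lemma gauss_cdf_limits:
  "(\<lambda>n. gauss_cdf t (real n)) \<longlonglongrightarrow> 1" "(\<lambda>n. gauss_cdf t (- real n)) \<longlonglongrightarrow> 0"
proof -
  have "(\<lambda>n. LBINT s. indicator {..real n} s * gauss t s) \<longlonglongrightarrow> (LBINT s. gauss t s)"
  proof (rule integral_dominated_convergence[where w = "gauss t"])
    show "AE s in lborel. (\<lambda>n. indicator {..real n} s * gauss t s) \<longlonglongrightarrow> gauss t s"
    proof (rule AE_I2)
      fix s :: real
      obtain N :: nat where "s \<le> real N" using real_arch_simple by blast
      then have "eventually (\<lambda>n. indicator {..real n} s * gauss t s = gauss t s) sequentially"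
        by (intro eventually_sequentiallyI[of N]) (auto simp: indicator_def)
      then show "(\<lambda>n. indicator {..real n} s * gauss t s) \<longlonglongrightarrow> gauss t s"
        by (rule tendsto_eventually)
    qed
  qed (use gauss_pos[OF t] in \<open>auto intro: gauss_integrable t simp: indicator_def less_imp_le\<close>)
  then show "(\<lambda>n. gauss_cdf t (real n)) \<longlonglongrightarrow> 1" by (simp add: gauss_cdf_def gauss_integral t)
  have "(\<lambda>n. LBINT s. indicator {..- real n} s * gauss t s) \<longlonglongrightarrow> (\<integral>s. 0 \<partial>(lborel :: real measure))"
  proof (rule integral_dominated_convergence[where w = "gauss t"])
    show "AE s in lborel. (\<lambda>n. indicator {..- real n} s * gauss t s) \<longlonglongrightarrow> 0"
    proof (rule AE_I2)
      fix s :: real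
      obtain N :: nat where "- s < real N" using reals_Archimedean2 by blast
      then have "eventually (\<lambda>n. indicator {..- real n} s * gauss t s = 0) sequentially"
        by (intro eventually_sequentiallyI[of N]) (auto simp: indicator_def)
      then show "(\<lambda>n. indicator {..- real n} s * gauss t s) \<longlonglongrightarrow> 0"
        by (rule tendsto_eventually)
    qed
  qed (use gauss_pos[OF t] in \<open>auto intro: gauss_integrable t simp: indicator_def less_imp_le\<close>)
  then show "(\<lambda>n. gauss_cdf t (- real n)) \<longlonglongrightarrow> 0" by (simp add: gauss_cdf_def)
qed

lemma gauss_cdf_bounds: "0 < gauss_cdf t y" "gauss_cdf t y < 1"
proof -
  have nn: "0 \<le> gauss_cdf t y" for y
    unfolding gauss_cdf_def using gauss_pos[OF t] by (intro Bochner_Integration.integral_nonneg) (auto simp: less_imp_le)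
  have le1: "gauss_cdf t y \<le> 1" for y
  proof -
    have "gauss_cdf t y \<le> (LBINT s. gauss t s)"
      unfolding gauss_cdf_def using gauss_pos[OF t]
      using integrable_mult_indicator[OF _ gauss_integrable[OF t], of "{..y}"]
      by (intro integral_mono) (auto simp: gauss_integrable t indicator_def less_imp_le)
    then show ?thesis by (simp add: gauss_integral t)
  qed
  show "0 < gauss_cdf t y" using nn[of "y - 1"] gauss_cdf_strict_mono[of "y - 1" y] by simp
  show "gauss_cdf t y < 1" using le1[of "y + 1"] gauss_cdf_strict_mono[of y "y + 1"] by simp
qed

lemma gauss_cdf_surj:
  assumes "0 < p" "p < 1"
  shows "\<exists>y. gauss_cdf t y = p"
proof -
  have "eventually (\<lambda>n. p < gauss_cdf t (real n) \<and> gauss_cdf t (- real n) < p) sequentially"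
    using order_tendstoD(1)[OF gauss_cdf_limits(1) assms(2)] order_tendstoD(2)[OF gauss_cdf_limits(2) assms(1)]
    by eventually_elim simp
  then obtain n where n: "p < gauss_cdf t (real n)" "gauss_cdf t (- real n) < p"
    by (auto simp: eventually_sequentially)
  have "continuous_on {- real n..real n} (gauss_cdf t)"
    by (intro continuous_at_imp_continuous_on ballI DERIV_isCont[OF gauss_cdf_has_derivative])
  then show ?thesis using IVT'[of "gauss_cdf t" "- real n" p "real n"] n by auto
qed

lemma gauss_cdf_quantile: "0 < p \<Longrightarrow> p < 1 \<Longrightarrow> gauss_cdf t (gauss_quantile t p) = p"
  using gauss_cdf_surj[of p] f_the_inv_into_f[OF gauss_cdf_inj, of p] by (auto simp: gauss_quantile_def)

lemma gauss_quantile_cdf: "gauss_quantile t (gauss_cdf t y) = y"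
  using gauss_cdf_quantile[OF gauss_cdf_bounds] gauss_cdf_inj by (auto dest: injD)

lemma gauss_quantile_mono: "0 < p \<Longrightarrow> p \<le> q \<Longrightarrow> q < 1 \<Longrightarrow> gauss_quantile t p \<le> gauss_quantile t q"
  by (metis gauss_cdf_quantile gauss_cdf_strict_mono le_less_trans less_le_trans not_le)

lemma gauss_quantile_has_derivative:
  assumes p: "0 < p" "p < 1"
  shows "(gauss_quantile t has_real_derivative inverse (gauss t (gauss_quantile t p))) (at p)"
proof (rule DERIV_inverse_function)
  show "(gauss_cdf t has_real_derivative gauss t (gauss_quantile t p)) (at (gauss_quantile t p))"
    by (rule gauss_cdf_has_derivative)
  show "gauss t (gauss_quantile t p) \<noteq> 0" using gauss_pos[OF t] less_irrefl by metis
  show "0 < p" "p < 1" by fact+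
  show "gauss_cdf t (gauss_quantile t q) = q" if "0 < q" "q < 1" for q
    using that by (rule gauss_cdf_quantile)
  have "isCont (gauss_quantile t) (gauss_cdf t (gauss_quantile t p))"
    by (rule isCont_inverse_function2[of "gauss_quantile t p - 1" _ "gauss_quantile t p + 1"])
       (auto simp: gauss_quantile_cdf intro: DERIV_isCont[OF gauss_cdf_has_derivative])
  then show "isCont (gauss_quantile t) p" by (simp add: gauss_cdf_quantile p)
qed

lemma isCont_gauss_quantile: "0 < p \<Longrightarrow> p < 1 \<Longrightarrow> isCont (gauss_quantile t) p"
  by (rule DERIV_isCont[OF gauss_quantile_has_derivative])

lemma gauss_quantile_measurable [measurable]: "gauss_quantile t \<in> borel_measurable borel"
proof -
  have "continuous_on {0<..<1} (gauss_quantile t)"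
    by (intro continuous_at_imp_continuous_on ballI isCont_gauss_quantile) auto
  then have "(\<lambda>p. if p \<in> {0<..<1} then gauss_quantile t p else 0) \<in> borel_measurable borel"
    by (intro borel_measurable_continuous_on_if) auto
  also have "(\<lambda>p. if p \<in> {0<..<1} then gauss_quantile t p else 0) = gauss_quantile t"
    by (auto simp: gauss_quantile_def)
  finally show ?thesis .
qed

end

section \<open>Expansion of exponentials and Lebesgue differentiation along lines\<close>

lemma exp_le_quadratic: "exp z \<le> 1 + z + z\<^sup>2" if "\<bar>z\<bar> \<le> 1" for z :: real
proof (cases "z \<ge> 0")
  case True
  then show ?thesis using exp_bound[of z] that by simp
next
  case False
  define w where "w = - z"
  have w: "0 \<le> w" using False by (simp add: w_def)
  \<comment> \<open>The product equals 1 + w^3.\<close>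
  have "1 \<le> (1 - w + w\<^sup>2) * (1 + w)"
    using w by (simp add: algebra_simps power2_eq_square)
  also have "\<dots> \<le> (1 - w + w\<^sup>2) * exp w"
  proof (rule mult_left_mono)
    show "1 + w \<le> exp w" by (rule exp_ge_add_one_self)
    have "0 \<le> (w - 1)\<^sup>2" "0 \<le> w\<^sup>2" by auto
    then show "0 \<le> 1 - w + w\<^sup>2" using w by (simp add: power2_eq_square algebra_simps)
  qed
  finally have "exp (- w) \<le> 1 - w + w\<^sup>2"
    by (simp add: exp_minus field_simps)
  then show ?thesis by (simp add: w_def)
qed

text \<open>With h = 1 / (n + 1), the linear terms of the exponentials leave h (a n - c) / t, which
  is itself of order h^2 and contributes L / t. Each quadratic term contributes - c^2 / (2
  t^2).\<close>

lemma two_minus_exp_tendsto: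
  fixes a :: "nat \<Rightarrow> real"
  assumes "t > 0" and a: "a \<longlonglongrightarrow> c" and L: "(\<lambda>n. real (Suc n) * (a n - c)) \<longlonglongrightarrow> L"
  shows "(\<lambda>n. (real (Suc n))\<^sup>2 * (2 - exp (- (inverse (real (Suc n)) * a n / t)) - exp (inverse (real (Suc n)) * c / t)))
    \<longlonglongrightarrow> L / t - c\<^sup>2 / t\<^sup>2"
proof -
  \<comment> \<open>The second-order remainder coefficient of the exponential, extended to 0 by its
    limit 1/2, so that the expansion becomes an identity with a coefficient continuous at 0.\<close>
  define r where "r = (\<lambda>z::real. if z = 0 then 1 / 2 else (exp z - 1 - z) / z\<^sup>2)"
  have r: "exp z = 1 + z + z\<^sup>2 * r z" for z by (simp add: r_def)
  have "((\<lambda>z::real. (exp z - 1 - z) / z\<^sup>2) \<longlongrightarrow> 1 / 2) (at 0)" by real_asymp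
  then have "(r \<longlongrightarrow> 1 / 2) (at 0)"
    by (rule Lim_transform_eventually) (auto simp: r_def eventually_at_filter)
  then have cont: "isCont r 0" by (simp add: isCont_def r_def)
  have inv: "(\<lambda>n. inverse (real (Suc n))) \<longlonglongrightarrow> 0" by (rule LIMSEQ_inverse_real_of_nat)
  define z where "z = (\<lambda>n. - (inverse (real (Suc n)) * a n / t))"
  define w where "w = (\<lambda>n. inverse (real (Suc n)) * c / t)"
  have "z \<longlonglongrightarrow> - (0 * c / t)" "w \<longlonglongrightarrow> 0 * c / t"
    unfolding z_def w_def using \<open>t > 0\<close> by (intro tendsto_intros inv a; simp)+
  then have rz: "(\<lambda>n. r (z n)) \<longlonglongrightarrow> r 0" "(\<lambda>n. r (w n)) \<longlonglongrightarrow> r 0"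
    by (auto intro!: isCont_tendsto_compose[OF cont])
  have "(\<lambda>n. real (Suc n) * (a n - c) / t - (a n / t)\<^sup>2 * r (z n) - (c / t)\<^sup>2 * r (w n))
     \<longlonglongrightarrow> L / t - (c / t)\<^sup>2 * r 0 - (c / t)\<^sup>2 * r 0"
    using \<open>t > 0\<close> by (intro tendsto_intros L a rz) auto
  moreover have "real (Suc n) * (a n - c) / t - (a n / t)\<^sup>2 * r (z n) - (c / t)\<^sup>2 * r (w n) =
    (real (Suc n))\<^sup>2 * (2 - exp (z n) - exp (w n))" for n
  proof -
    define N where "N = real (Suc n)"
    have N: "N > 0" by (simp add: N_def)
    have "N\<^sup>2 * (2 - exp (z n) - exp (w n)) = N\<^sup>2 * (- z n - w n - (z n)\<^sup>2 * r (z n) - (w n)\<^sup>2 * r (w n))"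
      by (simp add: r[of "z n"] r[of "w n"])
    also have "\<dots> = N * (a n - c) / t - (a n / t)\<^sup>2 * r (z n) - (c / t)\<^sup>2 * r (w n)"
      using N \<open>t > 0\<close> unfolding z_def w_def N_def[symmetric] by (simp add: field_simps power2_eq_square)
    finally show ?thesis by (simp add: N_def)
  qed
  moreover have "L / t - (c / t)\<^sup>2 * r 0 - (c / t)\<^sup>2 * r 0 = L / t - c\<^sup>2 / t\<^sup>2"
    by (simp add: r_def power_divide)
  ultimately show ?thesis by (simp add: z_def w_def)
qed

text \<open>With countably many tolerances the set of convergence in
  \<open>line_lebesgue_differentiation\<close> is visibly measurable.\<close>

lemma LIMSEQ_iff_inverse_Suc:
  "(u \<longlonglongrightarrow> (l::real)) \<longleftrightarrow> (\<forall>k. \<exists>N. \<forall>n\<ge>N. \<bar>u n - l\<bar> < inverse (real (Suc k)))"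
proof
  assume "u \<longlonglongrightarrow> l"
  then show "\<forall>k. \<exists>N. \<forall>n\<ge>N. \<bar>u n - l\<bar> < inverse (real (Suc k))"
    by (auto simp: LIMSEQ_iff)
next
  assume *: "\<forall>k. \<exists>N. \<forall>n\<ge>N. \<bar>u n - l\<bar> < inverse (real (Suc k))"
  show "u \<longlonglongrightarrow> l"
    unfolding LIMSEQ_iff
  proof (intro allI impI)
    fix r :: real assume "r > 0"
    then obtain k where "inverse (real (Suc k)) < r" using reals_Archimedean by blast
    with * show "\<exists>N. \<forall>n\<ge>N. norm (u n - l) < r" by (metis less_trans real_norm_def)
  qed
qed

text \<open>The one-dimensional differentiation theorem holds on every line on which
  \<open>f\<close> is integrable. The exceptional set is thus null on almost every line, hence null
  in space.\<close>

lemma line_lebesgue_differentiation: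
  fixes f :: "'a::euclidean_space \<Rightarrow> real" and e :: 'a
  assumes [measurable]: "f \<in> borel_measurable borel"
    and int: "AE x in lborel. integrable lborel (\<lambda>s. f (x + s *\<^sub>R e))"
  shows "AE x in lborel. (\<lambda>n. real (Suc n) * (LBINT s. indicator {0<..inverse (real (Suc n))} s * f (x + s *\<^sub>R e))) \<longlonglongrightarrow> f x"
proof (rule AE_lborel_of_lines[where e = e])
  show "Measurable.pred borel (\<lambda>x. (\<lambda>n. real (Suc n) * (LBINT s. indicator {0<..inverse (real (Suc n))} s * f (x + s *\<^sub>R e))) \<longlonglongrightarrow> f x)"
    unfolding LIMSEQ_iff_inverse_Suc by measurable
  show "AE x in lborel. AE r in lborel.
     (\<lambda>n. real (Suc n) * (LBINT s. indicator {0<..inverse (real (Suc n))} s * f (x + r *\<^sub>R e + s *\<^sub>R e))) \<longlonglongrightarrow> f (x + r *\<^sub>R e)"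
    using int
  proof eventually_elim
    case (elim x)
    define \<phi> where "\<phi> = (\<lambda>s. f (x + s *\<^sub>R e))"
    have \<phi>: "integrable lborel \<phi>" using elim by (simp add: \<phi>_def)
    have si: "set_integrable lborel A \<phi>" if "A \<in> sets borel" for A
      using integrable_mult_indicator[OF _ \<phi>, of A] that by (simp add: set_integrable_def)
    \<comment> \<open>\<open>r\<close> is the position on the line through x. The average that
      starts there is an ordinary integral of \<open>\<phi>\<close> from r to r + h.\<close>
    have avg: "(LBINT s. indicator {0<..h} s * f (x + r *\<^sub>R e + s *\<^sub>R e)) = integral {r..r + h} \<phi>" if "h > 0" for h r
    proof -
      have "(LBINT s. indicator {0<..h} s * f (x + r *\<^sub>R e + s *\<^sub>R e)) = (LBINT s. indicator {r<..r + h} (s + r) * \<phi> (s + r))"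
        by (intro Bochner_Integration.integral_cong) (auto simp: \<phi>_def algebra_simps indicator_def)
      also have "\<dots> = (LBINT s. indicator {r<..r + h} s * \<phi> s)"
        using \<phi> by (intro integral_lborel_translate) auto
      also have "\<dots> = (LBINT s. indicator {r..r + h} s * \<phi> s)"
        using AE_lborel_singleton[of r] \<phi>
        by (intro integral_cong_AE) (auto elim!: eventually_mono simp: indicator_def)
      also have "\<dots> = integral {r..r + h} \<phi>"
        using set_borel_integral_eq_integral(2)[OF si[of "{r..r + h}"]] by (simp add: set_lebesgue_integral_def)
      finally show ?thesis .
    qed
    have "\<phi> integrable_on cbox a b" for a b
      using set_borel_integral_eq_integral(1)[OF si[of "cbox a b"]] by simp
    then obtain N where N: "negligible N"
       "\<And>x e. \<lbrakk>x \<notin> N; 0 < e\<rbrakk> \<Longrightarrow>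
               \<exists>d>0. \<forall>h. 0 < h \<and> h < d \<longrightarrow> norm(integral (cbox x (x + h *\<^sub>R One)) \<phi> /\<^sub>R h ^ DIM(real) - \<phi> x) < e"
      using integrable_ccontinuous_explicit[of \<phi>] by metis
    have "AE r in lebesgue. r \<notin> N"
      using N(1) by (intro AE_not_in) (simp add: negligible_iff_null_sets)
    then have "AE r in lborel. r \<notin> N" by (simp add: AE_completion_iff)
    then show ?case
    proof eventually_elim
      case (elim r)
      show ?case
        unfolding LIMSEQ_iff
      proof (intro allI impI)
        fix \<epsilon> :: real assume "\<epsilon> > 0"
        then obtain d where d: "d > 0" "\<And>h. 0 < h \<Longrightarrow> h < d \<Longrightarrow> norm (integral {r..r + h} \<phi> / h - \<phi> r) < \<epsilon>"
          using N(2)[OF elim] by (force simp: divide_inverse mult.commute)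
        obtain k where k: "inverse (real (Suc k)) < d" using reals_Archimedean[OF d(1)] by blast
        have "inverse (real (Suc n)) < d" if "n \<ge> k" for n
          using that by (intro le_less_trans[OF _ k]) (auto intro!: le_imp_inverse_le)
        then show "\<exists>no. \<forall>n\<ge>no. norm (real (Suc n) * (LBINT s. indicator {0<..inverse (real (Suc n))} s * f (x + r *\<^sub>R e + s *\<^sub>R e)) - f (x + r *\<^sub>R e)) < \<epsilon>"
          using d(2)[of "inverse (real (Suc _))"]
          by (intro exI[of _ k]) (auto simp: avg \<phi>_def divide_inverse mult.commute simp del: of_nat_Suc)
      qed
    qed
  qed
qed

section \<open>The one-dimensional step\<close>

text \<open>A discrete form of completing the square: \<open>\<theta>\<close> stands for the ratio
  of a positive ground state at two neighbouring points, and equality holds for a = \<theta>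
  b.\<close>

lemma norm_diff_square_ge:
  fixes a b :: complex
  assumes "\<theta> > 0"
  shows "(1 - \<theta>) * (cmod b)\<^sup>2 + (1 - 1 / \<theta>) * (cmod a)\<^sup>2 \<le> (cmod (a - b))\<^sup>2"
proof -
  have "(cmod a - cmod b)\<^sup>2 \<le> (cmod (a - b))\<^sup>2"
    using norm_triangle_ineq3[of a b] by (metis abs_le_square_iff abs_norm_cancel)
  moreover have "2 * (cmod a * cmod b) \<le> \<theta> * (cmod b)\<^sup>2 + (cmod a)\<^sup>2 / \<theta>"
  proof -
    have "0 \<le> (\<theta> * cmod b - cmod a)\<^sup>2 / \<theta>" using assms by simp
    also have "\<dots> = \<theta> * (cmod b)\<^sup>2 + (cmod a)\<^sup>2 / \<theta> - 2 * (cmod a * cmod b)"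
      using assms by (simp add: power2_diff field_simps power2_eq_square)
    finally show ?thesis by simp
  qed
  ultimately show ?thesis by (simp add: power2_diff algebra_simps)
qed

text \<open>The directional form of \<open>\<integral>|\<partial>\<psi>|\<^sup>2 \<ge> \<integral>(\<tau>' - \<tau>\<^sup>2)|\<psi>|\<^sup>2\<close>, which comes from
  \<open>|\<partial>\<psi> + \<tau> \<psi>|\<^sup>2 \<ge> 0\<close>; difference quotients replace the integration by parts.\<close>

lemma difference_quotient_ground_state:
  fixes e :: "'a::euclidean_space" and \<psi> :: "'a \<Rightarrow> complex" and \<tau> \<tau>' :: "'a \<Rightarrow> real"
  assumes [measurable]: "\<psi> \<in> borel_measurable borel" "\<tau> \<in> borel_measurable borel" "\<tau>' \<in> borel_measurable borel"
    and sq: "integrable lborel (\<lambda>x. (cmod (\<psi> x))\<^sup>2)"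
    and D: "0 \<le> D" "\<And>h. 0 < h \<Longrightarrow> (\<integral>\<^sup>+x. ennreal ((cmod (\<psi> (x + h *\<^sub>R e) - \<psi> x))\<^sup>2) \<partial>lborel) \<le> ennreal (h\<^sup>2 * D)"
    and K: "\<And>x. \<bar>\<tau> x\<bar> \<le> K"
    and mono: "AE x in lborel. \<forall>n. \<tau> x \<le> \<tau> (x + inverse (real (Suc n)) *\<^sub>R e)"
    and deriv: "AE x in lborel. (\<lambda>n. real (Suc n) * (\<tau> (x + inverse (real (Suc n)) *\<^sub>R e) - \<tau> x)) \<longlonglongrightarrow> \<tau>' x"
  shows "(\<integral>\<^sup>+x. ennreal (\<tau>' x * (cmod (\<psi> x))\<^sup>2) \<partial>lborel) \<le> ennreal (D + (LBINT x. (\<tau> x)\<^sup>2 * (cmod (\<psi> x))\<^sup>2))"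
proof -
  define \<rho> where "\<rho> = (\<lambda>x. (cmod (\<psi> x))\<^sup>2)"
  have [measurable]: "\<rho> \<in> borel_measurable borel" unfolding \<rho>_def by measurable
  have \<rho>: "integrable lborel \<rho>" "\<And>x. 0 \<le> \<rho> x" using sq by (auto simp: \<rho>_def)
  have K0: "0 \<le> K" using K[of 0] by linarith
  have bnd: "integrable lborel (\<lambda>x. B x * \<rho> x)" if [measurable]: "B \<in> borel_measurable borel" and "\<And>x. \<bar>B x\<bar> \<le> C" for B C
  proof (rule Bochner_Integration.integrable_bound[OF integrable_mult_right[OF \<rho>(1), of C]])
    have "\<bar>B x\<bar> * \<rho> x \<le> \<bar>C\<bar> * \<rho> x" for x
      using that(2)[of x] by (intro mult_right_mono \<rho>(2)) linarith
    then show "AE x in lborel. norm (B x * \<rho> x) \<le> norm (C * \<rho> x)"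
      using \<rho>(2) by (auto simp: abs_mult)
  qed measurable
  define h where "h = (\<lambda>n. inverse (real (Suc n)))"
  have h: "0 < h n" "h n \<le> 1" for n by (auto simp: h_def inverse_le_1_iff)
  define u where "u = (\<lambda>n x. 2 - exp (- (h n * \<tau> (x + h n *\<^sub>R e))) - exp (h n * \<tau> x))"
  have [measurable]: "u n \<in> borel_measurable borel" for n unfolding u_def by measurable
  have exp_le: "exp (h n * c) \<le> exp K" "exp (- (h n * c)) \<le> exp K" if "\<bar>c\<bar> \<le> K" for n c
  proof -
    have "\<bar>h n * c\<bar> \<le> 1 * K" using h[of n] that unfolding abs_mult by (intro mult_mono) auto
    then show "exp (h n * c) \<le> exp K" "exp (- (h n * c)) \<le> exp K" by auto
  qed
  \<comment> \<open>\<theta> approximates the ratio, at x + h e and at x, of a positive function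
    whose derivative is - \<tau> times itself. Taking \<tau> at the far endpoint makes the second
    term, after translation, depend on \<tau>(x). This is how the increment \<tau>(x + h e) -
    \<tau>(x) enters \<open>u\<close>.\<close>
  have step: "(LBINT x. u n x * \<rho> x) \<le> (h n)\<^sup>2 * D" for n
  proof -
    define \<theta> where "\<theta> = (\<lambda>x. exp (- (h n * \<tau> (x + h n *\<^sub>R e))))"
    have [measurable]: "\<theta> \<in> borel_measurable borel" unfolding \<theta>_def by measurable
    have \<theta>: "\<theta> x > 0" "\<theta> x \<le> exp K" for x using exp_le K by (auto simp: \<theta>_def)
    have dsq: "integrable lborel (\<lambda>x. (cmod (\<psi> (x + h n *\<^sub>R e) - \<psi> x))\<^sup>2)"
      using D(2)[OF h(1), of n] by (intro integrableI_nonneg) (auto intro: le_less_trans)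
    have i1: "integrable lborel (\<lambda>x. (1 - \<theta> x) * \<rho> x)"
    proof (rule bnd[where C = "1 + exp K"])
      show "\<bar>1 - \<theta> x\<bar> \<le> 1 + exp K" for x
        using \<theta>[of x] exp_gt_zero[of K] by linarith
    qed measurable
    have i2: "integrable lborel (\<lambda>x. (1 - exp (h n * \<tau> x)) * \<rho> x)"
    proof (rule bnd[where C = "1 + exp K"])
      show "\<bar>1 - exp (h n * \<tau> x)\<bar> \<le> 1 + exp K" for x
        using exp_le(1)[OF K, of n x] exp_gt_zero[of "h n * \<tau> x"] exp_gt_zero[of K] by linarith
    qed measurable
    have sh: "1 - 1 / \<theta> x = 1 - exp (h n * \<tau> (x + h n *\<^sub>R e))" for x
      by (simp add: \<theta>_def exp_minus inverse_eq_divide)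
    have i3: "integrable lborel (\<lambda>x. (1 - 1 / \<theta> x) * \<rho> (x + h n *\<^sub>R e))"
      unfolding sh by (rule integrable_lborel_translate[OF i2])
    have "(LBINT x. u n x * \<rho> x) = (LBINT x. (1 - \<theta> x) * \<rho> x + (1 - exp (h n * \<tau> x)) * \<rho> x)"
      by (intro Bochner_Integration.integral_cong) (auto simp: u_def \<theta>_def algebra_simps)
    also have "\<dots> = (LBINT x. (1 - \<theta> x) * \<rho> x) + (LBINT x. (1 - exp (h n * \<tau> x)) * \<rho> x)"
      by (rule Bochner_Integration.integral_add[OF i1 i2])
    also have "(LBINT x. (1 - exp (h n * \<tau> x)) * \<rho> x) = (LBINT x. (1 - 1 / \<theta> x) * \<rho> (x + h n *\<^sub>R e))"
      unfolding sh by (rule integral_lborel_translate[symmetric]) measurable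
    also have "(LBINT x. (1 - \<theta> x) * \<rho> x) + \<dots> = (LBINT x. (1 - \<theta> x) * \<rho> x + (1 - 1 / \<theta> x) * \<rho> (x + h n *\<^sub>R e))"
      by (rule Bochner_Integration.integral_add[OF i1 i3, symmetric])
    also have "\<dots> \<le> (LBINT x. (cmod (\<psi> (x + h n *\<^sub>R e) - \<psi> x))\<^sup>2)"
      by (intro integral_mono Bochner_Integration.integrable_add i1 i3 dsq) (simp add: \<rho>_def norm_diff_square_ge \<theta>)
    also have "\<dots> \<le> (h n)\<^sup>2 * D"
      using D(2)[OF h(1), of n] dsq D(1) by (simp add: nn_integral_eq_integral)
    finally show ?thesis .
  qed
  \<comment> \<open>\<open>u n\<close> may be negative. For small h, monotonicity of \<tau> and the
    quadratic bound on the exponentials give u \<ge> - 2 (h K)^2. Adding \<open>K'\<close> after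
    scaling by 1 / h^2 therefore makes Fatou's lemma applicable.\<close>
  define K' where "K' = 2 * K\<^sup>2"
  define v where "v = (\<lambda>n x. (real (Suc n))\<^sup>2 * u n x + K')"
  have [measurable]: "v n \<in> borel_measurable borel" for n unfolding v_def by measurable
  have Nh: "real (Suc n) * h n = 1" for n by (simp add: h_def)
  have N2h: "(real (Suc n))\<^sup>2 * (h n)\<^sup>2 = 1" for n using Nh[of n] by (metis power_mult_distrib power_one)
  have ev: "eventually (\<lambda>n. h n * K \<le> 1) sequentially"
  proof -
    have "(\<lambda>n. h n * K) \<longlonglongrightarrow> 0 * K" unfolding h_def by (intro tendsto_intros LIMSEQ_inverse_real_of_nat)
    then show ?thesis using order_tendstoD(2)[of "\<lambda>n. h n * K" "0 * K" sequentially 1]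
      by (auto elim: eventually_mono)
  qed
  have v_nonneg: "AE x in lborel. 0 \<le> v n x" if small: "h n * K \<le> 1" for n
    using mono
  proof eventually_elim
    case (elim x)
    define a where "a = \<tau> (x + h n *\<^sub>R e)"
    have a: "\<tau> x \<le> a" "\<bar>a\<bar> \<le> K" "\<bar>\<tau> x\<bar> \<le> K" using elim K by (auto simp: a_def h_def)
    have le1: "\<bar>h n * c\<bar> \<le> h n * K" if "\<bar>c\<bar> \<le> K" for c
      using that h[of n] by (simp add: abs_mult)
    have "exp (- (h n * a)) \<le> 1 + - (h n * a) + (- (h n * a))\<^sup>2"
      by (rule exp_le_quadratic) (use le1[OF a(2)] small in simp)
    moreover have "exp (h n * \<tau> x) \<le> 1 + h n * \<tau> x + (h n * \<tau> x)\<^sup>2"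
      by (rule exp_le_quadratic) (use le1[OF a(3)] small in simp)
    moreover have "h n * \<tau> x \<le> h n * a" using a h[of n] by simp
    moreover have "(h n * a)\<^sup>2 \<le> (h n * K)\<^sup>2" "(h n * \<tau> x)\<^sup>2 \<le> (h n * K)\<^sup>2"
      using power_mono[OF le1[OF a(2)], of 2] power_mono[OF le1[OF a(3)], of 2] by simp_all
    ultimately have "- 2 * (h n * K)\<^sup>2 \<le> u n x" by (simp add: u_def a_def)
    then have "(real (Suc n))\<^sup>2 * (- 2 * (h n * K)\<^sup>2) \<le> (real (Suc n))\<^sup>2 * u n x"
      by (intro mult_left_mono) auto
    moreover have "(real (Suc n))\<^sup>2 * (- 2 * (h n * K)\<^sup>2) = - K' * ((real (Suc n))\<^sup>2 * (h n)\<^sup>2)"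
      by (simp add: K'_def power_mult_distrib)
    ultimately show "0 \<le> v n x" by (simp add: v_def N2h del: of_nat_Suc)
  qed
  have u_int: "integrable lborel (\<lambda>x. u n x * \<rho> x)" for n
  proof (rule bnd[where C = "2 + 2 * exp K"])
    show "\<bar>u n x\<bar> \<le> 2 + 2 * exp K" for x
      using exp_le(1)[OF K, of n x] exp_le(2)[OF K, of n "x + h n *\<^sub>R e"] exp_gt_zero[of "h n * \<tau> x"]
        exp_gt_zero[of "- (h n * \<tau> (x + h n *\<^sub>R e))"] exp_gt_zero[of K]
      unfolding u_def abs_le_iff by linarith
  qed measurable
  have v_int: "(\<integral>\<^sup>+x. ennreal (v n x * \<rho> x) \<partial>lborel) \<le> ennreal (D + K' * (LBINT x. \<rho> x))" if small: "h n * K \<le> 1" for n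
  proof -
    have vi: "integrable lborel (\<lambda>x. v n x * \<rho> x)"
      using u_int[of n] \<rho>(1) by (simp add: v_def distrib_right mult.assoc)
    have "(\<integral>\<^sup>+x. ennreal (v n x * \<rho> x) \<partial>lborel) = ennreal (LBINT x. v n x * \<rho> x)"
      using v_nonneg[OF small] \<rho>(2) by (intro nn_integral_eq_integral vi) (auto elim!: eventually_mono)
    also have "(LBINT x. v n x * \<rho> x) = (real (Suc n))\<^sup>2 * (LBINT x. u n x * \<rho> x) + K' * (LBINT x. \<rho> x)"
      using u_int[of n] \<rho>(1) by (simp add: v_def distrib_right mult.assoc)
    also have "\<dots> \<le> (real (Suc n))\<^sup>2 * ((h n)\<^sup>2 * D) + K' * (LBINT x. \<rho> x)"
      by (intro add_right_mono mult_left_mono step) simp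
    also have "\<dots> = D + K' * (LBINT x. \<rho> x)"
      by (simp add: N2h flip: mult.assoc del: of_nat_Suc)
    finally show ?thesis by (simp add: ennreal_leI)
  qed
  have lim: "AE x in lborel. (\<lambda>n. ennreal (v n x * \<rho> x)) \<longlonglongrightarrow> ennreal ((\<tau>' x - (\<tau> x)\<^sup>2 + K') * \<rho> x)"
    using deriv
  proof eventually_elim
    case (elim x)
    define a where "a = (\<lambda>n. \<tau> (x + h n *\<^sub>R e))"
    have L: "(\<lambda>n. real (Suc n) * (a n - \<tau> x)) \<longlonglongrightarrow> \<tau>' x" using elim by (simp add: a_def h_def)
    have "(\<lambda>n. \<tau> x + h n * (real (Suc n) * (a n - \<tau> x))) \<longlonglongrightarrow> \<tau> x + 0 * \<tau>' x"
      unfolding h_def by (intro tendsto_intros LIMSEQ_inverse_real_of_nat L)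
    moreover have "\<tau> x + h n * (real (Suc n) * (a n - \<tau> x)) = a n" for n
      using Nh[of n] by (metis (no_types) add.commute diff_add_cancel mult.assoc mult.commute mult_1)
    ultimately have A: "a \<longlonglongrightarrow> \<tau> x" by simp
    have "(\<lambda>n. (real (Suc n))\<^sup>2 * u n x) \<longlonglongrightarrow> \<tau>' x - (\<tau> x)\<^sup>2"
      using two_minus_exp_tendsto[OF _ A L, of 1] by (simp add: u_def a_def h_def)
    then show ?case unfolding v_def by (intro tendsto_intros tendsto_ennrealI)
  qed
  have "(\<integral>\<^sup>+x. ennreal ((\<tau>' x - (\<tau> x)\<^sup>2 + K') * \<rho> x) \<partial>lborel) = (\<integral>\<^sup>+x. liminf (\<lambda>n. ennreal (v n x * \<rho> x)) \<partial>lborel)"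
    using lim by (intro nn_integral_cong_AE) (auto elim!: eventually_mono simp: lim_imp_Liminf)
  also have "\<dots> \<le> liminf (\<lambda>n. \<integral>\<^sup>+x. ennreal (v n x * \<rho> x) \<partial>lborel)"
    by (rule nn_integral_liminf) measurable
  also have "\<dots> \<le> liminf (\<lambda>n. ennreal (D + K' * (LBINT x. \<rho> x)))"
    using ev by (intro Liminf_mono) (auto elim!: eventually_mono intro: v_int)
  also have "\<dots> = ennreal (D + K' * (LBINT x. \<rho> x))" by (simp add: Liminf_const)
  finally have F: "(\<integral>\<^sup>+x. ennreal ((\<tau>' x - (\<tau> x)\<^sup>2 + K') * \<rho> x) \<partial>lborel) \<le> ennreal (D + K' * (LBINT x. \<rho> x))" .
  \<comment> \<open>The terms with \<tau>^2 and \<open>K'\<close> are integrable against |\<psi>|^2,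
    so they can be moved across and cancelled although \<tau>' is not yet known to be
    integrable.\<close>
  have t2: "integrable lborel (\<lambda>x. (\<tau> x)\<^sup>2 * \<rho> x)"
  proof (rule bnd[where C = "K\<^sup>2"])
    show "\<bar>(\<tau> x)\<^sup>2\<bar> \<le> K\<^sup>2" for x using power_mono[OF K, of x 2] by simp
  qed measurable
  have K'0: "0 \<le> K'" by (simp add: K'_def)
  have nonneg': "AE x in lborel. 0 \<le> \<tau>' x"
    using mono deriv
  proof eventually_elim
    case (elim x)
    show ?case by (rule LIMSEQ_le_const[OF elim(2)]) (use elim(1) in auto)
  qed
  have "(\<integral>\<^sup>+x. ennreal (\<tau>' x * \<rho> x) \<partial>lborel) + ennreal (K' * (LBINT x. \<rho> x)) =
     (\<integral>\<^sup>+x. ennreal (\<tau>' x * \<rho> x) \<partial>lborel) + (\<integral>\<^sup>+x. ennreal (K' * \<rho> x) \<partial>lborel)"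
    using \<rho> K'0 by (subst nn_integral_eq_integral) auto
  also have "\<dots> = (\<integral>\<^sup>+x. ennreal (\<tau>' x * \<rho> x) + ennreal (K' * \<rho> x) \<partial>lborel)"
    by (rule nn_integral_add[symmetric]) measurable
  also have "\<dots> \<le> (\<integral>\<^sup>+x. ennreal ((\<tau>' x - (\<tau> x)\<^sup>2 + K') * \<rho> x) + ennreal ((\<tau> x)\<^sup>2 * \<rho> x) \<partial>lborel)"
  proof (intro nn_integral_mono_AE)
    show "AE x in lborel. ennreal (\<tau>' x * \<rho> x) + ennreal (K' * \<rho> x) \<le> ennreal ((\<tau>' x - (\<tau> x)\<^sup>2 + K') * \<rho> x) + ennreal ((\<tau> x)\<^sup>2 * \<rho> x)"
      using nonneg'
    proof eventually_elim
      case (elim x)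
      have "ennreal (\<tau>' x * \<rho> x) + ennreal (K' * \<rho> x) = ennreal (\<tau>' x * \<rho> x + K' * \<rho> x)"
        using elim K'0 \<rho>(2) by (simp add: ennreal_plus)
      also have "\<tau>' x * \<rho> x + K' * \<rho> x = (\<tau>' x - (\<tau> x)\<^sup>2 + K') * \<rho> x + (\<tau> x)\<^sup>2 * \<rho> x"
        by (simp add: algebra_simps)
      also have "ennreal \<dots> \<le> ennreal ((\<tau>' x - (\<tau> x)\<^sup>2 + K') * \<rho> x) + ennreal ((\<tau> x)\<^sup>2 * \<rho> x)"
        using \<rho>(2)[of x] by (cases "0 \<le> (\<tau>' x - (\<tau> x)\<^sup>2 + K') * \<rho> x")
          (auto simp: ennreal_plus ennreal_neg intro!: ennreal_leI)
      finally show ?case .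
    qed
  qed
  also have "\<dots> = (\<integral>\<^sup>+x. ennreal ((\<tau>' x - (\<tau> x)\<^sup>2 + K') * \<rho> x) \<partial>lborel) + (\<integral>\<^sup>+x. ennreal ((\<tau> x)\<^sup>2 * \<rho> x) \<partial>lborel)"
    by (rule nn_integral_add) measurable
  also have "\<dots> \<le> ennreal (D + K' * (LBINT x. \<rho> x)) + ennreal (LBINT x. (\<tau> x)\<^sup>2 * \<rho> x)"
    using \<rho>(2) t2 by (intro add_mono F) (simp add: nn_integral_eq_integral)
  also have "\<dots> = ennreal (D + (LBINT x. (\<tau> x)\<^sup>2 * \<rho> x)) + ennreal (K' * (LBINT x. \<rho> x))"
    using D(1) K'0 \<rho>(2) by (subst (1 2) ennreal_plus[symmetric]) (auto intro!: add_nonneg_nonneg mult_nonneg_nonneg Bochner_Integration.integral_nonneg simp: algebra_simps)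
  finally show ?thesis
    by (simp add: ennreal_add_left_cancel_le[of "ennreal (K' * _)"] add.commute[of _ "ennreal (K' * (LBINT x. \<rho> x))"] \<rho>_def)
qed

section \<open>Monotone transport to the Gaussian along lines\<close>

definition line_integral :: "'a::euclidean_space \<Rightarrow> ('a \<Rightarrow> real) \<Rightarrow> 'a \<Rightarrow> real" where
  "line_integral e f x = (LBINT s. f (x + s *\<^sub>R e))"

text \<open>The line through x is parametrized from x itself, so s \<le> 0 is the part of the line
  up to x. The distribution functions of all lines become one function on the whole space.\<close>

definition line_cdf :: "'a::euclidean_space \<Rightarrow> ('a \<Rightarrow> real) \<Rightarrow> 'a \<Rightarrow> real" where
  "line_cdf e f x = (LBINT s. indicator {..0} s * f (x + s *\<^sub>R e)) / line_integral e f x"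

text \<open>For \<open>\<epsilon> = 0\<close> this is the monotone map carrying, on each line in direction \<open>e\<close>, the normalized
  density \<open>f\<close> to the Gaussian; \<open>\<epsilon> > 0\<close> makes it bounded.\<close>

definition transport :: "real \<Rightarrow> real \<Rightarrow> 'a::euclidean_space \<Rightarrow> ('a \<Rightarrow> real) \<Rightarrow> 'a \<Rightarrow> real" where
  "transport t \<epsilon> e f x = gauss_quantile t (\<epsilon> + (1 - 2 * \<epsilon>) * line_cdf e f x)"

text \<open>The value predicted by the chain rule: the quantile has derivative 1 /
  \<open>gauss\<close>, and the distribution function has derivative
  \<open>f / line_integral\<close>. Since \<open>f\<close> is merely measurable, this is a
  derivative only almost everywhere and is therefore introduced as a formula.\<close>

definition transport_deriv :: "real \<Rightarrow> real \<Rightarrow> 'a::euclidean_space \<Rightarrow> ('a \<Rightarrow> real) \<Rightarrow> 'a \<Rightarrow> real" where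
  "transport_deriv t \<epsilon> e f x = (1 - 2 * \<epsilon>) * (f x / line_integral e f x) / gauss t (transport t \<epsilon> e f x)"

lemma integral_pos_if_AE_pos:
  fixes \<phi> :: "real \<Rightarrow> real"
  assumes \<phi>: "integrable lborel \<phi>" and pos: "AE s in lborel. \<phi> s > 0"
    and A: "A \<in> sets borel" "emeasure lborel A \<noteq> 0"
  shows "(LBINT s. indicator A s * \<phi> s) > 0"
proof (rule ccontr)
  have int: "integrable lborel (\<lambda>s. indicator A s * \<phi> s)"
    using integrable_mult_indicator[OF _ \<phi>, of A] A by simp
  have nn: "AE s in lborel. 0 \<le> indicator A s * \<phi> s"
    using pos by eventually_elim (auto simp: indicator_def)
  assume "\<not> ?thesis"
  then have "(LBINT s. indicator A s * \<phi> s) = 0"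
    using integral_nonneg_AE[OF nn] by linarith
  then have "AE s in lborel. indicator A s * \<phi> s = 0"
    using integral_nonneg_eq_0_iff_AE[OF int nn] by simp
  with pos have "AE s in lborel. s \<notin> A"
    by eventually_elim (auto simp: indicator_def)
  then have "A \<in> null_sets lborel"
    using A by (subst AE_iff_null_sets) auto
  with A(2) show False by auto
qed

lemma integral_atMost_strict_bounds:
  fixes \<phi> :: "real \<Rightarrow> real"
  assumes \<phi>: "integrable lborel \<phi>" and pos: "AE s in lborel. \<phi> s > 0"
  shows "0 < (LBINT s. indicator {..y} s * \<phi> s)"
    and "(LBINT s. indicator {..y} s * \<phi> s) < (LBINT s. \<phi> s)"
proof -
  have "emeasure lborel {y<..y + 1} \<le> emeasure lborel {y<..}" by (rule emeasure_mono) auto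
  moreover have "emeasure lborel {y - 1..y} \<le> emeasure lborel {..y}" by (rule emeasure_mono) auto
  ultimately have ne: "emeasure lborel {y<..} \<noteq> 0" "emeasure lborel {..y} \<noteq> 0" by auto
  show "0 < (LBINT s. indicator {..y} s * \<phi> s)"
    by (rule integral_pos_if_AE_pos[OF \<phi> pos]) (use ne in auto)
  have r: "0 < (LBINT s. indicator {y<..} s * \<phi> s)"
    by (rule integral_pos_if_AE_pos[OF \<phi> pos]) (use ne in auto)
  have "(LBINT s. \<phi> s) = (LBINT s. indicator {..y} s * \<phi> s + indicator {y<..} s * \<phi> s)"
    by (intro Bochner_Integration.integral_cong) (auto simp: indicator_def)
  also have "\<dots> = (LBINT s. indicator {..y} s * \<phi> s) + (LBINT s. indicator {y<..} s * \<phi> s)"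
    using integrable_mult_indicator[OF _ \<phi>, of "{..y}"] integrable_mult_indicator[OF _ \<phi>, of "{y<..}"]
    by (intro Bochner_Integration.integral_add) auto
  finally show "(LBINT s. indicator {..y} s * \<phi> s) < (LBINT s. \<phi> s)" using r by simp
qed

lemma line_integral_pos:
  fixes f :: "'a::euclidean_space \<Rightarrow> real"
  assumes line_int: "AE x in lborel. integrable lborel (\<lambda>s. f (x + s *\<^sub>R e))"
    and f_pos: "AE x in lborel. f x > 0"
  shows "AE x in lborel. 0 < line_integral e f x \<and> 0 < line_cdf e f x \<and> line_cdf e f x < 1"
  using line_int AE_lborel_lines[OF f_pos, of e]
proof eventually_elim
  case (elim x)
  from integral_atMost_strict_bounds[OF elim, of 0] show ?case
    by (auto simp: line_cdf_def line_integral_def)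
qed

context
  fixes f :: "'a::euclidean_space \<Rightarrow> real" and e :: 'a and t :: real
  assumes f_meas [measurable]: "f \<in> borel_measurable borel" and f_nonneg: "\<And>x. 0 \<le> f x" and t_pos: "t > 0"
begin

lemma line_integral_measurable [measurable]: "line_integral e f \<in> borel_measurable borel"
  unfolding line_integral_def[abs_def] by measurable

lemma line_cdf_measurable [measurable]: "line_cdf e f \<in> borel_measurable borel"
  unfolding line_cdf_def[abs_def] by measurable

lemma transport_measurable [measurable]: "transport t \<epsilon> e f \<in> borel_measurable borel"
  using gauss_quantile_measurable[OF t_pos] unfolding transport_def[abs_def] by measurable

lemma transport_deriv_measurable [measurable]: "transport_deriv t \<epsilon> e f \<in> borel_measurable borel"
  unfolding transport_deriv_def[abs_def] by measurable

lemma line_integral_nonneg: "0 \<le> line_integral e f x"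
  unfolding line_integral_def by (intro Bochner_Integration.integral_nonneg f_nonneg)

lemma line_integral_shift: "line_integral e f (x + h *\<^sub>R e) = line_integral e f x"
proof -
  have "line_integral e f (x + h *\<^sub>R e) = (LBINT s. f (x + (s + h) *\<^sub>R e))"
    unfolding line_integral_def by (intro Bochner_Integration.integral_cong) (auto simp: algebra_simps)
  also have "\<dots> = line_integral e f x"
    unfolding line_integral_def by (rule integral_lborel_translate) measurable
  finally show ?thesis .
qed

lemma line_cdf_bounds: "0 \<le> line_cdf e f x" "line_cdf e f x \<le> 1"
proof -
  have nn: "0 \<le> (LBINT s. indicator {..0} s * f (x + s *\<^sub>R e))"
    by (intro Bochner_Integration.integral_nonneg) (auto simp: f_nonneg)
  then show "0 \<le> line_cdf e f x" by (simp add: line_cdf_def line_integral_nonneg)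
  show "line_cdf e f x \<le> 1"
  proof (cases "integrable lborel (\<lambda>s. f (x + s *\<^sub>R e))")
    case True
    have "(LBINT s. indicator {..0} s * f (x + s *\<^sub>R e)) \<le> line_integral e f x"
      unfolding line_integral_def using integrable_mult_indicator[OF _ True, of "{..0}"]
      by (intro integral_mono True) (auto simp: indicator_def f_nonneg)
    then show ?thesis using line_integral_nonneg[of x]
      by (cases "line_integral e f x = 0") (auto simp: line_cdf_def divide_le_eq)
  next
    \<comment> \<open>Here the integral over the line is 0 by default, and division by it gives
      0.\<close>
    case False
    then show ?thesis by (simp add: line_cdf_def line_integral_def not_integrable_integral_eq)
  qed
qed

lemma line_cdf_shift:
  assumes "h \<ge> 0" and int: "integrable lborel (\<lambda>s. f (x + s *\<^sub>R e))"
  shows "line_cdf e f (x + h *\<^sub>R e) - line_cdf e f x =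
    (LBINT s. indicator {0<..h} s * f (x + s *\<^sub>R e)) / line_integral e f x"
proof -
  have "(LBINT s. indicator {..0} s * f (x + h *\<^sub>R e + s *\<^sub>R e)) = (LBINT s. indicator {..h} (s + h) * f (x + (s + h) *\<^sub>R e))"
    by (intro Bochner_Integration.integral_cong) (auto simp: algebra_simps indicator_def)
  also have "\<dots> = (LBINT s. indicator {..h} s * f (x + s *\<^sub>R e))"
    by (rule integral_lborel_translate[of "\<lambda>s. indicator {..h} s * f (x + s *\<^sub>R e)"]) measurable
  finally show ?thesis
    using integral_atMost_diff[OF int assms(1)]
    by (simp add: line_cdf_def line_integral_shift flip: diff_divide_distrib)
qed

lemma transport_arg:
  assumes "0 < \<epsilon>" "\<epsilon> < 1 / 2"
  shows "\<epsilon> \<le> \<epsilon> + (1 - 2 * \<epsilon>) * line_cdf e f x" "\<epsilon> + (1 - 2 * \<epsilon>) * line_cdf e f x \<le> 1 - \<epsilon>"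
proof -
  have "(1 - 2 * \<epsilon>) * line_cdf e f x \<le> (1 - 2 * \<epsilon>) * 1"
    using assms by (intro mult_left_mono line_cdf_bounds) auto
  then show "\<epsilon> + (1 - 2 * \<epsilon>) * line_cdf e f x \<le> 1 - \<epsilon>" by simp
  show "\<epsilon> \<le> \<epsilon> + (1 - 2 * \<epsilon>) * line_cdf e f x"
    using assms line_cdf_bounds by simp
qed

lemma transport_bounded:
  assumes \<epsilon>: "0 < \<epsilon>" "\<epsilon> < 1 / 2"
  shows "\<exists>K. \<forall>x. \<bar>transport t \<epsilon> e f x\<bar> \<le> K"
proof (intro exI allI)
  fix x
  have "gauss_quantile t \<epsilon> \<le> transport t \<epsilon> e f x" "transport t \<epsilon> e f x \<le> gauss_quantile t (1 - \<epsilon>)"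
    unfolding transport_def using transport_arg[OF \<epsilon>, of x] \<epsilon>
    by (auto intro!: gauss_quantile_mono t_pos)
  then show "\<bar>transport t \<epsilon> e f x\<bar> \<le> \<bar>gauss_quantile t \<epsilon>\<bar> + \<bar>gauss_quantile t (1 - \<epsilon>)\<bar>" by linarith
qed

context
  assumes line_int: "AE x in lborel. integrable lborel (\<lambda>s. f (x + s *\<^sub>R e))"
begin

lemma transport_mono:
  assumes \<epsilon>: "0 < \<epsilon>" "\<epsilon> < 1 / 2"
  shows "AE x in lborel. \<forall>n. transport t \<epsilon> e f x \<le> transport t \<epsilon> e f (x + inverse (real (Suc n)) *\<^sub>R e)"
  using line_int
proof eventually_elim
  case (elim x)
  show ?case
  proof
    fix n
    define h where "h = inverse (real (Suc n))"
    have "h \<ge> 0" by (simp add: h_def)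
    have "0 \<le> (LBINT s. indicator {0<..h} s * f (x + s *\<^sub>R e)) / line_integral e f x"
      by (intro divide_nonneg_nonneg line_integral_nonneg Bochner_Integration.integral_nonneg) (auto simp: f_nonneg)
    then have "line_cdf e f x \<le> line_cdf e f (x + h *\<^sub>R e)"
      using line_cdf_shift[OF \<open>h \<ge> 0\<close> elim] by simp
    then have "\<epsilon> + (1 - 2 * \<epsilon>) * line_cdf e f x \<le> \<epsilon> + (1 - 2 * \<epsilon>) * line_cdf e f (x + h *\<^sub>R e)"
      using \<epsilon> by (intro add_left_mono mult_left_mono) auto
    then have "transport t \<epsilon> e f x \<le> transport t \<epsilon> e f (x + h *\<^sub>R e)"
      unfolding transport_def
      by (rule gauss_quantile_mono[OF t_pos, rotated])
         (use transport_arg[OF \<epsilon>, of x] transport_arg[OF \<epsilon>, of "x + h *\<^sub>R e"] \<epsilon> in linarith)+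
    then show "transport t \<epsilon> e f x \<le> transport t \<epsilon> e f (x + inverse (real (Suc n)) *\<^sub>R e)"
      by (simp add: h_def)
  qed
qed

lemma transport_difference_quotient:
  assumes \<epsilon>: "0 < \<epsilon>" "\<epsilon> < 1 / 2"
  shows "AE x in lborel. (\<lambda>n. real (Suc n) * (transport t \<epsilon> e f (x + inverse (real (Suc n)) *\<^sub>R e) - transport t \<epsilon> e f x))
    \<longlonglongrightarrow> transport_deriv t \<epsilon> e f x"
  using line_int line_lebesgue_differentiation[OF f_meas line_int]
proof eventually_elim
  case (elim x)
  define h where "h = (\<lambda>n. inverse (real (Suc n)))"
  define p where "p = (\<lambda>x. \<epsilon> + (1 - 2 * \<epsilon>) * line_cdf e f x)"
  define q where "q = (\<lambda>n. p (x + h n *\<^sub>R e))"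
  have p01: "0 < p x" "p x < 1" for x using transport_arg[OF \<epsilon>, of x] \<epsilon> by (auto simp: p_def)
  have qp: "real (Suc n) * (q n - p x) = (1 - 2 * \<epsilon>) / line_integral e f x *
      (real (Suc n) * (LBINT s. indicator {0<..h n} s * f (x + s *\<^sub>R e)))" for n
  proof -
    have "q n - p x = (1 - 2 * \<epsilon>) * (line_cdf e f (x + h n *\<^sub>R e) - line_cdf e f x)"
      by (simp add: q_def p_def algebra_simps)
    also have "\<dots> = (1 - 2 * \<epsilon>) * ((LBINT s. indicator {0<..h n} s * f (x + s *\<^sub>R e)) / line_integral e f x)"
      by (subst line_cdf_shift) (auto simp: h_def elim(1))
    finally show ?thesis by simp
  qed
  have L: "(\<lambda>n. real (Suc n) * (q n - p x)) \<longlonglongrightarrow> (1 - 2 * \<epsilon>) / line_integral e f x * f x"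
    unfolding qp using elim(2) unfolding h_def by (intro tendsto_intros)
  have "(\<lambda>n. p x + h n * (real (Suc n) * (q n - p x))) \<longlonglongrightarrow> p x + 0 * ((1 - 2 * \<epsilon>) / line_integral e f x * f x)"
    unfolding h_def by (intro tendsto_intros LIMSEQ_inverse_real_of_nat L)
  moreover have "p x + h n * (real (Suc n) * (q n - p x)) = q n" for n
    by (simp add: h_def field_simps del: of_nat_Suc)
  ultimately have q: "q \<longlonglongrightarrow> p x" by simp
  \<comment> \<open>Caratheodory's slope function replaces the quotient of increments, which has no
    meaning when q n = p x.\<close>
  obtain g where g: "\<And>z. gauss_quantile t z - gauss_quantile t (p x) = g z * (z - p x)"
    "isCont g (p x)" "g (p x) = inverse (gauss t (gauss_quantile t (p x)))"
    using gauss_quantile_has_derivative[OF t_pos p01, of x] unfolding CARAT_DERIV by blast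
  have "(\<lambda>n. g (q n) * (real (Suc n) * (q n - p x))) \<longlonglongrightarrow> g (p x) * ((1 - 2 * \<epsilon>) / line_integral e f x * f x)"
    by (intro tendsto_mult isCont_tendsto_compose[OF g(2) q] L)
  moreover have "g (q n) * (real (Suc n) * (q n - p x)) = real (Suc n) * (gauss_quantile t (q n) - gauss_quantile t (p x))" for n
    by (simp add: g(1))
  moreover have "g (p x) * ((1 - 2 * \<epsilon>) / line_integral e f x * f x) = transport_deriv t \<epsilon> e f x"
    unfolding g(3) by (simp add: transport_deriv_def transport_def p_def divide_inverse)
  ultimately have "(\<lambda>n. real (Suc n) * (gauss_quantile t (q n) - gauss_quantile t (p x))) \<longlonglongrightarrow> transport_deriv t \<epsilon> e f x"
    by (simp only:)
  then show ?case by (simp only: transport_def p_def q_def h_def)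
qed

lemma transport_deriv_nonneg: "\<epsilon> \<le> 1 / 2 \<Longrightarrow> 0 \<le> transport_deriv t \<epsilon> e f x"
  unfolding transport_deriv_def
  by (intro divide_nonneg_nonneg mult_nonneg_nonneg f_nonneg line_integral_nonneg less_imp_le[OF gauss_pos] t_pos) simp_all

context
  fixes \<psi> :: "'a \<Rightarrow> complex" and D :: real
  assumes psi_meas [measurable]: "\<psi> \<in> borel_measurable borel"
    and psi_sq: "integrable lborel (\<lambda>x. (cmod (\<psi> x))\<^sup>2)"
    and D_nonneg: "0 \<le> D"
    and D_bound: "\<And>h. 0 < h \<Longrightarrow> (\<integral>\<^sup>+x. ennreal ((cmod (\<psi> (x + h *\<^sub>R e) - \<psi> x))\<^sup>2) \<partial>lborel) \<le> ennreal (h\<^sup>2 * D)"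
begin

text \<open>This is \<open>difference_quotient_ground_state\<close> for \<tau> = T / t, multiplied
  by t. The parameter \<epsilon> keeps T bounded, so the right-hand side is finite, and
  integrability of T' |\<psi>|^2 follows.\<close>

lemma transport_inequality:
  assumes \<epsilon>: "0 < \<epsilon>" "\<epsilon> < 1 / 2"
  defines "T \<equiv> transport t \<epsilon> e f" and "T' \<equiv> transport_deriv t \<epsilon> e f"
  shows "integrable lborel (\<lambda>x. (T x)\<^sup>2 * (cmod (\<psi> x))\<^sup>2)"
    and "integrable lborel (\<lambda>x. T' x * (cmod (\<psi> x))\<^sup>2)"
    and "(LBINT x. T' x * (cmod (\<psi> x))\<^sup>2) \<le> t * D + (LBINT x. (T x)\<^sup>2 * (cmod (\<psi> x))\<^sup>2) / t"
proof -
  have [measurable]: "T \<in> borel_measurable borel" "T' \<in> borel_measurable borel"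
    unfolding T_def T'_def by measurable
  obtain K where K: "\<And>x. \<bar>T x\<bar> \<le> K" using transport_bounded[OF \<epsilon>] by (auto simp: T_def)
  show i: "integrable lborel (\<lambda>x. (T x)\<^sup>2 * (cmod (\<psi> x))\<^sup>2)"
  proof (rule Bochner_Integration.integrable_bound[OF integrable_mult_right[OF psi_sq, of "K\<^sup>2"]])
    have "(T x)\<^sup>2 \<le> K\<^sup>2" for x using power_mono[OF K, of x 2] by simp
    then show "AE x in lborel. norm ((T x)\<^sup>2 * (cmod (\<psi> x))\<^sup>2) \<le> norm (K\<^sup>2 * (cmod (\<psi> x))\<^sup>2)"
      by (intro AE_I2) (auto intro!: mult_right_mono)
  qed measurable
  have T'0: "0 \<le> T' x" for x using transport_deriv_nonneg \<epsilon> by (simp add: T'_def)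
  have "(\<integral>\<^sup>+x. ennreal (T' x / t * (cmod (\<psi> x))\<^sup>2) \<partial>lborel) \<le> ennreal (D + (LBINT x. (T x / t)\<^sup>2 * (cmod (\<psi> x))\<^sup>2))"
  proof (rule difference_quotient_ground_state[where e = e and \<tau> = "\<lambda>x. T x / t"])
    show "\<bar>T x / t\<bar> \<le> K / t" for x using K[of x] t_pos by (simp add: divide_right_mono)
    show "AE x in lborel. \<forall>n. T x / t \<le> T (x + inverse (real (Suc n)) *\<^sub>R e) / t"
      using transport_mono[OF \<epsilon>] t_pos by (auto simp: T_def divide_right_mono elim!: eventually_mono)
    show "AE x in lborel. (\<lambda>n. real (Suc n) * (T (x + inverse (real (Suc n)) *\<^sub>R e) / t - T x / t)) \<longlonglongrightarrow> T' x / t"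
      using transport_difference_quotient[OF \<epsilon>]
    proof eventually_elim
      case (elim x)
      have "(\<lambda>n. real (Suc n) * (T (x + inverse (real (Suc n)) *\<^sub>R e) - T x) / t) \<longlonglongrightarrow> T' x / t"
        using elim t_pos unfolding T_def T'_def by (intro tendsto_divide tendsto_const) auto
      then show ?case by (simp add: diff_divide_distrib right_diff_distrib)
    qed
  qed (use psi_sq D_nonneg D_bound in measurable)
  then have le: "(\<integral>\<^sup>+x. ennreal (T' x / t * (cmod (\<psi> x))\<^sup>2) \<partial>lborel) \<le> ennreal (D + (LBINT x. (T x / t)\<^sup>2 * (cmod (\<psi> x))\<^sup>2))" .
  then have i': "integrable lborel (\<lambda>x. T' x / t * (cmod (\<psi> x))\<^sup>2)"
    using T'0 t_pos by (intro integrableI_nonneg) (auto intro: le_less_trans)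
  have "(\<lambda>x. t * (T' x / t * (cmod (\<psi> x))\<^sup>2)) = (\<lambda>x. T' x * (cmod (\<psi> x))\<^sup>2)" using t_pos by auto
  with integrable_mult_right[OF i', of t] show i'': "integrable lborel (\<lambda>x. T' x * (cmod (\<psi> x))\<^sup>2)" by metis
  have "(LBINT x. T' x / t * (cmod (\<psi> x))\<^sup>2) \<le> D + (LBINT x. (T x / t)\<^sup>2 * (cmod (\<psi> x))\<^sup>2)"
  proof -
    have "(\<integral>\<^sup>+x. ennreal (T' x / t * (cmod (\<psi> x))\<^sup>2) \<partial>lborel) = ennreal (LBINT x. T' x / t * (cmod (\<psi> x))\<^sup>2)"
      using T'0 t_pos by (intro nn_integral_eq_integral i') auto
    moreover have "0 \<le> D + (LBINT x. (T x / t)\<^sup>2 * (cmod (\<psi> x))\<^sup>2)"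
      by (intro add_nonneg_nonneg D_nonneg Bochner_Integration.integral_nonneg) auto
    ultimately show ?thesis using le by (simp only: ennreal_le_iff)
  qed
  then have "t * (LBINT x. T' x / t * (cmod (\<psi> x))\<^sup>2) \<le> t * (D + (LBINT x. (T x / t)\<^sup>2 * (cmod (\<psi> x))\<^sup>2))"
    using t_pos by (intro mult_left_mono) auto
  also have "t * (LBINT x. T' x / t * (cmod (\<psi> x))\<^sup>2) = (LBINT x. T' x * (cmod (\<psi> x))\<^sup>2)"
    using t_pos by simp
  also have "(LBINT x. (T x / t)\<^sup>2 * (cmod (\<psi> x))\<^sup>2) = (LBINT x. (T x)\<^sup>2 * (cmod (\<psi> x))\<^sup>2 / t\<^sup>2)"
    by (simp add: power_divide)
  also have "t * (D + \<dots>) = t * D + (LBINT x. (T x)\<^sup>2 * (cmod (\<psi> x))\<^sup>2) / t"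
    using t_pos by (simp add: field_simps power2_eq_square)
  finally show "(LBINT x. T' x * (cmod (\<psi> x))\<^sup>2) \<le> t * D + (LBINT x. (T x)\<^sup>2 * (cmod (\<psi> x))\<^sup>2) / t" .
qed

text \<open>The logarithm of the transport equation T' g(T) = (1 - 2 \<epsilon>) f / m, with g the
  Gaussian density and m the line integral.\<close>

lemma transport_deriv_log:
  assumes "f x > 0" "line_integral e f x > 0" "\<epsilon> < 1 / 2"
  shows "0 < transport_deriv t \<epsilon> e f x"
    and "ln (f x / line_integral e f x) =
      ln (transport_deriv t \<epsilon> e f x) - (transport t \<epsilon> e f x)\<^sup>2 / t - ln (pi * t) / 2 - ln (1 - 2 * \<epsilon>)"
proof -
  let ?T = "transport t \<epsilon> e f x" and ?T' = "transport_deriv t \<epsilon> e f x"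
  have g: "gauss t ?T > 0" by (rule gauss_pos[OF t_pos])
  show pos: "0 < ?T'" using assms g by (simp add: transport_deriv_def)
  have "ln (gauss t ?T) = - ?T\<^sup>2 / t - ln (pi * t) / 2"
    using t_pos by (simp add: gauss_def ln_div ln_sqrt)
  moreover have "ln ?T' = ln (1 - 2 * \<epsilon>) + ln (f x / line_integral e f x) - ln (gauss t ?T)"
    using assms g unfolding transport_deriv_def
    by (subst ln_div) (auto simp: ln_mult simp del: times_divide_eq_right)
  ultimately show "ln (f x / line_integral e f x) = ln ?T' - ?T\<^sup>2 / t - ln (pi * t) / 2 - ln (1 - 2 * \<epsilon>)"
    by simp
qed

text \<open>The substitute for form boundedness of the negative part of the potential: ln T' \<le>
  T' bounds ln (f / m) by T' plus a constant, and T' is integrable against |\<psi>|^2. The value 1/4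
  of \<epsilon> is arbitrary.\<close>

lemma log_line_density_pos_part_integrable:
  assumes f_pos: "AE x in lborel. f x > 0"
  shows "integrable lborel (\<lambda>x. max 0 (ln (f x / line_integral e f x)) * (cmod (\<psi> x))\<^sup>2)"
proof -
  define C where "C = \<bar>ln (pi * t) / 2\<bar> + \<bar>ln (1 - 2 * (1 / 4 :: real))\<bar>"
  note i = transport_inequality(2)[of "1 / 4"]
  show ?thesis
  proof (rule Bochner_Integration.integrable_bound)
    show "integrable lborel (\<lambda>x. transport_deriv t (1/4) e f x * (cmod (\<psi> x))\<^sup>2 + C * (cmod (\<psi> x))\<^sup>2)"
      using i psi_sq by simp
    show "AE x in lborel. norm (max 0 (ln (f x / line_integral e f x)) * (cmod (\<psi> x))\<^sup>2) \<le>
       norm (transport_deriv t (1/4) e f x * (cmod (\<psi> x))\<^sup>2 + C * (cmod (\<psi> x))\<^sup>2)"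
      using f_pos line_integral_pos[OF line_int f_pos]
    proof eventually_elim
      case (elim x)
      let ?T' = "transport_deriv t (1/4) e f x"
      have T': "0 < ?T'" using elim by (intro transport_deriv_log) auto
      have "ln (f x / line_integral e f x) = ln ?T' - (transport t (1/4) e f x)\<^sup>2 / t - ln (pi * t) / 2 - ln (1 - 2 * (1/4))"
        using elim by (intro transport_deriv_log) auto
      moreover have "ln ?T' \<le> ?T'" using T' ln_le_minus_one[of ?T'] by simp
      moreover have "0 \<le> (transport t (1/4) e f x)\<^sup>2 / t" using t_pos by simp
      ultimately have "ln (f x / line_integral e f x) \<le> ?T' + C"
        unfolding C_def by linarith
      moreover have "0 \<le> C" unfolding C_def by (intro add_nonneg_nonneg abs_ge_zero)
      ultimately have "max 0 (ln (f x / line_integral e f x)) \<le> ?T' + C" using T' by simp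
      then have "max 0 (ln (f x / line_integral e f x)) * (cmod (\<psi> x))\<^sup>2 \<le> (?T' + C) * (cmod (\<psi> x))\<^sup>2"
        by (intro mult_right_mono) auto
      then show ?case by (simp add: distrib_right)
    qed
  qed measurable
qed

text \<open>For each \<epsilon> > 0 the term T^2 / t of the transport inequality cancels against the
  one in the logarithm of the density, so nothing about T^2 has to pass to the limit. The only error
  is - ln (1 - 2 \<epsilon>) times the squared norm of \<psi>, and Fatou's lemma carries the
  remainder T' - 1 - ln T' to \<epsilon> = 0.\<close>

lemma log_line_density_inequality:
  assumes f_pos: "AE x in lborel. f x > 0"
    and int: "integrable lborel (\<lambda>x. ln (f x / line_integral e f x) * (cmod (\<psi> x))\<^sup>2)"
  defines "A \<equiv> t * D - (LBINT x. (ln (f x / line_integral e f x) + 1 + ln (pi * t) / 2) * (cmod (\<psi> x))\<^sup>2)"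
  shows "0 \<le> A"
    and "(\<integral>\<^sup>+x. ennreal ((transport_deriv t 0 e f x - 1 - ln (transport_deriv t 0 e f x)) * (cmod (\<psi> x))\<^sup>2) \<partial>lborel) \<le> ennreal A"
proof -
  define \<rho> where "\<rho> = (\<lambda>x. (cmod (\<psi> x))\<^sup>2)"
  have [measurable]: "\<rho> \<in> borel_measurable borel" unfolding \<rho>_def by measurable
  have \<rho>: "integrable lborel \<rho>" "\<And>x. 0 \<le> \<rho> x" using psi_sq by (auto simp: \<rho>_def)
  define U where "U = (\<lambda>x. ln (f x / line_integral e f x))"
  have [measurable]: "U \<in> borel_measurable borel" unfolding U_def by measurable
  have U: "integrable lborel (\<lambda>x. U x * \<rho> x)" using int by (simp add: U_def \<rho>_def)
  define M where "M = (LBINT x. \<rho> x)"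
  define c where "c = 1 + ln (pi * t) / 2"
  have A: "A = t * D - (LBINT x. U x * \<rho> x) - c * M"
  proof -
    have "(LBINT x. (U x + 1 + ln (pi * t) / 2) * \<rho> x) = (LBINT x. U x * \<rho> x + c * \<rho> x)"
      by (intro Bochner_Integration.integral_cong) (auto simp: c_def algebra_simps)
    also have "\<dots> = (LBINT x. U x * \<rho> x) + c * M"
      using U \<rho>(1) by (simp add: M_def)
    finally show ?thesis by (simp add: A_def U_def \<rho>_def)
  qed
  define H where "H = (\<lambda>\<epsilon> x. transport_deriv t \<epsilon> e f x - 1 - ln (transport_deriv t \<epsilon> e f x))"
  have [measurable]: "H \<epsilon> \<in> borel_measurable borel" for \<epsilon> unfolding H_def by measurable
  have H_eq: "AE x in lborel. H \<epsilon> x = transport_deriv t \<epsilon> e f x - (transport t \<epsilon> e f x)\<^sup>2 / t - U x - (c + ln (1 - 2 * \<epsilon>))"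
    if "\<epsilon> < 1 / 2" for \<epsilon>
    using f_pos line_integral_pos[OF line_int f_pos]
  proof eventually_elim
    case (elim x)
    with transport_deriv_log(2)[of x \<epsilon>] that show ?case by (simp add: H_def U_def c_def)
  qed
  have H_nonneg: "AE x in lborel. 0 \<le> H \<epsilon> x" if "\<epsilon> < 1 / 2" for \<epsilon>
    using f_pos line_integral_pos[OF line_int f_pos]
  proof eventually_elim
    case (elim x)
    then have "0 < transport_deriv t \<epsilon> e f x" using that by (intro transport_deriv_log) auto
    then show ?case using ln_le_minus_one by (simp add: H_def)
  qed
  have bound: "(\<integral>\<^sup>+x. ennreal (H \<epsilon> x * \<rho> x) \<partial>lborel) \<le> ennreal (A - ln (1 - 2 * \<epsilon>) * M)" "0 \<le> A - ln (1 - 2 * \<epsilon>) * M"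
    if \<epsilon>: "0 < \<epsilon>" "\<epsilon> < 1 / 2" for \<epsilon>
  proof -
    let ?T = "transport t \<epsilon> e f" and ?T' = "transport_deriv t \<epsilon> e f"
    define B where "B = (\<lambda>x. ?T' x * \<rho> x - (?T x)\<^sup>2 * \<rho> x / t - U x * \<rho> x - (c + ln (1 - 2 * \<epsilon>)) * \<rho> x)"
    have T': "integrable lborel (\<lambda>x. (?T x)\<^sup>2 * \<rho> x)" "integrable lborel (\<lambda>x. ?T' x * \<rho> x)"
      "(LBINT x. ?T' x * \<rho> x) \<le> t * D + (LBINT x. (?T x)\<^sup>2 * \<rho> x) / t"
      using transport_inequality[OF \<epsilon>] by (simp_all add: \<rho>_def)
    have Bi: "integrable lborel B"
      unfolding B_def using T' U \<rho>(1) by (intro Bochner_Integration.integrable_diff integrable_mult_right integrable_divide) auto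
    have BH: "AE x in lborel. H \<epsilon> x * \<rho> x = B x"
      using H_eq[OF \<epsilon>(2)] by eventually_elim (simp add: B_def left_diff_distrib)
    have B0: "AE x in lborel. 0 \<le> B x"
      using BH H_nonneg[OF \<epsilon>(2)]
    proof eventually_elim
      case (elim x)
      then show ?case using \<rho>(2)[of x] by (metis mult_nonneg_nonneg)
    qed
    have "(LBINT x. B x) = (LBINT x. ?T' x * \<rho> x) - (LBINT x. (?T x)\<^sup>2 * \<rho> x) / t - (LBINT x. U x * \<rho> x) - (c + ln (1 - 2 * \<epsilon>)) * M"
      unfolding B_def M_def using T' U \<rho>(1) by simp
    also have "\<dots> \<le> A - ln (1 - 2 * \<epsilon>) * M"
      using T'(3) by (simp add: A algebra_simps)
    finally have le: "(LBINT x. B x) \<le> A - ln (1 - 2 * \<epsilon>) * M" .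
    then show "0 \<le> A - ln (1 - 2 * \<epsilon>) * M" using integral_nonneg_AE[OF B0] by linarith
    have "(\<integral>\<^sup>+x. ennreal (H \<epsilon> x * \<rho> x) \<partial>lborel) = (\<integral>\<^sup>+x. ennreal (B x) \<partial>lborel)"
      using BH by (intro nn_integral_cong_AE) auto
    also have "\<dots> = ennreal (LBINT x. B x)" by (rule nn_integral_eq_integral[OF Bi B0])
    finally show "(\<integral>\<^sup>+x. ennreal (H \<epsilon> x * \<rho> x) \<partial>lborel) \<le> ennreal (A - ln (1 - 2 * \<epsilon>) * M)"
      using le by (simp add: ennreal_leI)
  qed
  \<comment> \<open>The factor 1/3 keeps every value below 1/2.\<close>
  define \<epsilon> where "\<epsilon> = (\<lambda>n. inverse (real (Suc n)) / 3)"
  have \<epsilon>: "0 < \<epsilon> n" "\<epsilon> n < 1 / 2" for n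
  proof -
    have "inverse (real (Suc n)) \<le> 1" by (simp add: inverse_le_1_iff)
    then show "0 < \<epsilon> n" "\<epsilon> n < 1 / 2" by (auto simp: \<epsilon>_def)
  qed
  have "\<epsilon> \<longlonglongrightarrow> 0 / 3" unfolding \<epsilon>_def by (intro tendsto_divide LIMSEQ_inverse_real_of_nat tendsto_const) simp
  then have \<epsilon>0: "\<epsilon> \<longlonglongrightarrow> 0" by simp
  have "(\<lambda>n. A - ln (1 - 2 * \<epsilon> n) * M) \<longlonglongrightarrow> A - ln (1 - 2 * 0) * M"
    by (intro tendsto_intros \<epsilon>0) simp
  then have limA: "(\<lambda>n. A - ln (1 - 2 * \<epsilon> n) * M) \<longlonglongrightarrow> A" by simp
  show "0 \<le> A" by (rule LIMSEQ_le_const[OF limA]) (use bound(2)[OF \<epsilon>] in auto)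
  have lim: "AE x in lborel. (\<lambda>n. ennreal (H (\<epsilon> n) x * \<rho> x)) \<longlonglongrightarrow> ennreal (H 0 x * \<rho> x)"
    using f_pos line_integral_pos[OF line_int f_pos]
  proof eventually_elim
    case (elim x)
    have "(\<lambda>n. \<epsilon> n + (1 - 2 * \<epsilon> n) * line_cdf e f x) \<longlonglongrightarrow> 0 + (1 - 2 * 0) * line_cdf e f x"
      by (intro tendsto_intros \<epsilon>0)
    then have T: "(\<lambda>n. transport t (\<epsilon> n) e f x) \<longlonglongrightarrow> transport t 0 e f x"
      unfolding transport_def using elim
      by (intro isCont_tendsto_compose[OF isCont_gauss_quantile[OF t_pos]]) auto
    have "isCont (gauss t) y" for y
      using continuous_gauss[OF t_pos, of UNIV] by (simp add: continuous_on_eq_continuous_at)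
    then have "(\<lambda>n. transport_deriv t (\<epsilon> n) e f x) \<longlonglongrightarrow> transport_deriv t 0 e f x"
      unfolding transport_deriv_def using gauss_pos[OF t_pos, of "transport t 0 e f x"]
      by (intro tendsto_intros \<epsilon>0 isCont_tendsto_compose[OF _ T]) auto
    moreover have "0 < transport_deriv t 0 e f x" using elim by (intro transport_deriv_log) auto
    ultimately show ?case unfolding H_def by (intro tendsto_ennrealI tendsto_intros) auto
  qed
  have "(\<integral>\<^sup>+x. ennreal (H 0 x * \<rho> x) \<partial>lborel) = (\<integral>\<^sup>+x. liminf (\<lambda>n. ennreal (H (\<epsilon> n) x * \<rho> x)) \<partial>lborel)"
    using lim by (intro nn_integral_cong_AE) (auto elim!: eventually_mono simp: lim_imp_Liminf)
  also have "\<dots> \<le> liminf (\<lambda>n. \<integral>\<^sup>+x. ennreal (H (\<epsilon> n) x * \<rho> x) \<partial>lborel)"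
    by (rule nn_integral_liminf) measurable
  also have "\<dots> \<le> liminf (\<lambda>n. ennreal (A - ln (1 - 2 * \<epsilon> n) * M))"
    by (intro Liminf_mono always_eventually allI bound(1) \<epsilon>)
  also have "\<dots> = ennreal A"
    using tendsto_ennrealI[OF limA] by (simp add: lim_imp_Liminf)
  finally show "(\<integral>\<^sup>+x. ennreal ((transport_deriv t 0 e f x - 1 - ln (transport_deriv t 0 e f x)) * (cmod (\<psi> x))\<^sup>2) \<partial>lborel) \<le> ennreal A"
    by (simp add: H_def \<rho>_def)
qed

end
end
end

section \<open>Marginals\<close>

interpretation lborel_product: product_sigma_finite "\<lambda>_. lborel :: real measure"
  by standard

text \<open>The coordinates in \<open>S\<close> are integrated out, but the result stays a function
  on the whole space, constant in the directions of \<open>S\<close>. All marginals thus have one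
  type and admit the same operations on lines; values in \<open>ennreal\<close> postpone the
  question of finiteness.\<close>

definition marginal :: "'a::euclidean_space set \<Rightarrow> ('a \<Rightarrow> ennreal) \<Rightarrow> 'a \<Rightarrow> ennreal" where
  "marginal S f x = (\<integral>\<^sup>+y. f (x + (\<Sum>b\<in>S. y b *\<^sub>R b)) \<partial>(\<Pi>\<^sub>M b\<in>S. lborel))"

lemma marginal_empty: "marginal {} f x = f x"
  unfolding marginal_def by (subst lborel_product.nn_integral_empty) auto

lemma marginal_insert:
  assumes [measurable]: "f \<in> borel_measurable borel" and S: "finite S" "b \<notin> S"
  shows "marginal (insert b S) f x = (\<integral>\<^sup>+s. marginal S f (x + s *\<^sub>R b) \<partial>lborel)"
proof -
  have "(\<Sum>c\<in>insert b S. (y(b := s)) c *\<^sub>R c) = s *\<^sub>R b + (\<Sum>c\<in>S. y c *\<^sub>R c)" for y s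
    using S by (auto intro!: sum.cong)
  then show ?thesis
    unfolding marginal_def using S
    by (subst lborel_product.product_nn_integral_insert_rev) (auto simp: add.assoc)
qed

lemma marginal_measurable:
  assumes [measurable]: "f \<in> borel_measurable borel" and "finite S"
  shows "marginal S f \<in> borel_measurable borel"
  using assms(2)
proof (induction S rule: finite_induct)
  case empty
  then show ?case by (simp add: marginal_empty[abs_def])
next
  case (insert b S)
  note [measurable] = insert.IH
  show ?case
    using insert by (subst measurable_cong[OF marginal_insert]) auto
qed

lemma marginal_shift:
  assumes [measurable]: "f \<in> borel_measurable borel" and S: "finite S" "b \<in> S"
  shows "marginal S f (x + r *\<^sub>R b) = marginal S f x"
proof -
  have [measurable]: "marginal (S - {b}) f \<in> borel_measurable borel"
    using S by (intro marginal_measurable) auto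
  have "marginal S f (x + r *\<^sub>R b) = (\<integral>\<^sup>+s. marginal (S - {b}) f (x + (s + r) *\<^sub>R b) \<partial>lborel)"
    using marginal_insert[of f "S - {b}" b "x + r *\<^sub>R b"] S by (simp add: insert_absorb algebra_simps)
  also have "\<dots> = (\<integral>\<^sup>+s. marginal (S - {b}) f (x + s *\<^sub>R b) \<partial>lborel)"
    by (rule nn_integral_lborel_translate[of "\<lambda>s. marginal (S - {b}) f (x + s *\<^sub>R b)"]) measurable
  also have "\<dots> = marginal S f x"
    using marginal_insert[of f "S - {b}" b x] S by (simp add: insert_absorb)
  finally show ?thesis .
qed

lemma marginal_Basis:
  fixes f :: "'a::euclidean_space \<Rightarrow> ennreal"
  assumes [measurable]: "f \<in> borel_measurable borel"
  shows "marginal Basis f x = (\<integral>\<^sup>+z. f z \<partial>lborel)"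
proof -
  have "marginal Basis f x = (\<integral>\<^sup>+z. f (x + z) \<partial>distr (\<Pi>\<^sub>M b\<in>Basis. lborel) borel (\<lambda>y. \<Sum>b\<in>Basis. y b *\<^sub>R b))"
    unfolding marginal_def by (subst nn_integral_distr) auto
  also have "\<dots> = (\<integral>\<^sup>+z. f (z + x) \<partial>lborel)"
    by (subst (2) lborel_eq) (simp add: add.commute)
  finally show ?thesis by (simp add: nn_integral_lborel_translate)
qed

lemma marginal_pos:
  assumes [measurable]: "f \<in> borel_measurable borel" and "finite S" and pos: "\<And>x. f x > 0"
  shows "marginal S f x > 0"
  using assms(2)
proof (induction S arbitrary: x rule: finite_induct)
  case empty
  then show ?case by (simp add: marginal_empty pos)
next
  case (insert b S)
  have [measurable]: "marginal S f \<in> borel_measurable borel" using insert by (intro marginal_measurable) auto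
  show ?case
  proof (rule ccontr)
    assume "\<not> ?case"
    then have "(\<integral>\<^sup>+s. marginal S f (x + s *\<^sub>R b) \<partial>lborel) = 0"
      using insert by (simp add: marginal_insert)
    then have "AE s in lborel. marginal S f (x + s *\<^sub>R b) = 0"
      by (subst (asm) nn_integral_0_iff_AE) auto
    then have "AE s in (lborel :: real measure). False"
      by eventually_elim (use insert.IH in \<open>metis less_irrefl\<close>)
    then have "(UNIV :: real set) \<in> null_sets lborel"
      by (subst AE_iff_null_sets) auto
    then show False by (auto simp: null_sets_def)
  qed
qed

text \<open>The induction removes directions from \<open>Basis\<close>, where the marginal is the
  finite total integral. If the marginal over \<open>insert b S\<close> is finite at x, then the
  marginal over \<open>S\<close> is finite almost everywhere on the line through x in direction
  b.\<close>

lemma marginal_finite_AE: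
  fixes f :: "'a::euclidean_space \<Rightarrow> ennreal"
  assumes [measurable]: "f \<in> borel_measurable borel" and fin: "(\<integral>\<^sup>+z. f z \<partial>lborel) < \<infinity>"
    and "S \<subseteq> Basis"
  shows "AE x in lborel. marginal S f x < \<infinity>"
  using assms(3)
proof (induction "card (Basis - S)" arbitrary: S)
  case 0
  then have "S = Basis" by (auto simp: card_eq_0_iff)
  then show ?case using fin by (simp add: marginal_Basis)
next
  case (Suc n)
  then have "Basis - S \<noteq> {}" by (metis Zero_not_Suc card.empty)
  then obtain b where b: "b \<in> Basis" "b \<notin> S" by auto
  have S: "finite S" using Suc.prems finite_Basis finite_subset by blast
  have [measurable]: "marginal S f \<in> borel_measurable borel" using S by (intro marginal_measurable) auto
  have "card (Basis - insert b S) = n"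
    using Suc(2) b by (metis Diff_insert card_Diff_singleton Diff_iff diff_Suc_1)
  then have "AE x in lborel. marginal (insert b S) f x < \<infinity>"
    using Suc b by auto
  then have "AE x in lborel. AE s in lborel. marginal S f (x + s *\<^sub>R b) < \<infinity>"
  proof eventually_elim
    case (elim x)
    then have "(\<integral>\<^sup>+s. marginal S f (x + s *\<^sub>R b) \<partial>lborel) \<noteq> \<infinity>"
      using S b by (simp add: marginal_insert less_top)
    from nn_integral_PInf_AE[OF _ this] show ?case by (auto simp: less_top)
  qed
  then show ?case by (rule AE_lborel_of_lines[rotated]) measurable
qed

text \<open>The case of equality needs the estimate for the last direction, and every direction has
  to take that place.\<close>

lemma Basis_enumeration_ending_with:
  assumes "b \<in> Basis"
  obtains bs where "distinct (bs @ [b])" "set (bs @ [b]) = Basis"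
proof -
  obtain bs where "set bs = Basis - {b}" "distinct bs"
    using finite_distinct_list[of "Basis - {b}"] by auto
  then show ?thesis using assms by (intro that[of bs]) auto
qed

text \<open>\<open>enn2real\<close> sends infinity to 0. For an integrable positive \<open>f\<close>
  and \<open>S\<close> inside \<open>Basis\<close> this concerns a null set only, by
  \<open>marginal_finite_AE\<close>.\<close>

definition real_marginal :: "'a::euclidean_space set \<Rightarrow> ('a \<Rightarrow> real) \<Rightarrow> 'a \<Rightarrow> real" where
  "real_marginal S f x = enn2real (marginal S (\<lambda>x. ennreal (f x)) x)"

lemma real_marginal_measurable [measurable]:
  assumes [measurable]: "f \<in> borel_measurable borel" and "finite S"
  shows "real_marginal S f \<in> borel_measurable borel"
proof -
  have [measurable]: "marginal S (\<lambda>x. ennreal (f x)) \<in> borel_measurable borel"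
    using assms by (intro marginal_measurable) auto
  show ?thesis unfolding real_marginal_def[abs_def] by measurable
qed

lemma real_marginal_nonneg: "0 \<le> real_marginal S f x"
  by (simp add: real_marginal_def)

lemma real_marginal_shift:
  "f \<in> borel_measurable borel \<Longrightarrow> finite S \<Longrightarrow> b \<in> S \<Longrightarrow> real_marginal S f (x + r *\<^sub>R b) = real_marginal S f x"
  by (simp add: real_marginal_def marginal_shift)

text \<open>For f = exp (- t V), a normalized \<open>\<psi>\<close>, and \<open>D b\<close> the
  squared norm of the weak derivative in direction b, this is t times the excess of the energy of
  \<open>\<psi>\<close> over the lower bound.\<close>

definition deficit :: "('a::euclidean_space \<Rightarrow> real) \<Rightarrow> ('a \<Rightarrow> complex) \<Rightarrow> ('a \<Rightarrow> real) \<Rightarrow> real \<Rightarrow> real" where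
  "deficit f \<psi> D t = t * (\<Sum>b\<in>Basis. D b) - (LBINT x. ln (f x) * (cmod (\<psi> x))\<^sup>2) + ln (LBINT x. f x)
     - real DIM('a) * (1 + ln (pi * t) / 2)"

section \<open>Telescoping over the coordinates\<close>

context
  fixes f :: "'a::euclidean_space \<Rightarrow> real"
  assumes f_meas [measurable]: "f \<in> borel_measurable borel" and f_pos: "\<And>x. 0 < f x"
    and f_int: "integrable lborel f"
begin

lemma f_nn_finite: "(\<integral>\<^sup>+z. ennreal (f z) \<partial>lborel) < \<infinity>"
  using f_int f_pos by (subst nn_integral_eq_integral) (auto simp: less_imp_le)

lemma real_marginal_empty: "real_marginal {} f x = f x"
  using f_pos[of x] by (simp add: real_marginal_def marginal_empty)

lemma real_marginal_Basis: "real_marginal Basis f x = (LBINT z. f z)"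
  using f_int f_pos by (simp add: real_marginal_def marginal_Basis nn_integral_eq_integral less_imp_le)

lemma real_marginal_pos:
  assumes "S \<subseteq> Basis"
  shows "AE x in lborel. real_marginal S f x > 0"
proof -
  have "finite S" using assms finite_Basis finite_subset by blast
  then have "marginal S (\<lambda>x. ennreal (f x)) x > 0" for x
    by (intro marginal_pos) (auto simp: f_pos)
  moreover have "AE x in lborel. marginal S (\<lambda>x. ennreal (f x)) x < \<infinity>"
    by (rule marginal_finite_AE[OF _ f_nn_finite assms]) measurable
  ultimately show ?thesis
    by (auto simp: real_marginal_def enn2real_positive_iff elim!: eventually_mono)
qed

lemma real_marginal_line:
  assumes S: "S \<subseteq> Basis" and b: "b \<in> Basis" "b \<notin> S"
  shows "AE x in lborel. integrable lborel (\<lambda>s. real_marginal S f (x + s *\<^sub>R b)) \<and>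
    line_integral b (real_marginal S f) x = real_marginal (insert b S) f x"
proof -
  let ?m = "\<lambda>S. marginal S (\<lambda>x. ennreal (f x))"
  have fin: "finite S" using S finite_Basis finite_subset by blast
  have [measurable]: "real_marginal S f \<in> borel_measurable borel" "?m S \<in> borel_measurable borel"
    using fin by (auto intro!: real_marginal_measurable marginal_measurable)
  have "AE x in lborel. ?m (insert b S) x < \<infinity>"
    using S b by (intro marginal_finite_AE f_nn_finite) auto
  moreover have "AE x in lborel. AE s in lborel. ?m S (x + s *\<^sub>R b) < \<infinity>"
    using S by (intro AE_lborel_lines marginal_finite_AE f_nn_finite) auto
  ultimately show ?thesis
  proof eventually_elim
    case (elim x)
    have "(\<integral>\<^sup>+s. ennreal (real_marginal S f (x + s *\<^sub>R b)) \<partial>lborel) = (\<integral>\<^sup>+s. ?m S (x + s *\<^sub>R b) \<partial>lborel)"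
      using elim(2) by (intro nn_integral_cong_AE) (auto simp: real_marginal_def elim!: eventually_mono)
    also have "\<dots> = ?m (insert b S) x"
      using fin b by (subst marginal_insert) auto
    finally have eq: "(\<integral>\<^sup>+s. ennreal (real_marginal S f (x + s *\<^sub>R b)) \<partial>lborel) = ?m (insert b S) x" .
    have int: "integrable lborel (\<lambda>s. real_marginal S f (x + s *\<^sub>R b))"
      using elim(1) by (intro integrableI_nonneg) (auto simp: eq real_marginal_nonneg)
    have "line_integral b (real_marginal S f) x = enn2real (?m (insert b S) x)"
      unfolding line_integral_def
      by (subst integral_eq_nn_integral) (auto simp: eq real_marginal_nonneg)
    with int show ?case by (simp add: real_marginal_def)
  qed
qed

context
  fixes \<psi> :: "'a \<Rightarrow> complex" and D :: "'a \<Rightarrow> real" and t :: real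
  assumes t_pos: "t > 0"
    and psi_meas [measurable]: "\<psi> \<in> borel_measurable borel"
    and psi_sq: "integrable lborel (\<lambda>x. (cmod (\<psi> x))\<^sup>2)"
    and psi_norm: "(LBINT x. (cmod (\<psi> x))\<^sup>2) = 1"
    and D_nonneg: "\<And>b. b \<in> Basis \<Longrightarrow> 0 \<le> D b"
    and D_bound: "\<And>b h. b \<in> Basis \<Longrightarrow> 0 < h \<Longrightarrow>
       (\<integral>\<^sup>+x. ennreal ((cmod (\<psi> (x + h *\<^sub>R b) - \<psi> x))\<^sup>2) \<partial>lborel) \<le> ennreal (h\<^sup>2 * D b)"
    and ln_f_neg: "integrable lborel (\<lambda>x. max 0 (- ln (f x)) * (cmod (\<psi> x))\<^sup>2)"
begin

text \<open>Each one-dimensional step has a nonnegative excess \<open>A k\<close>, and these add up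
  to the deficit, so the deficit controls every single one. Only the last direction \<open>b\<close>
  is exported: there all other coordinates are integrated out, and the line integral is the constant
  total integral of \<open>f\<close>.\<close>

lemma marginal_chain:
  assumes bs: "distinct (bs @ [b])" "set (bs @ [b]) = Basis"
  defines "fb \<equiv> real_marginal (Basis - {b}) f"
  shows "integrable lborel (\<lambda>x. ln (f x) * (cmod (\<psi> x))\<^sup>2)"
    and "integrable lborel (\<lambda>x. ln (fb x) * (cmod (\<psi> x))\<^sup>2)"
    and "(\<integral>\<^sup>+x. ennreal ((transport_deriv t 0 b fb x - 1 - ln (transport_deriv t 0 b fb x)) * (cmod (\<psi> x))\<^sup>2) \<partial>lborel) \<le> ennreal (deficit f \<psi> D t)"
    and "t * D b - (LBINT x. ln (fb x) * (cmod (\<psi> x))\<^sup>2) + ln (LBINT x. f x) - (1 + ln (pi * t) / 2) \<le> deficit f \<psi> D t"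
    and "0 \<le> deficit f \<psi> D t"
proof -
  define \<rho> where "\<rho> = (\<lambda>x. (cmod (\<psi> x))\<^sup>2)"
  have [measurable]: "\<rho> \<in> borel_measurable borel" unfolding \<rho>_def by measurable
  have \<rho>: "integrable lborel \<rho>" "\<And>x. 0 \<le> \<rho> x" "(LBINT x. \<rho> x) = 1"
    using psi_sq psi_norm by (auto simp: \<rho>_def)
  define cs where "cs = bs @ [b]"
  define d where "d = length cs"
  have cs: "distinct cs" "set cs = Basis" using bs by (auto simp: cs_def)
  have d: "d = Suc (length bs)" "d = DIM('a)"
    using distinct_card[OF cs(1)] cs(2) by (auto simp: d_def cs_def)
  define S where "S k = set (take k cs)" for k
  have S: "S k \<subseteq> Basis" "finite (S k)" for k
    using set_take_subset[of k cs] cs(2) by (auto simp: S_def)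
  have S_Suc: "S (Suc k) = insert (cs ! k) (S k)" "cs ! k \<in> Basis" "cs ! k \<notin> S k" if "k < d" for k
  proof -
    show "S (Suc k) = insert (cs ! k) (S k)"
      using that by (simp add: S_def take_Suc_conv_app_nth d_def)
    show "cs ! k \<in> Basis" using that cs(2) nth_mem by (auto simp: d_def)
    show "cs ! k \<notin> S k"
      using that cs(1) by (auto simp: S_def in_set_conv_nth d_def nth_eq_iff_index_eq)
  qed
  define F where "F k = real_marginal (S k) f" for k
  have [measurable]: "F k \<in> borel_measurable borel" for k
    unfolding F_def using S by (intro real_marginal_measurable) auto
  have F0: "F 0 x = f x" for x by (simp add: F_def S_def real_marginal_empty)
  have Fd: "F d x = (LBINT z. f z)" for x
    by (simp add: F_def S_def d_def cs(2) real_marginal_Basis)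
  have Fpos: "AE x in lborel. F k x > 0" for k unfolding F_def by (rule real_marginal_pos[OF S(1)])
  have Fline: "AE x in lborel. integrable lborel (\<lambda>s. F k (x + s *\<^sub>R (cs ! k)))"
    "AE x in lborel. line_integral (cs ! k) (F k) x = F (Suc k) x" if "k < d" for k
    using real_marginal_line[OF S(1)[of k] S_Suc(2,3)[OF that]]
    by (auto simp: F_def S_Suc(1)[OF that] elim: eventually_mono)
  have Fnn: "0 \<le> F k x" for k x by (simp add: F_def real_marginal_nonneg)
  \<comment> \<open>Up to a null set, the logarithm of the conditional density along
    \<open>cs ! k\<close> given the coordinates not yet integrated out.\<close>
  define U where "U k x = ln (F k x) - ln (F (Suc k) x)" for k x
  have [measurable]: "U k \<in> borel_measurable borel" for k unfolding U_def by measurable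
  have U_eq: "AE x in lborel. ln (F k x / line_integral (cs ! k) (F k) x) = U k x" if "k < d" for k
    using Fline(2)[OF that] Fpos[of k] Fpos[of "Suc k"]
    by eventually_elim (simp add: U_def ln_div)
  have [measurable]: "line_integral (cs ! k) (F k) \<in> borel_measurable borel" for k
    unfolding line_integral_def[abs_def] by measurable
  have Upos: "integrable lborel (\<lambda>x. max 0 (U k x) * \<rho> x)" if k: "k < d" for k
  proof -
    have "integrable lborel (\<lambda>x. max 0 (ln (F k x / line_integral (cs ! k) (F k) x)) * (cmod (\<psi> x))\<^sup>2)"
      by (rule log_line_density_pos_part_integrable[where D = "D (cs ! k)" and t = t])
         (use Fnn t_pos Fline[OF k] psi_sq D_nonneg D_bound S_Suc[OF k] Fpos in auto)
    then show ?thesis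
      using U_eq[OF k] by (subst integrable_cong_AE[where g = "\<lambda>x. max 0 (ln (F k x / line_integral (cs ! k) (F k) x)) * (cmod (\<psi> x))\<^sup>2"])
        (auto simp: \<rho>_def elim!: eventually_mono)
  qed
  have sumU: "(\<Sum>k<d. U k x) = ln (f x) - ln (LBINT z. f z)" for x
    using sum_lessThan_telescope'[of "\<lambda>k. ln (F k x)" d] by (simp add: U_def F0 Fd)
  \<comment> \<open>The positive parts are integrable step by step, but a lower bound is known only
    for the sum, through the negative part of ln f. Hence \<open>U k\<close> is written as the sum
    minus the other terms, which are bounded by their positive parts.\<close>
  have Uneg: "integrable lborel (\<lambda>x. U k x * \<rho> x)" if k: "k < d" for k
  proof (rule Bochner_Integration.integrable_bound)
    define Z where "Z = ln (LBINT z. f z)"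
    let ?B = "\<lambda>x. max 0 (- ln (f x)) * \<rho> x + \<bar>Z\<bar> * \<rho> x + (\<Sum>j<d. max 0 (U j x) * \<rho> x)"
    show "integrable lborel ?B"
      using ln_f_neg \<rho>(1) Upos by (intro Bochner_Integration.integrable_add Bochner_Integration.integrable_sum) (auto simp: \<rho>_def)
    have "\<bar>U k x\<bar> \<le> max 0 (- ln (f x)) + \<bar>Z\<bar> + (\<Sum>j<d. max 0 (U j x))" for x
    proof -
      have "U k x = (\<Sum>j<d. U j x) - (\<Sum>j\<in>{..<d} - {k}. U j x)"
        using k by (simp add: sum.remove[of "{..<d}" k])
      moreover have "(\<Sum>j\<in>{..<d} - {k}. U j x) \<le> (\<Sum>j\<in>{..<d} - {k}. max 0 (U j x))"
        by (intro sum_mono) auto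
      moreover have "(\<Sum>j\<in>{..<d} - {k}. max 0 (U j x)) \<le> (\<Sum>j<d. max 0 (U j x))"
        by (intro sum_mono2) auto
      moreover have "max 0 (U k x) \<le> (\<Sum>j<d. max 0 (U j x))"
        using k by (intro member_le_sum) auto
      ultimately show ?thesis unfolding sumU Z_def by linarith
    qed
    then have "\<bar>U k x\<bar> * \<rho> x \<le> (max 0 (- ln (f x)) + \<bar>Z\<bar> + (\<Sum>j<d. max 0 (U j x))) * \<rho> x" for x
      by (intro mult_right_mono \<rho>(2))
    moreover have "(max 0 (- ln (f x)) + \<bar>Z\<bar> + (\<Sum>j<d. max 0 (U j x))) * \<rho> x = ?B x" for x
      by (simp only: distrib_right sum_distrib_right)
    ultimately have "\<bar>U k x\<bar> * \<rho> x \<le> \<bar>?B x\<bar>" for x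
      using order_trans[OF _ abs_ge_self] by metis
    then show "AE x in lborel. norm (U k x * \<rho> x) \<le> norm (?B x)"
      using \<rho>(2) by (intro AE_I2) (simp add: abs_mult)
  qed measurable
  define A where "A k = t * D (cs ! k) - (LBINT x. U k x * \<rho> x) - (1 + ln (pi * t) / 2)" for k
  have A: "0 \<le> A k"
    "(\<integral>\<^sup>+x. ennreal ((transport_deriv t 0 (cs ! k) (F k) x - 1 - ln (transport_deriv t 0 (cs ! k) (F k) x)) * (cmod (\<psi> x))\<^sup>2) \<partial>lborel) \<le> ennreal (A k)"
    if k: "k < d" for k
  proof -
    have int: "integrable lborel (\<lambda>x. ln (F k x / line_integral (cs ! k) (F k) x) * (cmod (\<psi> x))\<^sup>2)"
      using Uneg[OF k] U_eq[OF k] by (subst integrable_cong_AE[where g = "\<lambda>x. U k x * \<rho> x"])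
        (auto simp: \<rho>_def elim!: eventually_mono)
    have "(LBINT x. (ln (F k x / line_integral (cs ! k) (F k) x) + 1 + ln (pi * t) / 2) * (cmod (\<psi> x))\<^sup>2) =
       (LBINT x. U k x * \<rho> x + (1 + ln (pi * t) / 2) * \<rho> x)"
      using U_eq[OF k] by (intro integral_cong_AE) (auto simp: \<rho>_def algebra_simps elim!: eventually_mono)
    also have "\<dots> = (LBINT x. U k x * \<rho> x) + (1 + ln (pi * t) / 2)"
      using Uneg[OF k] \<rho> by simp
    finally have eq: "t * D (cs ! k) - (LBINT x. (ln (F k x / line_integral (cs ! k) (F k) x) + 1 + ln (pi * t) / 2) * (cmod (\<psi> x))\<^sup>2) = A k"
      by (simp add: A_def)
    note * = log_line_density_inequality[where D = "D (cs ! k)" and t = t and e = "cs ! k" and f = "F k", OF _ Fnn t_pos Fline(1)[OF k] psi_meas psi_sq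
       D_nonneg D_bound Fpos int, unfolded eq]
    show "0 \<le> A k" by (rule *) (use S_Suc[OF k] in auto)
    show "(\<integral>\<^sup>+x. ennreal ((transport_deriv t 0 (cs ! k) (F k) x - 1 - ln (transport_deriv t 0 (cs ! k) (F k) x)) * (cmod (\<psi> x))\<^sup>2) \<partial>lborel) \<le> ennreal (A k)"
      by (rule *) (use S_Suc[OF k] in auto)
  qed
  have int_sum: "integrable lborel (\<lambda>x. (\<Sum>k<d. U k x * \<rho> x))"
    using Uneg by (intro Bochner_Integration.integrable_sum) auto
  have sumU': "(\<Sum>k<d. U k x * \<rho> x) = ln (f x) * \<rho> x - ln (LBINT z. f z) * \<rho> x" for x
    using sumU[of x] by (simp add: left_diff_distrib flip: sum_distrib_right)
  have "integrable lborel (\<lambda>x. (\<Sum>k<d. U k x * \<rho> x) + ln (LBINT z. f z) * \<rho> x)"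
    using int_sum \<rho>(1) by (intro Bochner_Integration.integrable_add) auto
  then show lnf: "integrable lborel (\<lambda>x. ln (f x) * (cmod (\<psi> x))\<^sup>2)"
    unfolding sumU' by (simp add: \<rho>_def)
  have "(\<Sum>k<d. LBINT x. U k x * \<rho> x) = (LBINT x. (\<Sum>k<d. U k x * \<rho> x))"
    using Uneg by (intro Bochner_Integration.integral_sum[symmetric]) auto
  also have "\<dots> = (LBINT x. ln (f x) * \<rho> x) - ln (LBINT z. f z)"
    unfolding sumU' using lnf \<rho> by (simp add: \<rho>_def)
  finally have sum_int: "(\<Sum>k<d. LBINT x. U k x * \<rho> x) = (LBINT x. ln (f x) * \<rho> x) - ln (LBINT z. f z)" .
  have sumD: "(\<Sum>k<d. D (cs ! k)) = (\<Sum>b\<in>Basis. D b)"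
    using sum.reindex_bij_betw[OF bij_betw_nth[OF cs(1) refl refl], of D] cs(2) by (simp add: d_def)
  have "(\<Sum>k<d. A k) = t * (\<Sum>k<d. D (cs ! k)) - (\<Sum>k<d. LBINT x. U k x * \<rho> x) - real d * (1 + ln (pi * t) / 2)"
    by (simp add: A_def sum_subtractf sum_distrib_left)
  then have sumA: "(\<Sum>k<d. A k) = deficit f \<psi> D t"
    unfolding deficit_def sumD sum_int by (simp add: \<rho>_def d(2))
  define l where "l = length bs"
  have l: "l < d" "cs ! l = b" "Suc l = d" by (auto simp: l_def d(1) cs_def)
  have "A l \<le> (\<Sum>k<d. A k)" using A(1) l by (intro member_le_sum) auto
  then have Al: "A l \<le> deficit f \<psi> D t" by (simp add: sumA)
  have "S l = Basis - {b}" using bs by (auto simp: S_def l_def cs_def)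
  then have Fl: "F l = fb" by (simp add: F_def fb_def)
  show "0 \<le> deficit f \<psi> D t" using A(1)[OF l(1)] Al by simp
  show "(\<integral>\<^sup>+x. ennreal ((transport_deriv t 0 b fb x - 1 - ln (transport_deriv t 0 b fb x)) * (cmod (\<psi> x))\<^sup>2) \<partial>lborel) \<le> ennreal (deficit f \<psi> D t)"
    using A(2)[OF l(1)] Al by (simp add: l(2) Fl) (meson ennreal_leI order_trans)
  have Ul: "U l x = ln (fb x) - ln (LBINT z. f z)" for x by (simp add: U_def Fl l(3) Fd)
  have "integrable lborel (\<lambda>x. U l x * \<rho> x + ln (LBINT z. f z) * \<rho> x)"
    using Uneg[OF l(1)] \<rho>(1) by (intro Bochner_Integration.integrable_add) auto
  then show lnfb: "integrable lborel (\<lambda>x. ln (fb x) * (cmod (\<psi> x))\<^sup>2)"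
    unfolding Ul by (simp add: \<rho>_def left_diff_distrib)
  have "(LBINT x. U l x * \<rho> x) = (LBINT x. ln (fb x) * \<rho> x - ln (LBINT z. f z) * \<rho> x)"
    by (simp add: Ul left_diff_distrib)
  also have "\<dots> = (LBINT x. ln (fb x) * \<rho> x) - ln (LBINT z. f z)"
    using lnfb \<rho> by (simp add: \<rho>_def)
  finally show "t * D b - (LBINT x. ln (fb x) * (cmod (\<psi> x))\<^sup>2) + ln (LBINT x. f x) - (1 + ln (pi * t) / 2) \<le> deficit f \<psi> D t"
    using Al by (simp add: A_def l(2) \<rho>_def)
qed

end
end

section \<open>The harmonic potential\<close>

lemma norm_square_eq_sum: "(norm (x::'a::euclidean_space))\<^sup>2 = (\<Sum>b\<in>Basis. (x \<bullet> b)\<^sup>2)"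
  unfolding power2_norm_eq_inner by (subst euclidean_inner) (simp add: power2_eq_square)

text \<open>The squared ground state of the potential |x - c|^2 / t^2, written as a product so that
  its integrals reduce to one variable.\<close>

definition gaussian :: "real \<Rightarrow> 'a::euclidean_space \<Rightarrow> 'a \<Rightarrow> real" where
  "gaussian t c x = (\<Prod>b\<in>Basis. gauss t (x \<bullet> b - c \<bullet> b))"

lemma gaussian_eq:
  fixes x c :: "'a::euclidean_space"
  assumes "t > 0"
  shows "gaussian t c x = exp (- (norm (x - c))\<^sup>2 / t) / sqrt (pi * t) ^ DIM('a)"
proof -
  have "gaussian t c x = (\<Prod>b\<in>Basis. exp (- ((x - c) \<bullet> b)\<^sup>2 / t)) / sqrt (pi * t) ^ DIM('a)"
    by (simp add: gaussian_def gauss_def prod_dividef inner_diff_left)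
  also have "(\<Prod>b\<in>Basis. exp (- ((x - c) \<bullet> b)\<^sup>2 / t)) = exp (- (norm (x - c))\<^sup>2 / t)"
    by (simp add: norm_square_eq_sum exp_sum[symmetric] sum_divide_distrib sum_negf)
  finally show ?thesis .
qed

lemma gauss_moment_2:
  assumes t: "t > 0"
  shows "integrable lborel (\<lambda>y. gauss t y * y\<^sup>2)" "(LBINT y. gauss t y * y\<^sup>2) = t / 2"
proof -
  have eq: "gauss t y * y\<^sup>2 = normal_density 0 (sqrt (t / 2)) y * (y - 0) ^ (2 * 1)" for y
    using gauss_eq_normal_density[OF t] by simp
  have s: "sqrt (t / 2) > 0" using t by simp
  show "integrable lborel (\<lambda>y. gauss t y * y\<^sup>2)"
    unfolding eq by (rule integrable_normal_moment[OF s])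
  show "(LBINT y. gauss t y * y\<^sup>2) = t / 2"
    unfolding eq using integral_normal_moment_even[OF s, of 0 1] t
    by (simp add: fact_numeral field_simps)
qed

lemma gaussian_integrals:
  fixes c :: "'a::euclidean_space"
  assumes t: "t > 0"
  shows "integrable lborel (gaussian t c)" "(LBINT x. gaussian t c x) = 1"
    and "b \<in> Basis \<Longrightarrow> integrable lborel (\<lambda>x. ((x - c) \<bullet> b)\<^sup>2 * gaussian t c x)"
    and "b \<in> Basis \<Longrightarrow> (LBINT x. ((x - c) \<bullet> b)\<^sup>2 * gaussian t c x) = t / 2"
proof -
  have g0: "0 \<le> gauss t y" for y using gauss_pos[OF t] by (simp add: less_imp_le)
  have [measurable]: "gaussian t c \<in> borel_measurable borel"
    unfolding gaussian_def[abs_def] by measurable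
  have G0: "0 \<le> gaussian t c x" for x unfolding gaussian_def by (intro prod_nonneg g0)
  have one: "(\<integral>\<^sup>+y. ennreal (gauss t (y - r)) \<partial>lborel) = 1" for r
  proof -
    have "(\<integral>\<^sup>+y. ennreal (gauss t (y - r)) \<partial>lborel) = (\<integral>\<^sup>+y. ennreal (gauss t (y + r - r)) \<partial>lborel)"
      by (rule nn_integral_lborel_translate[of "\<lambda>y. ennreal (gauss t (y - r))", symmetric]) measurable
    then show ?thesis using t g0 by (simp add: nn_integral_eq_integral gauss_integrable gauss_integral)
  qed
  have two: "(\<integral>\<^sup>+y. ennreal ((y - r)\<^sup>2 * gauss t (y - r)) \<partial>lborel) = ennreal (t / 2)" for r
  proof -
    have "(\<integral>\<^sup>+y. ennreal ((y - r)\<^sup>2 * gauss t (y - r)) \<partial>lborel) = (\<integral>\<^sup>+y. ennreal ((y + r - r)\<^sup>2 * gauss t (y + r - r)) \<partial>lborel)"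
      by (rule nn_integral_lborel_translate[of "\<lambda>y. ennreal ((y - r)\<^sup>2 * gauss t (y - r))", symmetric]) measurable
    then show ?thesis using gauss_moment_2[OF t] g0 by (simp add: nn_integral_eq_integral mult.commute)
  qed
  have nn: "(\<integral>\<^sup>+x. ennreal (gaussian t c x) \<partial>lborel) = 1"
  proof -
    have "(\<integral>\<^sup>+x. ennreal (gaussian t c x) \<partial>lborel) = (\<integral>\<^sup>+x. (\<Prod>b\<in>Basis. ennreal (gauss t (x \<bullet> b - c \<bullet> b))) \<partial>lborel)"
      by (simp add: gaussian_def prod_ennreal g0)
    also have "\<dots> = (\<Prod>b\<in>(Basis :: 'a set). \<integral>\<^sup>+y. ennreal (gauss t (y - c \<bullet> b)) \<partial>lborel)"
      by (rule nn_integral_lborel_prod) auto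
    finally show ?thesis by (simp add: one)
  qed
  show "integrable lborel (gaussian t c)"
    using nn by (intro integrableI_nonneg) (auto simp: G0)
  show "(LBINT x. gaussian t c x) = 1"
    by (subst integral_eq_nn_integral) (auto simp: nn G0)
  assume b: "b \<in> Basis"
  have nn2: "(\<integral>\<^sup>+x. ennreal (((x - c) \<bullet> b)\<^sup>2 * gaussian t c x) \<partial>lborel) = ennreal (t / 2)"
  proof -
    \<comment> \<open>The factors of the density, with the second moment inserted in the factor for
      direction \<open>b\<close>.\<close>
    define k where "k b' y = (if b' = b then (y - c \<bullet> b')\<^sup>2 * gauss t (y - c \<bullet> b') else gauss t (y - c \<bullet> b'))" for b' y
    have [measurable]: "k b' \<in> borel_measurable borel" for b'
      unfolding k_def[abs_def] by (cases "b' = b") auto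
    have "((x - c) \<bullet> b)\<^sup>2 * gaussian t c x = (\<Prod>b'\<in>Basis. k b' (x \<bullet> b'))" for x
    proof -
      have "(\<Prod>b'\<in>Basis. k b' (x \<bullet> b')) = k b (x \<bullet> b) * (\<Prod>b'\<in>Basis - {b}. k b' (x \<bullet> b'))"
        using b by (simp add: prod.remove)
      also have "(\<Prod>b'\<in>Basis - {b}. k b' (x \<bullet> b')) = (\<Prod>b'\<in>Basis - {b}. gauss t (x \<bullet> b' - c \<bullet> b'))"
        by (intro prod.cong) (auto simp: k_def)
      finally show ?thesis
        using b by (simp add: gaussian_def prod.remove[of Basis b "\<lambda>b. gauss t (x \<bullet> b - c \<bullet> b)"] k_def inner_diff_left)
    qed
    then have "(\<integral>\<^sup>+x. ennreal (((x - c) \<bullet> b)\<^sup>2 * gaussian t c x) \<partial>lborel) = (\<integral>\<^sup>+x. (\<Prod>b'\<in>Basis. ennreal (k b' (x \<bullet> b'))) \<partial>lborel)"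
      using g0 by (simp add: prod_ennreal k_def)
    also have "\<dots> = (\<Prod>b'\<in>(Basis :: 'a set). \<integral>\<^sup>+y. ennreal (k b' y) \<partial>lborel)"
      by (rule nn_integral_lborel_prod) auto
    also have "\<dots> = (\<integral>\<^sup>+y. ennreal (k b y) \<partial>lborel) * (\<Prod>b'\<in>Basis - {b}. \<integral>\<^sup>+y. ennreal (k b' y) \<partial>lborel)"
      using b by (simp add: prod.remove)
    also have "(\<Prod>b'\<in>Basis - {b}. \<integral>\<^sup>+y. ennreal (k b' y) \<partial>lborel) = 1"
      by (intro prod.neutral) (auto simp: k_def one)
    finally show ?thesis by (simp add: k_def two)
  qed
  show "integrable lborel (\<lambda>x. ((x - c) \<bullet> b)\<^sup>2 * gaussian t c x)"
    using nn2 by (intro integrableI_nonneg) (auto simp: G0)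
  show "(LBINT x. ((x - c) \<bullet> b)\<^sup>2 * gaussian t c x) = t / 2"
    using t by (subst integral_eq_nn_integral) (auto simp: nn2 G0)
qed

section \<open>Integration by parts and the Gaussian trial function\<close>

lemma continuous_compact_support_integrable:
  fixes g :: "'a::euclidean_space \<Rightarrow> real"
  assumes "continuous_on UNIV g" "\<And>x. x \<notin> cbox a b \<Longrightarrow> g x = 0"
  shows "integrable lborel g"
proof -
  have "integrable lborel (\<lambda>x. indicator (cbox a b) x *\<^sub>R g x)"
    by (intro borel_integrable_compact continuous_on_subset[OF assms(1)]) auto
  also have "(\<lambda>x. indicator (cbox a b) x *\<^sub>R g x) = g"
    using assms(2) by (auto simp: indicator_def fun_eq_iff)
  finally show ?thesis .
qed

text \<open>The difference quotients of the compactly supported product u = \<phi> G have integral 0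
  by translation invariance, and dominated convergence passes this on to the derivative of
  u.\<close>

lemma integral_partial_by_parts:
  fixes \<phi> G G' :: "real^'n::finite \<Rightarrow> real" and i :: 'n
  defines "e \<equiv> axis i 1 :: real^'n"
  assumes \<phi>: "test_function \<phi>" and cont: "continuous_on UNIV G" "continuous_on UNIV G'"
    and deriv: "\<And>x s. ((\<lambda>s. G (x + s *\<^sub>R e)) has_real_derivative G' (x + s *\<^sub>R e)) (at s)"
  shows "(LBINT x. partial i \<phi> x * G x) = - (LBINT x. \<phi> x * G' x)"
proof -
  obtain a b where ab: "\<And>x. x \<notin> cbox a b \<Longrightarrow> \<phi> x = 0" "\<And>x i. x \<notin> cbox a b \<Longrightarrow> partial i \<phi> x = 0"
    using test_functionE[OF \<phi>] by metis
  have "C_k 0 \<phi>" "C_k (Suc 0) \<phi>" using \<phi> unfolding test_function_def by blast+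
  then have c\<phi>: "continuous_on UNIV \<phi>" "continuous_on UNIV (partial i \<phi>)" by simp_all
  define u where "u = (\<lambda>x. \<phi> x * G x)"
  define u' where "u' = (\<lambda>x. partial i \<phi> x * G x + \<phi> x * G' x)"
  have cu: "continuous_on UNIV u" "continuous_on UNIV u'"
    unfolding u_def u'_def by (intro continuous_intros c\<phi> cont)+
  have [measurable]: "u \<in> borel_measurable borel" "u' \<in> borel_measurable borel"
    using cu by (auto intro: borel_measurable_continuous_onI)
  have supp: "u x = 0" "u' x = 0" if "x \<notin> cbox a b" for x using ab that by (auto simp: u_def u'_def)
  have uint: "integrable lborel u" using continuous_compact_support_integrable[OF cu(1) supp(1)] .
  have D: "((\<lambda>s. u (x + s *\<^sub>R e)) has_real_derivative u' (x + s *\<^sub>R e)) (at s)" for x s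
  proof -
    have "((\<lambda>s. \<phi> (x - (- s) *\<^sub>R axis i 1)) has_real_derivative - partial i \<phi> (x - (- s) *\<^sub>R axis i 1) * - 1) (at s)"
      by (rule DERIV_chain2[OF test_function_DERIV_line[OF \<phi>]]) (auto intro!: derivative_eq_intros)
    then have "((\<lambda>s. \<phi> (x + s *\<^sub>R e)) has_real_derivative partial i \<phi> (x + s *\<^sub>R e)) (at s)"
      by (simp add: e_def)
    from DERIV_mult[OF this deriv] show ?thesis
      unfolding u_def u'_def by (simp add: algebra_simps)
  qed
  have "bounded (u' ` cbox a b)"
    by (intro compact_imp_bounded compact_continuous_image continuous_on_subset[OF cu(2)]) auto
  then obtain B0 where B0: "\<And>x. x \<in> cbox a b \<Longrightarrow> \<bar>u' x\<bar> \<le> B0" by (auto simp: bounded_real)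
  define B where "B = max B0 0"
  have B: "\<bar>u' x\<bar> \<le> B" for x using B0[of x] supp(2)[of x] by (cases "x \<in> cbox a b") (auto simp: B_def)
  have B_nonneg: "0 \<le> B" by (simp add: B_def)
  define h where "h = (\<lambda>n. inverse (real (Suc n)))"
  have h: "0 < h n" "h n \<le> 1" for n by (auto simp: h_def inverse_le_1_iff)
  define q where "q = (\<lambda>n x. (u (x + h n *\<^sub>R e) - u x) / h n)"
  have [measurable]: "q n \<in> borel_measurable borel" for n unfolding q_def by measurable
  \<comment> \<open>By the mean value theorem a difference quotient is a value of u' at most one
    unit ahead, because h n \<le> 1. The box extended by e on the lower side therefore carries all
    quotients.\<close>
  have qB: "\<bar>q n x\<bar> \<le> B * indicator (cbox (a - e) b) x" for n x
  proof -
    obtain z where z: "z > 0" "z < h n" "u (x + h n *\<^sub>R e) - u (x + 0 *\<^sub>R e) = (h n - 0) * u' (x + z *\<^sub>R e)"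
      using MVT2[of 0 "h n" "\<lambda>s. u (x + s *\<^sub>R e)" "\<lambda>s. u' (x + s *\<^sub>R e)"] h(1)[of n] D by auto
    then have qz: "q n x = u' (x + z *\<^sub>R e)" using h(1)[of n] by (simp add: q_def)
    show ?thesis
    proof (cases "x \<in> cbox (a - e) b")
      case True
      then show ?thesis using B qz by simp
    next
      case False
      have "x + z *\<^sub>R e \<notin> cbox a b"
      proof
        assume *: "x + z *\<^sub>R e \<in> cbox a b"
        have "a $ j - e $ j \<le> x $ j \<and> x $ j \<le> b $ j" for j
        proof -
          have "0 \<le> z * e $ j" "z * e $ j \<le> e $ j"
            using z h(2)[of n] by (auto simp: e_def axis_def)
          moreover have "a $ j \<le> x $ j + z * e $ j" "x $ j + z * e $ j \<le> b $ j"
            using * by (simp_all add: mem_box_cart)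
          ultimately show ?thesis by linarith
        qed
        then have "x \<in> cbox (a - e) b" by (simp add: mem_box_cart)
        with False show False by simp
      qed
      then show ?thesis using supp(2) qz False by simp
    qed
  qed
  have "(\<lambda>n. LBINT x. q n x) \<longlonglongrightarrow> (LBINT x. u' x)"
  proof (rule integral_dominated_convergence[where w = "\<lambda>x. B * indicator (cbox (a - e) b) x"])
    show "AE x in lborel. (\<lambda>n. q n x) \<longlonglongrightarrow> u' x"
    proof (rule AE_I2)
      fix x
      have "((\<lambda>s. (u (x + s *\<^sub>R e) - u x) / s) \<longlongrightarrow> u' x) (at 0)"
        using D[of x 0] by (simp add: has_field_derivative_iff)
      moreover have "filterlim h (at 0) sequentially"
        unfolding filterlim_at using h LIMSEQ_inverse_real_of_nat by (auto simp: h_def intro!: always_eventually)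
      ultimately show "(\<lambda>n. q n x) \<longlonglongrightarrow> u' x"
        unfolding q_def by (rule filterlim_compose)
    qed
    show "integrable lborel (\<lambda>x. B * indicator (cbox (a - e) b) x)"
      by (intro integrable_mult_right integrable_real_indicator) (auto simp: emeasure_lborel_cbox_eq)
  qed (use qB in auto)
  moreover have "(LBINT x. q n x) = 0" for n
    using integrable_lborel_translate[OF uint, of "h n *\<^sub>R e"] uint integral_lborel_translate[of u "h n *\<^sub>R e"]
    by (simp add: q_def)
  ultimately have "(LBINT x. u' x) = 0"
    using LIMSEQ_unique[OF _ tendsto_const[of 0]] by simp
  moreover have "(LBINT x. u' x) = (LBINT x. partial i \<phi> x * G x) + (LBINT x. \<phi> x * G' x)"
    unfolding u'_def
    by (intro Bochner_Integration.integral_add continuous_compact_support_integrable[of _ a b] continuous_intros c\<phi> cont) (auto simp: ab)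
  ultimately show ?thesis by simp
qed

lemma weak_partial_props:
  assumes "\<psi> \<in> H1"
  shows "weak_partial i \<psi> \<in> L2" "has_weak_partial i \<psi> (weak_partial i \<psi>)"
proof -
  have "\<exists>g. g \<in> L2 \<and> has_weak_partial i \<psi> g" using assms by (auto simp: H1_def)
  from someI_ex[OF this] show "weak_partial i \<psi> \<in> L2" "has_weak_partial i \<psi> (weak_partial i \<psi>)"
    by (auto simp: weak_partial_def)
qed

lemma test_function_scaleR_integrable:
  assumes \<phi>: "test_function \<phi>" and g: "g \<in> L2"
  shows "integrable lebesgue (\<lambda>x. \<phi> x *\<^sub>R g x)"
proof -
  obtain a b C where C: "\<And>x. x \<notin> cbox a b \<Longrightarrow> \<phi> x = 0" "\<And>x. \<bar>\<phi> x\<bar> \<le> C"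
    using test_functionE[OF \<phi>] by metis
  have [measurable]: "\<phi> \<in> borel_measurable lebesgue" "g \<in> borel_measurable lebesgue"
    using test_function_measurable[OF \<phi>] g by (auto simp: L2_def intro: measurable_completion)
  have si: "integrable lebesgue (\<lambda>x. indicator (cbox a b) x *\<^sub>R g x)"
    using set_integrable_cbox_of_square[of g a b] g by (auto simp: L2_def set_integrable_def)
  show ?thesis
  proof (rule Bochner_Integration.integrable_bound[OF integrable_mult_right[OF integrable_norm[OF si], of C]])
    have "norm (\<phi> x *\<^sub>R g x) \<le> norm (C * norm (indicat_real (cbox a b) x *\<^sub>R g x))" for x
      using C(1)[of x] C(2)[of x] by (cases "x \<in> cbox a b") (auto simp: abs_mult intro!: mult_right_mono)
    then show "AE x in lebesgue. norm (\<phi> x *\<^sub>R g x) \<le> norm (C * norm (indicat_real (cbox a b) x *\<^sub>R g x))" by simp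
  qed measurable
qed

text \<open>Identifies the function chosen in \<open>weak_partial\<close> with an explicitly
  computed derivative.\<close>

lemma has_weak_partial_unique:
  assumes g: "g \<in> L2" "has_weak_partial i \<psi> g" and g': "g' \<in> L2" "has_weak_partial i \<psi> g'"
  shows "AE x in lebesgue. g x = g' x"
proof -
  have [measurable]: "g \<in> borel_measurable lebesgue" "g' \<in> borel_measurable lebesgue"
    using g g' by (auto simp: L2_def)
  have "AE x in lebesgue. g x - g' x = 0"
  proof (rule AE_eq_0_if_orthogonal_to_test_functions)
    show "integrable lebesgue (\<lambda>x. (cmod (g x - g' x))\<^sup>2)"
    proof (rule Bochner_Integration.integrable_bound)
      show "integrable lebesgue (\<lambda>x. 2 * ((cmod (g x))\<^sup>2 + (cmod (g' x))\<^sup>2))"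
        using g g' by (auto simp: L2_def)
      have "(cmod (u - v))\<^sup>2 \<le> 2 * ((cmod u)\<^sup>2 + (cmod v)\<^sup>2)" for u v
      proof -
        have "(cmod (u - v))\<^sup>2 \<le> (cmod u + cmod v)\<^sup>2"
          by (intro power_mono norm_triangle_ineq4) auto
        also have "\<dots> \<le> 2 * ((cmod u)\<^sup>2 + (cmod v)\<^sup>2)"
          using zero_le_power2[of "cmod u - cmod v"] by (simp add: power2_eq_square algebra_simps)
        finally show ?thesis .
      qed
      then show "AE x in lebesgue. norm ((cmod (g x - g' x))\<^sup>2) \<le> norm (2 * ((cmod (g x))\<^sup>2 + (cmod (g' x))\<^sup>2))"
        by (intro AE_I2) simp
    qed measurable
    fix \<phi> :: "real^'a \<Rightarrow> real" assume \<phi>: "test_function \<phi>"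
    show "(LINT x|lebesgue. \<phi> x *\<^sub>R (g x - g' x)) = 0"
      using g g' \<phi> test_function_scaleR_integrable[OF \<phi> g(1)] test_function_scaleR_integrable[OF \<phi> g'(1)]
      by (simp add: scaleR_diff_right has_weak_partial_def)
  qed measurable
  then show ?thesis by eventually_elim simp
qed

text \<open>The trial function is the square root of the Gaussian density, the ground state of the
  oscillator. With d the dimension, its kinetic energy and its energy in the quadratic potential are
  both d / (2 t).\<close>

lemma lowest_eigenvalue_harmonic_le:
  fixes V :: "real^'n::finite \<Rightarrow> real" and c :: "real^'n"
  assumes t: "t > 0" and [measurable]: "V \<in> borel_measurable lebesgue"
    and V: "AE x in lebesgue. V x = (1 / t\<^sup>2) * (norm (x - c))\<^sup>2 + C"
  shows "lowest_eigenvalue V \<le> ereal (real CARD('n) / t + C)"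
proof -
  let ?\<rho> = "gaussian t c :: real^'n \<Rightarrow> real"
  define N where "N = 1 / sqrt (sqrt (pi * t) ^ CARD('n))"
  define G where "G = (\<lambda>x::real^'n. N * exp (- (norm (x - c))\<^sup>2 / (2 * t)))"
  define G' where "G' i x = - ((x - c) \<bullet> axis i 1) / t * G x" for i x
  define \<psi> where "\<psi> = (\<lambda>x. complex_of_real (G x))"
  define g where "g i x = complex_of_real (G' i x)" for i x
  have \<rho>_eq: "(G x)\<^sup>2 = ?\<rho> x" for x
  proof -
    have "(G x)\<^sup>2 = N\<^sup>2 * (exp (- (norm (x - c))\<^sup>2 / (2 * t)))\<^sup>2" by (simp add: G_def power_mult_distrib)
    also have "(exp (- (norm (x - c))\<^sup>2 / (2 * t)))\<^sup>2 = exp (- (norm (x - c))\<^sup>2 / t)"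
      by (simp add: exp_double[symmetric])
    also have "N\<^sup>2 = 1 / sqrt (pi * t) ^ CARD('n)"
      using t by (simp add: N_def power_divide)
    finally show ?thesis using t by (simp add: gaussian_eq)
  qed
  have cont: "continuous_on UNIV G" "continuous_on UNIV (G' i)" for i
    unfolding G_def G'_def by (intro continuous_intros; use t in simp)+
  have [measurable]: "G \<in> borel_measurable borel" "G' i \<in> borel_measurable borel" for i
    using cont by (auto intro: borel_measurable_continuous_onI)
  have [measurable]: "?\<rho> \<in> borel_measurable borel"
    using gaussian_integrals(1)[OF t, of c] by (auto dest: borel_measurable_integrable)
  have m [measurable]: "G \<in> borel_measurable lebesgue" "G' i \<in> borel_measurable lebesgue" "?\<rho> \<in> borel_measurable lebesgue" for i
    by (auto intro: measurable_completion)
  have [measurable]: "\<psi> \<in> borel_measurable lebesgue" "g i \<in> borel_measurable lebesgue" for i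
    unfolding \<psi>_def g_def[abs_def] by measurable
  have deriv: "((\<lambda>s. G (x + s *\<^sub>R axis i 1)) has_real_derivative G' i (x + s *\<^sub>R axis i 1)) (at s)" for x s i
  proof -
    define a where "a = (x - c) \<bullet> axis i 1"
    have n: "(norm (x + r *\<^sub>R axis i 1 - c))\<^sup>2 = (norm (x - c))\<^sup>2 + 2 * r * a + r\<^sup>2" for r
    proof -
      have "(norm (y + r *\<^sub>R axis i 1))\<^sup>2 = (norm y)\<^sup>2 + 2 * r * (y \<bullet> axis i 1) + r\<^sup>2" for y :: "real^'n"
        unfolding power2_norm_eq_inner
        by (simp add: inner_add_left inner_add_right inner_commute inner_axis_axis power2_eq_square)
      from this[of "x - c"] show ?thesis by (simp add: a_def algebra_simps)
    qed
    have "((\<lambda>s. N * exp (- ((norm (x - c))\<^sup>2 + 2 * s * a + s\<^sup>2) / (2 * t))) has_real_derivative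
       N * (exp (- ((norm (x - c))\<^sup>2 + 2 * s * a + s\<^sup>2) / (2 * t)) * (- (2 * a + 2 * s) / (2 * t)))) (at s)"
    proof (intro DERIV_cmult DERIV_fun_exp)
      show "((\<lambda>s. - ((norm (x - c))\<^sup>2 + 2 * s * a + s\<^sup>2) / (2 * t)) has_real_derivative - (2 * a + 2 * s) / (2 * t)) (at s)"
        by (rule DERIV_cdivide) (auto intro!: derivative_eq_intros)
    qed
    moreover have eq: "- (2 * a + 2 * s) / (2 * t) = - ((x + s *\<^sub>R axis i 1 - c) \<bullet> axis i 1) / t"
      using t by (simp add: a_def inner_diff_left inner_add_left inner_axis_axis field_simps)
    moreover have "(\<lambda>s. G (x + s *\<^sub>R axis i 1)) = (\<lambda>s. N * exp (- ((norm (x - c))\<^sup>2 + 2 * s * a + s\<^sup>2) / (2 * t)))"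
      by (simp only: G_def n)
    moreover have "G' i (x + s *\<^sub>R axis i 1) = N * (exp (- ((norm (x - c))\<^sup>2 + 2 * s * a + s\<^sup>2) / (2 * t)) * (- (2 * a + 2 * s) / (2 * t)))"
      unfolding G'_def G_def n eq by (simp only: mult_ac)
    ultimately show ?thesis by (simp only:)
  qed
  have weak: "has_weak_partial i \<psi> (g i)" for i
    unfolding has_weak_partial_def
  proof (intro allI impI)
    fix \<phi> :: "real^'n \<Rightarrow> real" assume \<phi>: "test_function \<phi>"
    have [measurable]: "\<phi> \<in> borel_measurable borel" "partial i \<phi> \<in> borel_measurable borel"
      by (rule test_function_measurable[OF \<phi>])+
    have "(LINT x|lebesgue. partial i \<phi> x *\<^sub>R \<psi> x) = (LINT x|lebesgue. complex_of_real (partial i \<phi> x * G x))"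
      by (simp add: \<psi>_def scaleR_conv_of_real)
    also have "\<dots> = complex_of_real (LBINT x. partial i \<phi> x * G x)"
      by (simp add: integral_completion del: of_real_mult)
    also have "\<dots> = - complex_of_real (LBINT x. \<phi> x * G' i x)"
      by (subst integral_partial_by_parts[OF \<phi> cont deriv]) simp
    also have "complex_of_real (LBINT x. \<phi> x * G' i x) = (LINT x|lebesgue. \<phi> x *\<^sub>R g i x)"
      by (simp add: g_def scaleR_conv_of_real integral_completion flip: of_real_mult)
    finally show "(LINT x|lebesgue. partial i \<phi> x *\<^sub>R \<psi> x) = - (LINT x|lebesgue. \<phi> x *\<^sub>R g i x)" .
  qed
  have \<psi>2: "(cmod (\<psi> x))\<^sup>2 = ?\<rho> x" for x by (simp add: \<psi>_def \<rho>_eq)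
  have g2: "(cmod (g i x))\<^sup>2 = ((x - c) \<bullet> axis i 1)\<^sup>2 * ?\<rho> x / t\<^sup>2" for i x
    unfolding g_def norm_of_real power2_abs \<rho>_eq[symmetric] G'_def by (simp add: power_mult_distrib power_divide)
  have ax: "axis i (1::real) \<in> Basis" for i :: 'n by simp
  note int = gaussian_integrals[OF t, where c = c]
  have intL: "integrable lebesgue ?\<rho>" "(LINT x|lebesgue. ?\<rho> x) = 1"
    "integrable lebesgue (\<lambda>x. ((x - c) \<bullet> axis i 1)\<^sup>2 * ?\<rho> x)" "(LINT x|lebesgue. ((x - c) \<bullet> axis i 1)\<^sup>2 * ?\<rho> x) = t / 2" for i
    using int(1,2) int(3,4)[OF ax] by (simp_all add: integrable_completion integral_completion)
  have L2: "\<psi> \<in> L2" "g i \<in> L2" for i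
    using intL by (auto simp: L2_def \<psi>2 g2)
  have H1: "\<psi> \<in> H1" using L2 weak by (auto simp: H1_def)
  have "(norm y)\<^sup>2 = (\<Sum>i\<in>UNIV. (y \<bullet> axis i 1)\<^sup>2)" for y :: "real^'n"
    unfolding power2_norm_eq_inner inner_vec_def[of y y] by (simp add: inner_axis power2_eq_square)
  from this[of "_ - c"] have nsq: "(norm (x - c))\<^sup>2 = (\<Sum>i\<in>UNIV. ((x - c) \<bullet> axis i 1)\<^sup>2)" for x .
  have intn: "integrable lebesgue (\<lambda>x. (norm (x - c))\<^sup>2 * ?\<rho> x)" "(LINT x|lebesgue. (norm (x - c))\<^sup>2 * ?\<rho> x) = real CARD('n) * (t / 2)"
    unfolding nsq sum_distrib_right
    by (intro Bochner_Integration.integrable_sum intL(3))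
       (subst Bochner_Integration.integral_sum, rule intL(3), simp only: intL(4) sum_constant)
  have fd: "\<psi> \<in> form_domain V"
    unfolding form_domain_def
  proof (intro CollectI conjI H1)
    show "integrable lebesgue (\<lambda>x. max (V x) 0 * (cmod (\<psi> x))\<^sup>2)"
    proof (rule Bochner_Integration.integrable_bound)
      show "integrable lebesgue (\<lambda>x. (norm (x - c))\<^sup>2 * ?\<rho> x / t\<^sup>2 + \<bar>C\<bar> * ?\<rho> x)"
        using intn intL by simp
      show "AE x in lebesgue. norm (max (V x) 0 * (cmod (\<psi> x))\<^sup>2) \<le> norm ((norm (x - c))\<^sup>2 * ?\<rho> x / t\<^sup>2 + \<bar>C\<bar> * ?\<rho> x)"
        using V
      proof eventually_elim
        case (elim x)
        have "0 \<le> (norm (x - c))\<^sup>2 / t\<^sup>2" by simp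
        then have "max (V x) 0 \<le> (norm (x - c))\<^sup>2 / t\<^sup>2 + \<bar>C\<bar>" using elim by simp
        moreover have \<rho>0: "0 \<le> ?\<rho> x" by (simp flip: \<rho>_eq)
        ultimately have "max (V x) 0 * ?\<rho> x \<le> ((norm (x - c))\<^sup>2 / t\<^sup>2 + \<bar>C\<bar>) * ?\<rho> x"
          by (intro mult_right_mono)
        then show ?case using \<rho>0 by (simp add: \<psi>2 abs_mult distrib_right)
      qed
    qed (simp add: \<psi>2)
  qed
  have norm1: "L2_norm \<psi> = 1" by (simp add: L2_norm_def \<psi>2 intL)
  have "AE x in lebesgue. \<forall>i. weak_partial i \<psi> x = g i x"
    unfolding AE_all_countable
    by (intro allI has_weak_partial_unique[OF weak_partial_props[OF H1] L2(2) weak])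
  with V have ae: "AE x in lebesgue. (\<Sum>i\<in>UNIV. (cmod (weak_partial i \<psi> x))\<^sup>2) + V x * (cmod (\<psi> x))\<^sup>2 =
     2 / t\<^sup>2 * ((norm (x - c))\<^sup>2 * ?\<rho> x) + C * ?\<rho> x"
  proof eventually_elim
    case (elim x)
    have "(\<Sum>i\<in>UNIV. (cmod (weak_partial i \<psi> x))\<^sup>2) = (norm (x - c))\<^sup>2 * ?\<rho> x / t\<^sup>2"
      using elim(2) unfolding nsq by (simp add: g2 sum_divide_distrib sum_distrib_right)
    then show ?case using elim(1) by (simp add: \<psi>2 algebra_simps)
  qed
  have [measurable]: "weak_partial i \<psi> \<in> borel_measurable lebesgue" for i
    using weak_partial_props(1)[OF H1] by (auto simp: L2_def)
  have "schroedinger_form V \<psi> = (LINT x|lebesgue. 2 / t\<^sup>2 * ((norm (x - c))\<^sup>2 * ?\<rho> x) + C * ?\<rho> x)"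
    unfolding schroedinger_form_def
  proof (rule integral_cong_AE[OF _ _ ae])
    have "(\<lambda>x. (norm (x - c))\<^sup>2 * ?\<rho> x) \<in> borel_measurable lebesgue" using intn(1) by (rule borel_measurable_integrable)
    then show "(\<lambda>x. 2 / t\<^sup>2 * ((norm (x - c))\<^sup>2 * ?\<rho> x) + C * ?\<rho> x) \<in> borel_measurable lebesgue" by measurable
  qed measurable
  also have "\<dots> = 2 / t\<^sup>2 * (real CARD('n) * (t / 2)) + C"
    using intn intL by (subst Bochner_Integration.integral_add) (auto simp del: times_divide_eq_left)
  also have "\<dots> = real CARD('n) / t + C"
    using t by (simp add: field_simps power2_eq_square)
  finally have "schroedinger_form V \<psi> = real CARD('n) / t + C" .
  then show ?thesis
    unfolding lowest_eigenvalue_def using fd norm1 by (intro INF_lower2[of \<psi>]) auto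
qed

section \<open>Rigidity of the marginals\<close>

text \<open>The hypothesis is T' = 1 written without derivatives, and it holds only almost
  everywhere. It improves itself: the distribution function is continuous, so the right-hand side is
  continuous, so the distribution function is differentiable everywhere. Then T has derivative 1
  everywhere and is a translation.\<close>

lemma gaussian_if_transport_trivial:
  fixes \<phi> :: "real \<Rightarrow> real"
  assumes t: "t > 0" and \<phi>: "integrable lborel \<phi>" and pos: "AE y in lborel. \<phi> y > 0"
  defines "Z \<equiv> LBINT y. \<phi> y"
  assumes eq: "AE y in lborel. \<phi> y = Z * gauss t (gauss_quantile t ((LBINT s. indicator {..y} s * \<phi> s) / Z))"
  shows "\<exists>\<beta>. AE y in lborel. \<phi> y = Z * gauss t (y + \<beta>)"
proof -
  define F where "F y = (LBINT s. indicator {..y} s * \<phi> s) / Z" for y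
  define g where "g y = gauss t (gauss_quantile t (F y))" for y
  have Z: "Z > 0" using integral_pos_if_AE_pos[OF \<phi> pos, of UNIV] by (simp add: Z_def)
  have F01: "0 < F y" "F y < 1" for y
    using integral_atMost_strict_bounds[OF \<phi> pos, of y] Z by (auto simp: F_def Z_def)
  have Zc: "(LBINT s. indicator {..y} s * (\<phi> s / Z)) = F y" for y by (simp add: F_def)
  have intZ: "integrable lborel (\<lambda>s. \<phi> s / Z)" using \<phi> by simp
  have cF: "continuous_on UNIV F"
  proof (rule continuous_at_imp_continuous_on, rule ballI)
    fix y
    show "isCont F y"
      unfolding isCont_def
    proof (rule tendsto_at_iff_sequentially[THEN iffD2], intro allI impI)
      fix X :: "nat \<Rightarrow> real"
      assume "\<forall>i. X i \<in> UNIV - {y}" and X: "X \<longlonglongrightarrow> y"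
      have "(\<lambda>n. LBINT s. indicator {..X n} s * \<phi> s) \<longlonglongrightarrow> (LBINT s. indicator {..y} s * \<phi> s)"
      proof (rule integral_dominated_convergence[where w = "\<lambda>s. \<bar>\<phi> s\<bar>"])
        show "AE s in lborel. (\<lambda>n. indicator {..X n} s * \<phi> s) \<longlonglongrightarrow> indicator {..y} s * \<phi> s"
          using AE_lborel_singleton[of y]
        proof eventually_elim
          case (elim s)
          have "eventually (\<lambda>n. indicator {..X n} s * \<phi> s = indicator {..y} s * \<phi> s) sequentially"
          proof (cases "s < y")
            case True
            show ?thesis
              by (rule eventually_mono[OF order_tendstoD(1)[OF X True]]) (use True in \<open>auto simp: indicator_def\<close>)
          next
            case False
            with elim have "y < s" by simp
            show ?thesis
              by (rule eventually_mono[OF order_tendstoD(2)[OF X \<open>y < s\<close>]]) (use \<open>y < s\<close> in \<open>auto simp: indicator_def\<close>)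
          qed
          then show ?case by (rule tendsto_eventually)
        qed
      qed (use \<phi> in \<open>auto simp: indicator_def\<close>)
      then show "((F \<circ> X) \<longlonglongrightarrow> F y)"
        unfolding F_def o_def using Z by (intro tendsto_intros) auto
    qed
  qed
  have "isCont F y" for y using cF by (simp add: continuous_on_eq_continuous_at)
  then have "isCont (\<lambda>y. gauss_quantile t (F y)) y" for y
    by (rule isCont_o2) (rule isCont_gauss_quantile[OF t F01])
  then have "continuous_on UNIV (\<lambda>y. gauss_quantile t (F y))"
    by (simp add: continuous_at_imp_continuous_on)
  then have cg: "continuous_on UNIV g"
    unfolding g_def by (rule continuous_on_compose2[OF continuous_gauss[OF t, of UNIV]]) auto
  have aeg: "AE s in lborel. \<phi> s / Z = g s"
    using eq by eventually_elim (use Z in \<open>simp add: g_def F_def\<close>)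
  have dF: "(F has_real_derivative g y) (at y)" for y
    using integral_atMost_has_derivative[OF intZ cg aeg, of y] unfolding Zc by simp
  define T where "T y = gauss_quantile t (F y) - y" for y
  have "(T has_real_derivative 0) (at y)" for y
  proof -
    have "((\<lambda>y. gauss_quantile t (F y)) has_real_derivative inverse (gauss t (gauss_quantile t (F y))) * g y) (at y)"
      by (rule DERIV_chain2[OF gauss_quantile_has_derivative[OF t F01] dF])
    moreover have "inverse (gauss t (gauss_quantile t (F y))) * g y = 1"
      using gauss_pos[OF t, of "gauss_quantile t (F y)"] by (simp add: g_def)
    ultimately show ?thesis unfolding T_def[abs_def] by (auto intro!: derivative_eq_intros)
  qed
  then have "T y = T 0" for y by (intro DERIV_isconst_all allI)
  then have "gauss_quantile t (F y) = y + T 0" for y unfolding T_def by (metis add.commute diff_add_cancel)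
  then have "AE y in lborel. \<phi> y = Z * gauss t (y + T 0)"
    using eq unfolding F_def by simp
  then show ?thesis ..
qed

lemma real_marginal_shift_sum:
  assumes "f \<in> borel_measurable borel" "finite S" "finite C" "C \<subseteq> S"
  shows "real_marginal S f (x + (\<Sum>c\<in>C. r c *\<^sub>R c)) = real_marginal S f x"
  using assms(3,4)
proof (induction C arbitrary: x rule: finite_induct)
  case (insert b C)
  have "real_marginal S f (x + (\<Sum>c\<in>insert b C. r c *\<^sub>R c)) = real_marginal S f ((x + r b *\<^sub>R b) + (\<Sum>c\<in>C. r c *\<^sub>R c))"
    using insert by (simp add: add.assoc)
  also have "\<dots> = real_marginal S f x"
    using insert assms by (simp add: real_marginal_shift)
  finally show ?case .
qed simp

text \<open>\<open>fb\<close> depends on the coordinate along b alone. The densities on all lines in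
  that direction are therefore translates of one function \<open>\<phi>\<close>, to which the
  one-dimensional rigidity applies.\<close>

lemma marginal_gaussian_if_transport_trivial:
  fixes f :: "'a::euclidean_space \<Rightarrow> real"
  assumes t: "t > 0" and f: "f \<in> borel_measurable borel" "\<And>x. 0 < f x" "integrable lborel f"
    and b: "b \<in> Basis"
  defines "fb \<equiv> real_marginal (Basis - {b}) f" and "Z \<equiv> LBINT x. f x"
  assumes eq: "AE x in lborel. transport_deriv t 0 b fb x = 1"
  shows "\<exists>\<beta>. AE x in lborel. fb x = Z * gauss t (x \<bullet> b + \<beta>)"
proof -
  note [measurable] = f(1)
  have [measurable]: "fb \<in> borel_measurable borel" unfolding fb_def by measurable
  define \<phi> where "\<phi> y = fb (y *\<^sub>R b)" for y
  have [measurable]: "\<phi> \<in> borel_measurable borel" unfolding \<phi>_def[abs_def] by measurable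
  have fb: "fb x = \<phi> (x \<bullet> b)" for x
  proof -
    have "x = (x \<bullet> b) *\<^sub>R b + (\<Sum>c\<in>Basis - {b}. (x \<bullet> c) *\<^sub>R c)"
      using euclidean_representation[of x] b by (simp add: sum.remove)
    then have "fb x = fb ((x \<bullet> b) *\<^sub>R b + (\<Sum>c\<in>Basis - {b}. (x \<bullet> c) *\<^sub>R c))" by simp
    also have "\<dots> = \<phi> (x \<bullet> b)"
      unfolding fb_def \<phi>_def by (rule real_marginal_shift_sum) (use f in auto)
    finally show ?thesis .
  qed
  have fbs: "fb (x + s *\<^sub>R b) = \<phi> (s + x \<bullet> b)" for x s
    using b by (simp add: fb inner_add_left add.commute)
  have ins: "insert b (Basis - {b}) = Basis" using b by auto
  have line: "AE x in lborel. integrable lborel (\<lambda>s. fb (x + s *\<^sub>R b)) \<and> line_integral b fb x = Z"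
    using real_marginal_line[OF f(1) f(2) f(3), of "Basis - {b}" b] b
    by (simp add: fb_def Z_def ins real_marginal_Basis[OF f(1) f(2) f(3)] insert_absorb)
  have nontriv: "ae_filter (lborel :: 'a measure) \<noteq> bot" by (simp add: ae_filter_eq_bot_iff)
  \<comment> \<open>A property of the coordinate along b that holds almost everywhere in space holds
    almost everywhere on at least one line, and the coordinate along that line differs from its
    parameter by a translation.\<close>
  have to_line: "AE y in lborel. P y" if "AE x in lborel. P (x \<bullet> b)" for P
  proof -
    have "AE x in lborel. AE s in lborel. P ((x + s *\<^sub>R b) \<bullet> b)"
      using that by (rule AE_lborel_lines)
    then obtain x where "AE s in lborel. P ((x + s *\<^sub>R b) \<bullet> b)"
      using eventually_happens'[OF nontriv] by blast
    then have "AE s in lborel. P (s + x \<bullet> b)"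
      using b by (simp add: inner_add_left add.commute)
    from AE_lborel_translate[OF this, of "- (x \<bullet> b)"] show ?thesis by simp
  qed
  obtain x where x: "integrable lborel (\<lambda>s. fb (x + s *\<^sub>R b))" "line_integral b fb x = Z"
    using eventually_happens'[OF nontriv line] by auto
  have \<phi>int: "integrable lborel \<phi>"
    using integrable_lborel_translate[of "\<lambda>s. \<phi> (s + x \<bullet> b)" "- (x \<bullet> b)"] x(1) by (simp add: fbs)
  have \<phi>Z: "(LBINT y. \<phi> y) = Z"
    using integral_lborel_translate[of \<phi> "x \<bullet> b"] x(2) by (simp add: line_integral_def fbs)
  have cdf: "line_cdf b fb x = (LBINT s. indicator {..x \<bullet> b} s * \<phi> s) / Z" if "line_integral b fb x = Z" for x
  proof -
    have "(LBINT s. indicator {..0} s * fb (x + s *\<^sub>R b)) = (LBINT s. indicator {..x \<bullet> b} (s + x \<bullet> b) * \<phi> (s + x \<bullet> b))"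
      by (intro Bochner_Integration.integral_cong) (auto simp: fbs indicator_def)
    also have "\<dots> = (LBINT s. indicator {..x \<bullet> b} s * \<phi> s)"
      by (rule integral_lborel_translate[of "\<lambda>s. indicator {..x \<bullet> b} s * \<phi> s"]) measurable
    finally show ?thesis using that by (simp add: line_cdf_def)
  qed
  have fb_pos: "AE x in lborel. 0 < \<phi> (x \<bullet> b)"
    using real_marginal_pos[OF f(1) f(2) f(3), of "Basis - {b}"] by (simp add: fb[symmetric] fb_def)
  have "AE x in lborel. \<phi> (x \<bullet> b) = Z * gauss t (gauss_quantile t ((LBINT s. indicator {..x \<bullet> b} s * \<phi> s) / Z))"
    using eq line fb_pos
  proof eventually_elim
    case (elim x)
    have g: "gauss t (transport t 0 b fb x) > 0" by (rule gauss_pos[OF t])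
    have "Z \<noteq> 0" using elim by (auto simp: transport_deriv_def)
    with elim g have "fb x = Z * gauss t (transport t 0 b fb x)"
      by (simp add: transport_deriv_def field_simps)
    then show ?case using elim by (simp add: fb transport_def cdf)
  qed
  from to_line[OF this] obtain \<beta> where \<beta>: "AE y in lborel. \<phi> y = Z * gauss t (y + \<beta>)"
    using gaussian_if_transport_trivial[OF t \<phi>int to_line[OF fb_pos]] unfolding \<phi>Z by auto
  have "AE x in lborel. AE s in lborel. fb (x + s *\<^sub>R b) = Z * gauss t ((x + s *\<^sub>R b) \<bullet> b + \<beta>)"
  proof (rule AE_I2)
    fix x
    show "AE s in lborel. fb (x + s *\<^sub>R b) = Z * gauss t ((x + s *\<^sub>R b) \<bullet> b + \<beta>)"
      using AE_lborel_translate[OF \<beta>, of "x \<bullet> b"] b by (simp add: fbs inner_add_left add_ac)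
  qed
  then have "AE x in lborel. fb x = Z * gauss t (x \<bullet> b + \<beta>)"
    by (rule AE_lborel_of_lines[rotated]) measurable
  then show ?thesis ..
qed

section \<open>The lower bound\<close>

definition energy_bound :: "real \<Rightarrow> (real^'n::finite \<Rightarrow> real) \<Rightarrow> real" where
  "energy_bound t V = - (1 / t) * ln (LINT x|lebesgue. exp (- t * V x))
     + real CARD('n) * (1 / t) * (1 + 1 / 2 * ln (pi * t))"

lemma integral_AE_eq_lborel:
  fixes u :: "'a::euclidean_space \<Rightarrow> 'b::{banach, second_countable_topology}"
  assumes u: "u \<in> borel_measurable lebesgue" and v: "v \<in> borel_measurable borel" and eq: "AE x in lborel. u x = v x"
  shows "integrable lebesgue u \<longleftrightarrow> integrable lborel v" "(LINT x|lebesgue. u x) = (LBINT x. v x)"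
proof -
  have v': "v \<in> borel_measurable lebesgue" using v by (auto intro: measurable_completion)
  note eq' = AE_completion[OF eq]
  have "integrable lebesgue u \<longleftrightarrow> integrable lebesgue v"
    by (rule integrable_cong_AE[OF u v' eq'])
  also have "\<dots> \<longleftrightarrow> integrable lborel v" using v by (simp add: integrable_completion)
  finally show "integrable lebesgue u \<longleftrightarrow> integrable lborel v" .
  have "(LINT x|lebesgue. u x) = (LINT x|lebesgue. v x)"
    by (rule integral_cong_AE[OF u v' eq'])
  also have "\<dots> = (LBINT x. v x)" using v by (simp add: integral_completion)
  finally show "(LINT x|lebesgue. u x) = (LBINT x. v x)" .
qed

text \<open>Splitting the integral needs both parts integrable. Integrability of V |\<psi>|^2 is not
  part of the form domain and has to be supplied by the lower bound argument.\<close>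

lemma schroedinger_form_eq:
  fixes \<psi> :: "real^'n::finite \<Rightarrow> complex"
  assumes \<psi>: "\<psi> \<in> H1" and V: "integrable lebesgue (\<lambda>x. V x * (cmod (\<psi> x))\<^sup>2)"
  shows "schroedinger_form V \<psi> =
    (\<Sum>i\<in>UNIV. LINT x|lebesgue. (cmod (weak_partial i \<psi> x))\<^sup>2) + (LINT x|lebesgue. V x * (cmod (\<psi> x))\<^sup>2)"
proof -
  have "integrable lebesgue (\<lambda>x. (cmod (weak_partial i \<psi> x))\<^sup>2)" for i
    using weak_partial_props(1)[OF \<psi>] by (auto simp: L2_def)
  then show ?thesis
    unfolding schroedinger_form_def using V
    by (subst Bochner_Integration.integral_add) (auto intro!: Bochner_Integration.integral_sum Bochner_Integration.integrable_sum)
qed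

lemma exp_integral_pos:
  fixes f :: "'a::euclidean_space \<Rightarrow> real"
  assumes f: "integrable lborel f" and pos: "\<And>x. f x > 0"
  shows "(LBINT x. f x) > 0"
proof (rule ccontr)
  have nn: "AE x in lborel. 0 \<le> f x" using pos by (simp add: less_imp_le)
  assume "\<not> ?thesis"
  then have "(LBINT x. f x) = 0" using integral_nonneg_AE[OF nn] by linarith
  then have "AE x in lborel. f x = 0" using integral_nonneg_eq_0_iff_AE[OF f nn] by simp
  then have "AE x in lborel. x \<notin> (UNIV :: 'a set)" by eventually_elim (use pos in \<open>metis less_irrefl\<close>)
  then have "(UNIV :: 'a set) \<in> null_sets lborel" by (subst AE_iff_null_sets) auto
  then show False by (auto simp: null_sets_def)
qed

lemma axis_index_axis [simp]: "axis_index (axis i (1::real)) = i"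
  using axis_index[of "axis i (1::real)"] by (simp add: axis_eq_axis)

lemma sum_Basis_axis: "(\<Sum>b\<in>(Basis :: (real^'n::finite) set). g (axis_index b)) = (\<Sum>i\<in>UNIV. g i)"
proof -
  have B: "(Basis :: (real^'n) set) = range (\<lambda>i. axis i 1)" by (auto simp: Basis_vec_def)
  have "inj (\<lambda>i. axis i 1 :: real^'n)" by (auto simp: inj_on_def axis_eq_axis)
  then show ?thesis unfolding B by (subst sum.reindex) auto
qed

text \<open>Transfers \<open>marginal_chain\<close> from Borel functions and the Borel measure to
  weak derivatives and Lebesgue measure. The coordinate \<open>i\<close> is the last one to be
  integrated out, and \<open>\<delta>\<close> is the deficit.\<close>

lemma energy_deficit:
  fixes V V0 :: "real^'n::finite \<Rightarrow> real" and \<psi> :: "real^'n \<Rightarrow> complex" and i :: 'n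
  assumes t: "t > 0"
    and V_meas [measurable]: "V \<in> borel_measurable lebesgue" and V0_meas [measurable]: "V0 \<in> borel_measurable borel"
    and VV0: "AE x in lborel. V x = V0 x"
    and V_int: "integrable lebesgue (\<lambda>x. exp (- t * V x))"
    and \<psi>: "\<psi> \<in> form_domain V" "L2_norm \<psi> = 1"
  defines "f \<equiv> \<lambda>x. exp (- t * V0 x)" and "b \<equiv> axis i 1 :: real^'n"
  defines "fb \<equiv> real_marginal (Basis - {b}) f"
  defines "\<delta> \<equiv> t * (schroedinger_form V \<psi> - energy_bound t V)"
  shows "integrable lebesgue (\<lambda>x. V x * (cmod (\<psi> x))\<^sup>2)"
    and "0 \<le> \<delta>"
    and "integrable lebesgue (\<lambda>x. ln (fb x) * (cmod (\<psi> x))\<^sup>2)"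
    and "(\<integral>\<^sup>+x. ennreal ((transport_deriv t 0 b fb x - 1 - ln (transport_deriv t 0 b fb x)) * (cmod (\<psi> x))\<^sup>2) \<partial>lebesgue) \<le> ennreal \<delta>"
    and "t * (LINT x|lebesgue. (cmod (weak_partial i \<psi> x))\<^sup>2) - (LINT x|lebesgue. ln (fb x) * (cmod (\<psi> x))\<^sup>2)
      + ln (LBINT x. f x) - (1 + ln (pi * t) / 2) \<le> \<delta>"
    and "integrable lborel f" "(LBINT x. f x) = (LINT x|lebesgue. exp (- t * V x))"
proof -
  have H1: "\<psi> \<in> H1" and L2: "\<psi> \<in> L2" and Vp: "integrable lebesgue (\<lambda>x. max (V x) 0 * (cmod (\<psi> x))\<^sup>2)"
    using \<psi> by (auto simp: form_domain_def H1_def)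
  have \<psi>_meas [measurable]: "\<psi> \<in> borel_measurable lebesgue" using L2 by (auto simp: L2_def)
  obtain \<psi>' where \<psi>' [measurable]: "\<psi>' \<in> borel_measurable borel" "AE x in lborel. \<psi> x = \<psi>' x"
    using ex_borel_version[OF \<psi>_meas] by auto
  have f [measurable]: "f \<in> borel_measurable borel" and fpos: "\<And>x. 0 < f x" unfolding f_def by auto
  have lf: "integrable lborel f" "(LINT x|lebesgue. exp (- t * V x)) = (LBINT x. f x)"
    using V_int integral_AE_eq_lborel[of "\<lambda>x. exp (- t * V x)" f] VV0 by (auto simp: f_def elim!: eventually_mono)
  show "integrable lborel f" "(LBINT x. f x) = (LINT x|lebesgue. exp (- t * V x))" using lf by auto
  have tr: "integrable lebesgue (\<lambda>x. K x * (cmod (\<psi> x))\<^sup>2) \<longleftrightarrow> integrable lborel (\<lambda>x. K x * (cmod (\<psi>' x))\<^sup>2)"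
    "(LINT x|lebesgue. K x * (cmod (\<psi> x))\<^sup>2) = (LBINT x. K x * (cmod (\<psi>' x))\<^sup>2)"
    if K [measurable]: "K \<in> borel_measurable borel" for K
  proof -
    have [measurable]: "K \<in> borel_measurable lebesgue" by (auto intro: measurable_completion)
    have "AE x in lborel. K x * (cmod (\<psi> x))\<^sup>2 = K x * (cmod (\<psi>' x))\<^sup>2" using \<psi>'(2) by eventually_elim simp
    then show "integrable lebesgue (\<lambda>x. K x * (cmod (\<psi> x))\<^sup>2) \<longleftrightarrow> integrable lborel (\<lambda>x. K x * (cmod (\<psi>' x))\<^sup>2)"
      "(LINT x|lebesgue. K x * (cmod (\<psi> x))\<^sup>2) = (LBINT x. K x * (cmod (\<psi>' x))\<^sup>2)"
      by (intro integral_AE_eq_lborel; measurable)+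
  qed
  have sq: "integrable lborel (\<lambda>x. (cmod (\<psi>' x))\<^sup>2)"
    using tr(1)[of "\<lambda>x. 1"] L2 by (simp add: L2_def)
  have norm1: "(LBINT x. (cmod (\<psi>' x))\<^sup>2) = 1"
    using tr(2)[of "\<lambda>x. 1"] \<psi>(2) by (simp add: L2_norm_def)
  have Vtr: "AE x in lborel. V x * (cmod (\<psi> x))\<^sup>2 = V0 x * (cmod (\<psi>' x))\<^sup>2"
    "AE x in lborel. max (V x) 0 * (cmod (\<psi> x))\<^sup>2 = max (V0 x) 0 * (cmod (\<psi>' x))\<^sup>2"
    using VV0 \<psi>'(2) by (eventually_elim; simp)+
  have Vint_iff: "integrable lebesgue (\<lambda>x. V x * (cmod (\<psi> x))\<^sup>2) \<longleftrightarrow> integrable lborel (\<lambda>x. V0 x * (cmod (\<psi>' x))\<^sup>2)"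
    "(LINT x|lebesgue. V x * (cmod (\<psi> x))\<^sup>2) = (LBINT x. V0 x * (cmod (\<psi>' x))\<^sup>2)"
    by (rule integral_AE_eq_lborel[OF _ _ Vtr(1)]; measurable)+
  have "integrable lborel (\<lambda>x. max (V0 x) 0 * (cmod (\<psi>' x))\<^sup>2)"
    using Vp integral_AE_eq_lborel(1)[OF _ _ Vtr(2)] by simp
  then have "integrable lborel (\<lambda>x. t * (max (V0 x) 0 * (cmod (\<psi>' x))\<^sup>2))" by simp
  \<comment> \<open>For f = exp (- t V0), t times the positive part of V0 is the negative part of ln
    f. The form domain condition is exactly the integrability assumed in
    \<open>marginal_chain\<close>.\<close>
  moreover have "t * (max (V0 x) 0 * (cmod (\<psi>' x))\<^sup>2) = max 0 (- ln (f x)) * (cmod (\<psi>' x))\<^sup>2" for x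
    using t by (auto simp: f_def max_def mult_le_0_iff zero_le_mult_iff)
  ultimately have neg: "integrable lborel (\<lambda>x. max 0 (- ln (f x)) * (cmod (\<psi>' x))\<^sup>2)" by simp
  define D where "D b = (LINT x|lebesgue. (cmod (weak_partial (axis_index b) \<psi> x))\<^sup>2)" for b :: "real^'n"
  have D0: "0 \<le> D b" for b unfolding D_def by (intro Bochner_Integration.integral_nonneg) auto
  have Db: "(\<integral>\<^sup>+x. ennreal ((cmod (\<psi>' (x + h *\<^sub>R b) - \<psi>' x))\<^sup>2) \<partial>lborel) \<le> ennreal (h\<^sup>2 * D b)"
    if "b \<in> Basis" "0 < h" for b h
  proof -
    obtain j where j: "b = axis j 1" using \<open>b \<in> Basis\<close> by (auto simp: Basis_vec_def)
    show ?thesis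
      unfolding j D_def axis_index_axis
      by (rule has_weak_partial_increment[OF L2 weak_partial_props[OF H1] \<psi>' that(2)])
  qed
  have bB: "b \<in> Basis" by (simp add: b_def)
  obtain bs where bs: "distinct (bs @ [b])" "set (bs @ [b]) = Basis"
    using Basis_enumeration_ending_with[OF bB] .
  note chain = marginal_chain[OF f fpos lf(1) t \<psi>'(1) sq norm1 D0 Db neg bs, folded fb_def]
  have lnf: "ln (f x) = - t * V0 x" for x by (simp add: f_def)
  have "integrable lborel (\<lambda>x. - (1 / t) * (ln (f x) * (cmod (\<psi>' x))\<^sup>2))"
    using chain(1) by (rule integrable_mult_right)
  then show Vi: "integrable lebesgue (\<lambda>x. V x * (cmod (\<psi> x))\<^sup>2)"
    unfolding Vint_iff lnf using t by simp
  have def: "deficit f \<psi>' D t = \<delta>"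
  proof -
    have "(LBINT x. ln (f x) * (cmod (\<psi>' x))\<^sup>2) = - t * (LINT x|lebesgue. V x * (cmod (\<psi> x))\<^sup>2)"
      unfolding lnf Vint_iff by (simp add: mult.assoc)
    moreover have "(\<Sum>b\<in>Basis. D b) = (\<Sum>i\<in>UNIV. LINT x|lebesgue. (cmod (weak_partial i \<psi> x))\<^sup>2)"
      unfolding D_def by (rule sum_Basis_axis)
    ultimately show ?thesis
      unfolding deficit_def \<delta>_def energy_bound_def schroedinger_form_eq[OF H1 Vi] lf(2)
      using t by (simp add: field_simps)
  qed
  show "0 \<le> \<delta>" using chain(5) unfolding def .
  have [measurable]: "fb \<in> borel_measurable borel" unfolding fb_def by measurable
  have [measurable]: "transport_deriv t 0 b fb \<in> borel_measurable borel"
    by (rule transport_deriv_measurable) (use t in \<open>auto simp: fb_def real_marginal_nonneg\<close>)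
  have Db': "D b = (LINT x|lebesgue. (cmod (weak_partial i \<psi> x))\<^sup>2)" by (simp add: D_def b_def)
  show "integrable lebesgue (\<lambda>x. ln (fb x) * (cmod (\<psi> x))\<^sup>2)"
    using chain(2) by (subst tr(1)) measurable
  show "t * (LINT x|lebesgue. (cmod (weak_partial i \<psi> x))\<^sup>2) - (LINT x|lebesgue. ln (fb x) * (cmod (\<psi> x))\<^sup>2)
      + ln (LBINT x. f x) - (1 + ln (pi * t) / 2) \<le> \<delta>"
    using chain(4) unfolding def Db' by (subst tr(2)) measurable
  have "(\<integral>\<^sup>+x. ennreal ((transport_deriv t 0 b fb x - 1 - ln (transport_deriv t 0 b fb x)) * (cmod (\<psi> x))\<^sup>2) \<partial>lebesgue) =
    (\<integral>\<^sup>+x. ennreal ((transport_deriv t 0 b fb x - 1 - ln (transport_deriv t 0 b fb x)) * (cmod (\<psi>' x))\<^sup>2) \<partial>lborel)"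
    unfolding nn_integral_completion
    using \<psi>'(2) by (intro nn_integral_cong_AE) (auto elim!: eventually_mono)
  then show "(\<integral>\<^sup>+x. ennreal ((transport_deriv t 0 b fb x - 1 - ln (transport_deriv t 0 b fb x)) * (cmod (\<psi> x))\<^sup>2) \<partial>lebesgue) \<le> ennreal \<delta>"
    using chain(3) unfolding def by simp
qed

lemma ex_borel_version_real:
  fixes V :: "'a::euclidean_space \<Rightarrow> real"
  assumes "V \<in> borel_measurable lebesgue"
  obtains V0 :: "'a \<Rightarrow> real" where "V0 \<in> borel_measurable borel" "AE x in lborel. V x = V0 x"
  using completion_ex_borel_measurable_real[OF assms] by auto

lemma energy_bound_le_form:
  fixes V :: "real^'n::finite \<Rightarrow> real"
  assumes t: "t > 0" and V: "V \<in> borel_measurable lebesgue" "integrable lebesgue (\<lambda>x. exp (- t * V x))"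
    and \<psi>: "\<psi> \<in> form_domain V" "L2_norm \<psi> = 1"
  shows "energy_bound t V \<le> schroedinger_form V \<psi>" "integrable lebesgue (\<lambda>x. V x * (cmod (\<psi> x))\<^sup>2)"
proof -
  obtain V0 where V0: "V0 \<in> borel_measurable borel" "AE x in lborel. V x = V0 x"
    using ex_borel_version_real[OF V(1)] .
  note ED = energy_deficit[OF t V(1) V0 V(2) \<psi>]
  show "energy_bound t V \<le> schroedinger_form V \<psi>" using ED(2) t by (simp add: zero_le_mult_iff)
  show "integrable lebesgue (\<lambda>x. V x * (cmod (\<psi> x))\<^sup>2)" by (rule ED(1))
qed

lemma energy_bound_le_lowest_eigenvalue:
  fixes V :: "real^'n::finite \<Rightarrow> real"
  assumes "t > 0" "V \<in> borel_measurable lebesgue" "integrable lebesgue (\<lambda>x. exp (- t * V x))"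
  shows "ereal (energy_bound t V) \<le> lowest_eigenvalue V"
  unfolding lowest_eigenvalue_def using energy_bound_le_form(1)[OF assms]
  by (intro INF_greatest) auto

lemma lowest_eigenvalue_approx:
  assumes "lowest_eigenvalue V = ereal E" "\<delta> > 0"
  obtains \<psi> where "\<psi> \<in> form_domain V" "L2_norm \<psi> = 1" "schroedinger_form V \<psi> < E + \<delta>"
proof -
  have "lowest_eigenvalue V < ereal (E + \<delta>)" using assms by simp
  then show ?thesis unfolding lowest_eigenvalue_def by (auto simp: INF_less_iff intro: that)
qed

section \<open>The case of equality\<close>

text \<open>The near-minimizers vary with the error, so a small remainder weighted by |\<psi>|^2
  says nothing pointwise about T'. The lower bound for V + w turns it into an inequality between the
  integrals of exp (- t V) and exp (- t (V + w)), in which no wave function is left.\<close>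

lemma equality_imp_transport_trivial:
  fixes V V0 :: "real^'n::finite \<Rightarrow> real" and i :: 'n
  assumes t: "t > 0"
    and V_meas [measurable]: "V \<in> borel_measurable lebesgue" and V0_meas [measurable]: "V0 \<in> borel_measurable borel"
    and VV0: "AE x in lborel. V x = V0 x"
    and V_int: "integrable lebesgue (\<lambda>x. exp (- t * V x))"
    and equality: "lowest_eigenvalue V = ereal (energy_bound t V)"
  defines "f \<equiv> \<lambda>x. exp (- t * V0 x)" and "b \<equiv> axis i 1 :: real^'n"
  defines "fb \<equiv> real_marginal (Basis - {b}) f"
  shows "AE x in lborel. transport_deriv t 0 b fb x = 1"
proof -
  note ED = energy_deficit(1,2)[OF t V_meas V0_meas VV0 V_int]
    energy_deficit(4)[OF t V_meas V0_meas VV0 V_int, where i = i, folded f_def b_def, folded fb_def]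
  have f [measurable]: "f \<in> borel_measurable borel" and fpos: "\<And>x. 0 < f x" unfolding f_def by auto
  have [measurable]: "fb \<in> borel_measurable borel" unfolding fb_def by measurable
  have [measurable]: "transport_deriv t 0 b fb \<in> borel_measurable borel"
    by (rule transport_deriv_measurable) (use t in \<open>auto simp: fb_def real_marginal_nonneg\<close>)
  define H where "H x = transport_deriv t 0 b fb x - 1 - ln (transport_deriv t 0 b fb x)" for x
  \<comment> \<open>The cutoff at 1 makes \<open>w\<close> bounded, so a function in the form domain
    of V stays in that of V + w. The maximum with 0 covers the null set where T' vanishes and the
    logarithm has a default value.\<close>
  define w where "w x = max 0 (min 1 (H x))" for x
  have [measurable]: "H \<in> borel_measurable borel" unfolding H_def[abs_def] by measurable
  have w_meas [measurable]: "w \<in> borel_measurable borel" unfolding w_def[abs_def] by measurable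
  have wL [measurable]: "w \<in> borel_measurable lebesgue" by (auto intro: measurable_completion)
  have w: "0 \<le> w x" "w x \<le> 1" for x by (auto simp: w_def)
  define V' where "V' x = V x + w x" for x
  have V'_meas: "V' \<in> borel_measurable lebesgue" unfolding V'_def[abs_def] by measurable
  have V'_int: "integrable lebesgue (\<lambda>x. exp (- t * V' x))"
  proof (rule Bochner_Integration.integrable_bound[OF V_int])
    show "AE x in lebesgue. norm (exp (- t * V' x)) \<le> norm (exp (- t * V x))"
      using t w by (intro AE_I2) (auto simp: V'_def)
    show "(\<lambda>x. exp (- t * V' x)) \<in> borel_measurable lebesgue" using V'_meas by measurable
  qed
  have "energy_bound t V' \<le> energy_bound t V + \<epsilon>" if "\<epsilon> > 0" for \<epsilon>
  proof -
    \<comment> \<open>The energy of the near-minimizer exceeds the bound by less than \<delta>, and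
      \<open>w\<close> adds at most t \<delta>; together they make \<epsilon>.\<close>
    define \<delta> where "\<delta> = \<epsilon> / (1 + t)"
    have "\<delta> > 0" "(1 + t) * \<delta> = \<epsilon>" using that t by (auto simp: \<delta>_def)
    then have \<delta>: "\<delta> > 0" "\<delta> + t * \<delta> = \<epsilon>" by (auto simp: distrib_right)
    obtain \<psi> where \<psi>: "\<psi> \<in> form_domain V" "L2_norm \<psi> = 1" "schroedinger_form V \<psi> < energy_bound t V + \<delta>"
      using lowest_eigenvalue_approx[OF equality \<delta>(1)] .
    note ED\<psi> = ED[OF \<psi>(1,2)]
    have H1: "\<psi> \<in> H1" and Vp: "integrable lebesgue (\<lambda>x. max (V x) 0 * (cmod (\<psi> x))\<^sup>2)"
      using \<psi> by (auto simp: form_domain_def)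
    have [measurable]: "\<psi> \<in> borel_measurable lebesgue" and \<psi>sq: "integrable lebesgue (\<lambda>x. (cmod (\<psi> x))\<^sup>2)"
      using H1 by (auto simp: H1_def L2_def)
    have w\<psi>: "integrable lebesgue (\<lambda>x. w x * (cmod (\<psi> x))\<^sup>2)"
      by (rule Bochner_Integration.integrable_bound[OF \<psi>sq])
         (use w in \<open>auto intro!: AE_I2 mult_left_le_one_le\<close>)
    have "ennreal (LINT x|lebesgue. w x * (cmod (\<psi> x))\<^sup>2) = (\<integral>\<^sup>+x. ennreal (w x * (cmod (\<psi> x))\<^sup>2) \<partial>lebesgue)"
      using w by (intro nn_integral_eq_integral[symmetric] w\<psi>) auto
    also have "\<dots> \<le> (\<integral>\<^sup>+x. ennreal (H x * (cmod (\<psi> x))\<^sup>2) \<partial>lebesgue)"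
    proof (rule nn_integral_mono)
      fix x
      show "ennreal (w x * (cmod (\<psi> x))\<^sup>2) \<le> ennreal (H x * (cmod (\<psi> x))\<^sup>2)"
      proof (cases "0 \<le> H x")
        case True
        then show ?thesis by (intro ennreal_leI mult_right_mono) (auto simp: w_def)
      next
        case False
        then have "w x = 0" by (simp add: w_def)
        then show ?thesis by simp
      qed
    qed
    also have "\<dots> \<le> ennreal (t * (schroedinger_form V \<psi> - energy_bound t V))"
      using ED\<psi>(3) by (simp add: H_def)
    finally have "(LINT x|lebesgue. w x * (cmod (\<psi> x))\<^sup>2) \<le> t * (schroedinger_form V \<psi> - energy_bound t V)"
      using ED\<psi>(2) by (simp only: ennreal_le_iff)
    also have "\<dots> \<le> t * \<delta>" using \<psi>(3) t by (intro mult_left_mono) auto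
    finally have wle: "(LINT x|lebesgue. w x * (cmod (\<psi> x))\<^sup>2) \<le> t * \<delta>" .
    have "\<psi> \<in> form_domain V'"
      unfolding form_domain_def
    proof (intro CollectI conjI H1)
      show "integrable lebesgue (\<lambda>x. max (V' x) 0 * (cmod (\<psi> x))\<^sup>2)"
      proof (rule Bochner_Integration.integrable_bound)
        show "integrable lebesgue (\<lambda>x. max (V x) 0 * (cmod (\<psi> x))\<^sup>2 + (cmod (\<psi> x))\<^sup>2)"
          using Vp \<psi>sq by simp
        show "AE x in lebesgue. norm (max (V' x) 0 * (cmod (\<psi> x))\<^sup>2) \<le> norm (max (V x) 0 * (cmod (\<psi> x))\<^sup>2 + (cmod (\<psi> x))\<^sup>2)"
        proof (rule AE_I2)
          fix x
          have "max (V' x) 0 * (cmod (\<psi> x))\<^sup>2 \<le> (max (V x) 0 + 1) * (cmod (\<psi> x))\<^sup>2"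
            using w[of x] by (intro mult_right_mono) (auto simp: V'_def)
          then show "norm (max (V' x) 0 * (cmod (\<psi> x))\<^sup>2) \<le> norm (max (V x) 0 * (cmod (\<psi> x))\<^sup>2 + (cmod (\<psi> x))\<^sup>2)"
            by (simp add: abs_mult distrib_right)
        qed
      qed (use V'_meas in measurable)
    qed
    note V'\<psi> = energy_bound_le_form[OF t V'_meas V'_int this \<psi>(2)]
    have "schroedinger_form V' \<psi> = schroedinger_form V \<psi> + (LINT x|lebesgue. w x * (cmod (\<psi> x))\<^sup>2)"
      unfolding schroedinger_form_eq[OF H1 ED\<psi>(1)] schroedinger_form_eq[OF H1 V'\<psi>(2)]
      using ED\<psi>(1) w\<psi> by (simp add: V'_def distrib_right)
    with V'\<psi>(1) wle \<psi>(3) \<delta>(2) show ?thesis by linarith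
  qed
  then have "energy_bound t V' \<le> energy_bound t V" by (rule field_le_epsilon)
  then have "ln (LINT x|lebesgue. exp (- t * V x)) \<le> ln (LINT x|lebesgue. exp (- t * V' x))"
    using t by (simp add: energy_bound_def divide_le_cancel)
  moreover have Z: "integrable lborel f" "(LINT x|lebesgue. exp (- t * V x)) = (LBINT x. f x)"
    using V_int VV0 integral_AE_eq_lborel[of "\<lambda>x. exp (- t * V x)" f] by (auto simp: f_def elim!: eventually_mono)
  moreover have Z': "integrable lborel (\<lambda>x. f x * exp (- t * w x))"
    "(LINT x|lebesgue. exp (- t * V' x)) = (LBINT x. f x * exp (- t * w x))"
  proof -
    have "(\<lambda>x. exp (- t * V' x)) \<in> borel_measurable lebesgue" using V'_meas by measurable
    moreover have "AE x in lborel. exp (- t * V' x) = f x * exp (- t * w x)"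
      using VV0 by eventually_elim (simp add: f_def V'_def distrib_left flip: exp_add)
    ultimately show "integrable lborel (\<lambda>x. f x * exp (- t * w x))"
      "(LINT x|lebesgue. exp (- t * V' x)) = (LBINT x. f x * exp (- t * w x))"
      using V'_int integral_AE_eq_lborel[of "\<lambda>x. exp (- t * V' x)" "\<lambda>x. f x * exp (- t * w x)"] by auto
  qed
  moreover have "0 < (LBINT x. f x)" "0 < (LBINT x. f x * exp (- t * w x))"
    using Z(1) Z'(1) fpos by (auto intro!: exp_integral_pos)
  \<comment> \<open>Multiplying f by exp (- t w) \<le> 1 does not lower its integral, so
    \<open>w\<close> vanishes almost everywhere.\<close>
  ultimately have le: "(LBINT x. f x) \<le> (LBINT x. f x * exp (- t * w x))"
    by (simp add: ln_le_cancel_iff)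
  have d_int: "integrable lborel (\<lambda>x. f x - f x * exp (- t * w x))" using Z(1) Z'(1) by simp
  have d_nn: "0 \<le> f x - f x * exp (- t * w x)" for x
    using fpos[of x] w[of x] t by simp
  have "(LBINT x. f x - f x * exp (- t * w x)) = 0"
    using le Z(1) Z'(1) Bochner_Integration.integral_nonneg[of lborel "\<lambda>x. f x - f x * exp (- t * w x)"] d_nn by simp
  then have "AE x in lborel. f x - f x * exp (- t * w x) = 0"
    using integral_nonneg_eq_0_iff_AE[OF d_int] d_nn by simp
  then have w0: "AE x in lborel. w x = 0"
    by eventually_elim (use fpos t in \<open>metis (no_types, opaque_lifting) eq_iff_diff_eq_0 exp_eq_one_iff mult_cancel_left2 mult_eq_0_iff neg_equal_0_iff_equal order_less_irrefl\<close>)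
  have bB: "b \<in> Basis" by (simp add: b_def)
  have ins: "insert b (Basis - {b}) = Basis" using bB by auto
  have fb_pos: "AE x in lborel. 0 < fb x"
    unfolding fb_def by (rule real_marginal_pos[OF f fpos Z(1)]) auto
  have line: "AE x in lborel. integrable lborel (\<lambda>s. fb (x + s *\<^sub>R b))"
    using real_marginal_line[OF f fpos Z(1), of "Basis - {b}" b] bB by (auto simp: fb_def elim: eventually_mono)
  have line_pos: "AE x in lborel. 0 < line_integral b fb x \<and> 0 < line_cdf b fb x \<and> line_cdf b fb x < 1"
    by (rule line_integral_pos[OF line fb_pos])
  show ?thesis
    using w0 fb_pos line_pos
  proof eventually_elim
    case (elim x)
    let ?T = "transport_deriv t 0 b fb x"
    have T: "0 < ?T" using gauss_pos[OF t] elim by (simp add: transport_deriv_def)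
    have "H x \<le> 0" using elim(1) by (simp add: w_def max_def min_def split: if_splits)
    then have "?T - 1 \<le> ln ?T" by (simp add: H_def)
    then show ?case using ln_le_minus_one[OF T] ln_eq_minus_one[OF T] by simp
  qed
qed

lemma harmonic_exp_integral:
  fixes c :: "real^'n::finite"
  assumes t: "t > 0"
  shows "integrable lborel (\<lambda>x. exp (- (norm (x - c))\<^sup>2 / t))"
    and "(LBINT x. exp (- (norm (x - c))\<^sup>2 / t)) = sqrt (pi * t) ^ CARD('n)"
proof -
  have eq: "exp (- (norm (x - c))\<^sup>2 / t) = sqrt (pi * t) ^ CARD('n) * gaussian t c x" for x
    using t by (simp add: gaussian_eq)
  show "integrable lborel (\<lambda>x. exp (- (norm (x - c))\<^sup>2 / t))"
    "(LBINT x. exp (- (norm (x - c))\<^sup>2 / t)) = sqrt (pi * t) ^ CARD('n)"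
    unfolding eq using gaussian_integrals(1,2)[OF t, of c] by simp_all
qed

lemma ln_sqrt_power: "x > 0 \<Longrightarrow> ln (sqrt x ^ n) = real n * ln x / 2"
  by (simp add: ln_realpow ln_sqrt)

text \<open>The harmonic energy of a near-minimizer is controlled coordinate by coordinate through
  the marginals. Since d / t is the lower bound for the harmonic potential itself, the averaged
  potential yields an inequality opposite to Cauchy-Schwarz.\<close>

lemma equality_imp_harmonic:
  fixes V :: "real^'n::finite \<Rightarrow> real"
  assumes t: "t > 0"
    and V_meas [measurable]: "V \<in> borel_measurable lebesgue"
    and V_int: "integrable lebesgue (\<lambda>x. exp (- t * V x))"
    and equality: "lowest_eigenvalue V = ereal (energy_bound t V)"
  shows "\<exists>b C. AE x in lebesgue. V x = (1 / t\<^sup>2) * (norm (x - b))\<^sup>2 + C"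
proof -
  obtain V0 where V0_meas [measurable]: "V0 \<in> borel_measurable borel" and VV0: "AE x in lborel. V x = V0 x"
    using ex_borel_version_real[OF V_meas] .
  define f where "f x = exp (- t * V0 x)" for x
  have f [measurable]: "f \<in> borel_measurable borel" and fpos: "\<And>x. 0 < f x" unfolding f_def[abs_def] by auto
  have fi: "integrable lborel f" and Zf: "(LINT x|lebesgue. exp (- t * V x)) = (LBINT x. f x)"
    using V_int VV0 integral_AE_eq_lborel[of "\<lambda>x. exp (- t * V x)" f] by (auto simp: f_def elim!: eventually_mono)
  define Z where "Z = (LBINT x. f x)"
  have Z: "Z > 0" unfolding Z_def by (rule exp_integral_pos[OF fi fpos])
  define fb where "fb i = real_marginal (Basis - {axis i 1}) f" for i :: 'n
  have "\<exists>\<beta>. AE x in lborel. fb i x = Z * gauss t (x \<bullet> axis i 1 + \<beta>)" for i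
    unfolding fb_def Z_def
    by (rule marginal_gaussian_if_transport_trivial[OF t f fpos fi])
       (use equality_imp_transport_trivial[OF t V_meas V0_meas VV0 V_int equality, of i] in \<open>auto simp: f_def[abs_def]\<close>)
  then obtain \<beta> where \<beta>: "\<And>i. AE x in lborel. fb i x = Z * gauss t (x \<bullet> axis i 1 + \<beta> i)" by metis
  define c where "c = (\<chi> i. - \<beta> i)"
  have nsq: "(norm (x - c))\<^sup>2 = (\<Sum>i\<in>UNIV. (x $ i + \<beta> i)\<^sup>2)" for x
    unfolding power2_norm_eq_inner inner_vec_def by (simp add: c_def power2_eq_square)
  define VG where "VG x = (norm (x - c))\<^sup>2 / t\<^sup>2" for x
  define k where "k x = exp (- t * VG x)" for x
  have [measurable]: "VG \<in> borel_measurable borel" unfolding VG_def[abs_def] by measurable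
  have VGL [measurable]: "VG \<in> borel_measurable lebesgue" by (auto intro: measurable_completion)
  have k_eq: "k x = exp (- (norm (x - c))\<^sup>2 / t)" for x using t by (simp add: k_def VG_def power2_eq_square)
  define ZG where "ZG = sqrt (pi * t) ^ CARD('n)"
  have ZG: "ZG > 0" "ln ZG = real CARD('n) * ln (pi * t) / 2" using t by (auto simp: ZG_def ln_sqrt_power)
  have ki: "integrable lborel k" "(LBINT x. k x) = ZG"
    using harmonic_exp_integral[OF t, of c] by (simp_all add: k_eq[abs_def] ZG_def)
  define V' where "V' x = (V x + VG x) / 2" for x
  have V'_meas: "V' \<in> borel_measurable lebesgue" unfolding V'_def[abs_def] by measurable
  have half: "exp (- t * ((p + q) / 2)) = sqrt (exp (- t * p) * exp (- t * q))" for p q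
  proof -
    have "(exp (- t * ((p + q) / 2)))\<^sup>2 = exp (- t * p) * exp (- t * q)"
      by (simp add: exp_double[symmetric] field_simps flip: exp_add)
    then show ?thesis by (metis exp_ge_zero real_sqrt_unique)
  qed
  have fk_int: "integrable lborel (\<lambda>x. sqrt (f x * k x))"
  proof (rule Bochner_Integration.integrable_bound)
    show "integrable lborel (\<lambda>x. (f x + k x) / 2)" using fi ki by simp
    show "AE x in lborel. norm (sqrt (f x * k x)) \<le> norm ((f x + k x) / 2)"
    proof (rule AE_I2)
      fix x
      have "0 \<le> f x" "0 \<le> k x" using fpos[of x] by (auto simp: k_def)
      with arith_geo_mean_sqrt[OF this] show "norm (sqrt (f x * k x)) \<le> norm ((f x + k x) / 2)" by simp
    qed
    show "(\<lambda>x. sqrt (f x * k x)) \<in> borel_measurable lborel" unfolding k_def by measurable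
  qed
  have ae': "AE x in lborel. exp (- t * V' x) = sqrt (f x * k x)"
    using VV0 by eventually_elim (simp only: V'_def f_def k_def half)
  have km: "(\<lambda>x. sqrt (f x * k x)) \<in> borel_measurable borel" unfolding k_def by measurable
  have V'm: "(\<lambda>x. exp (- t * V' x)) \<in> borel_measurable lebesgue" using V'_meas by measurable
  have V'_int: "integrable lebesgue (\<lambda>x. exp (- t * V' x))"
    and Z': "(LINT x|lebesgue. exp (- t * V' x)) = (LBINT x. sqrt (f x * k x))"
    using fk_int integral_AE_eq_lborel[OF V'm km ae'] by auto
  define d where "d = real CARD('n)"
  have "energy_bound t V' \<le> (energy_bound t V + d / t) / 2 + \<epsilon>" if "\<epsilon> > 0" for \<epsilon>
  proof -
    \<comment> \<open>The error \<delta> occurs once in the energy for V and once for each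
      coordinate of the harmonic energy; the average halves the sum.\<close>
    define \<delta> where "\<delta> = \<epsilon> / (1 + d)"
    have "0 \<le> d" by (simp add: d_def)
    then have "\<delta> > 0" "(1 + d) * \<delta> = \<epsilon>" using that by (auto simp: \<delta>_def)
    then have \<delta>: "\<delta> > 0" "(\<delta> + d * \<delta>) / 2 \<le> \<epsilon>" using that by (auto simp: distrib_right)
    obtain \<psi> where \<psi>: "\<psi> \<in> form_domain V" "L2_norm \<psi> = 1" "schroedinger_form V \<psi> < energy_bound t V + \<delta>"
      using lowest_eigenvalue_approx[OF equality \<delta>(1)] .
    define \<rho> where "\<rho> x = (cmod (\<psi> x))\<^sup>2" for x
    define D where "D i = (LINT x|lebesgue. (cmod (weak_partial i \<psi> x))\<^sup>2)" for i
    define \<Delta> where "\<Delta> = t * (schroedinger_form V \<psi> - energy_bound t V)"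
    have \<Delta>: "\<Delta> \<le> t * \<delta>" unfolding \<Delta>_def using \<psi>(3) t by (intro mult_left_mono) auto
    have H1: "\<psi> \<in> H1" and Vp: "integrable lebesgue (\<lambda>x. max (V x) 0 * \<rho> x)"
      using \<psi> by (auto simp: form_domain_def \<rho>_def)
    have \<psi>m [measurable]: "\<psi> \<in> borel_measurable lebesgue" and \<rho>i: "integrable lebesgue \<rho>"
      using H1 by (auto simp: H1_def L2_def \<rho>_def[abs_def])
    have [measurable]: "\<rho> \<in> borel_measurable lebesgue" unfolding \<rho>_def[abs_def] by measurable
    have \<rho>1: "(LINT x|lebesgue. \<rho> x) = 1" using \<psi>(2) by (simp add: L2_norm_def \<rho>_def)
    have \<rho>0: "0 \<le> \<rho> x" for x by (simp add: \<rho>_def)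
    have Vi: "integrable lebesgue (\<lambda>x. V x * \<rho> x)"
      using energy_bound_le_form(2)[OF t V_meas V_int \<psi>(1,2)] by (simp add: \<rho>_def)
    \<comment> \<open>With ln fb = a - (x_i + \<beta>_i)^2 / t, the estimate for the single
      coordinate i bounds an oscillator energy by its ground state value 1 / t plus \<delta>.
      Integrability of ln fb against |\<psi>|^2 gives the finite second moment.\<close>
    have moment: "integrable lebesgue (\<lambda>x. (x $ i + \<beta> i)\<^sup>2 * \<rho> x)"
      "D i + (LINT x|lebesgue. (x $ i + \<beta> i)\<^sup>2 * \<rho> x) / t\<^sup>2 \<le> 1 / t + \<delta>" for i
    proof -
      note ED = energy_deficit(3,5)[OF t V_meas V0_meas VV0 V_int \<psi>(1,2), where i = i, folded f_def[abs_def], folded fb_def Z_def D_def \<rho>_def \<Delta>_def]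
      define a where "a = ln Z - ln (pi * t) / 2"
      have "AE x in lebesgue. fb i x = Z * gauss t (x \<bullet> axis i 1 + \<beta> i)"
        using \<beta>[of i] by (rule AE_completion)
      then have ae: "AE x in lebesgue. (x $ i + \<beta> i)\<^sup>2 * \<rho> x = t * a * \<rho> x - t * (ln (fb i x) * \<rho> x)"
      proof eventually_elim
        case (elim x)
        have "ln (fb i x) = ln Z + ln (gauss t (x $ i + \<beta> i))"
          using elim Z gauss_pos[OF t, of "x $ i + \<beta> i"] by (simp add: inner_axis ln_mult)
        also have "\<dots> = a - (x $ i + \<beta> i)\<^sup>2 / t"
          using t by (simp add: gauss_def ln_div ln_sqrt a_def)
        finally have L: "ln (fb i x) = a - (x $ i + \<beta> i)\<^sup>2 / t" .
        show ?case unfolding L using t by (simp add: field_simps)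
      qed
      have m1: "(\<lambda>x. (x $ i + \<beta> i)\<^sup>2 * \<rho> x) \<in> borel_measurable lebesgue"
      proof -
        have "(\<lambda>x::real^'n. (x $ i + \<beta> i)\<^sup>2) \<in> borel_measurable borel" by measurable
        then have [measurable]: "(\<lambda>x::real^'n. (x $ i + \<beta> i)\<^sup>2) \<in> borel_measurable lebesgue" by (auto intro: measurable_completion)
        show ?thesis by measurable
      qed
      have i2: "integrable lebesgue (\<lambda>x. t * a * \<rho> x - t * (ln (fb i x) * \<rho> x))"
        using \<rho>i ED(1) by simp
      show "integrable lebesgue (\<lambda>x. (x $ i + \<beta> i)\<^sup>2 * \<rho> x)"
        using i2 integrable_cong_AE[OF m1 borel_measurable_integrable[OF i2] ae] by simp
      have "(LINT x|lebesgue. (x $ i + \<beta> i)\<^sup>2 * \<rho> x) = (LINT x|lebesgue. t * a * \<rho> x - t * (ln (fb i x) * \<rho> x))"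
        by (rule integral_cong_AE[OF m1 borel_measurable_integrable[OF i2] ae])
      also have "\<dots> = t * a - t * (LINT x|lebesgue. ln (fb i x) * \<rho> x)"
        using \<rho>i ED(1) \<rho>1 by simp
      finally have I: "(LINT x|lebesgue. (x $ i + \<beta> i)\<^sup>2 * \<rho> x) = t * (a - (LINT x|lebesgue. ln (fb i x) * \<rho> x))"
        by (simp add: right_diff_distrib)
      have "t * D i + (a - (LINT x|lebesgue. ln (fb i x) * \<rho> x)) \<le> 1 + t * \<delta>"
        using ED(2) \<Delta> by (simp add: a_def)
      then have "(t * D i + (a - (LINT x|lebesgue. ln (fb i x) * \<rho> x))) / t \<le> (1 + t * \<delta>) / t"
        using t by (simp add: divide_right_mono)
      then show "D i + (LINT x|lebesgue. (x $ i + \<beta> i)\<^sup>2 * \<rho> x) / t\<^sup>2 \<le> 1 / t + \<delta>"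
        unfolding I using t by (simp add: add_divide_distrib power2_eq_square)
    qed
    have VG_eq: "VG x * \<rho> x = (\<Sum>i\<in>UNIV. (x $ i + \<beta> i)\<^sup>2 * \<rho> x) / t\<^sup>2" for x
      by (simp add: VG_def nsq sum_distrib_right)
    have VGi: "integrable lebesgue (\<lambda>x. VG x * \<rho> x)"
      unfolding VG_eq by (intro integrable_divide Bochner_Integration.integrable_sum moment)
    have "(\<Sum>i\<in>UNIV. D i) + (LINT x|lebesgue. VG x * \<rho> x) = (\<Sum>i\<in>UNIV. D i + (LINT x|lebesgue. (x $ i + \<beta> i)\<^sup>2 * \<rho> x) / t\<^sup>2)"
      unfolding VG_eq using moment(1) by (simp add: sum.distrib sum_divide_distrib)
    also have "\<dots> \<le> (\<Sum>i\<in>(UNIV :: 'n set). 1 / t + \<delta>)" by (intro sum_mono moment)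
    also have "\<dots> = d / t + d * \<delta>" by (simp add: d_def distrib_left)
    finally have Gle: "(\<Sum>i\<in>UNIV. D i) + (LINT x|lebesgue. VG x * \<rho> x) \<le> d / t + d * \<delta>" .
    have "\<psi> \<in> form_domain V'"
      unfolding form_domain_def
    proof (intro CollectI conjI H1)
      have "integrable lebesgue (\<lambda>x. max (V' x) 0 * \<rho> x)"
      proof (rule Bochner_Integration.integrable_bound)
        show "integrable lebesgue (\<lambda>x. max (V x) 0 * \<rho> x + VG x * \<rho> x)" using Vp VGi by simp
        show "AE x in lebesgue. norm (max (V' x) 0 * \<rho> x) \<le> norm (max (V x) 0 * \<rho> x + VG x * \<rho> x)"
        proof (rule AE_I2)
          fix x
          have "0 \<le> VG x" by (simp add: VG_def)
          then have "max (V' x) 0 * \<rho> x \<le> (max (V x) 0 + VG x) * \<rho> x"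
            by (intro mult_right_mono \<rho>0) (auto simp: V'_def max_def)
          then show "norm (max (V' x) 0 * \<rho> x) \<le> norm (max (V x) 0 * \<rho> x + VG x * \<rho> x)"
            using \<rho>0[of x] by (simp add: abs_mult distrib_right)
        qed
      qed (use V'_meas in measurable)
      then show "integrable lebesgue (\<lambda>x. max (V' x) 0 * (cmod (\<psi> x))\<^sup>2)" by (simp add: \<rho>_def)
    qed
    note V'\<psi> = energy_bound_le_form[OF t V'_meas V'_int this \<psi>(2)]
    have "schroedinger_form V' \<psi> = (\<Sum>i\<in>UNIV. D i) + (LINT x|lebesgue. V' x * \<rho> x)"
      using schroedinger_form_eq[OF H1 V'\<psi>(2)] by (simp add: D_def \<rho>_def)
    also have "(LINT x|lebesgue. V' x * \<rho> x) = (LINT x|lebesgue. (V x * \<rho> x + VG x * \<rho> x) / 2)"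
      by (intro Bochner_Integration.integral_cong) (auto simp: V'_def field_simps)
    also have "\<dots> = ((LINT x|lebesgue. V x * \<rho> x) + (LINT x|lebesgue. VG x * \<rho> x)) / 2"
      using Vi VGi by simp
    finally have "schroedinger_form V' \<psi> = (schroedinger_form V \<psi> + ((\<Sum>i\<in>UNIV. D i) + (LINT x|lebesgue. VG x * \<rho> x))) / 2"
      using schroedinger_form_eq[OF H1 Vi[unfolded \<rho>_def]] by (simp add: D_def \<rho>_def)
    with V'\<psi>(1) Gle \<psi>(3) \<delta>(2) show ?thesis by (simp add: field_simps)
  qed
  then have "energy_bound t V' \<le> (energy_bound t V + d / t) / 2" by (rule field_le_epsilon)
  moreover define Z' where "Z' = (LBINT x. sqrt (f x * k x))"
  ultimately have le: "- (1 / t) * ln Z' + d * (1 / t) * (1 + 1 / 2 * ln (pi * t)) \<le>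
     (- (1 / t) * ln Z + d * (1 / t) * (1 + 1 / 2 * ln (pi * t)) + d / t) / 2"
    by (simp only: energy_bound_def d_def Zf Z_def Z')
  \<comment> \<open>Since ln ZG = d ln (pi t) / 2, the number d / t is the energy bound of the
    harmonic potential. All terms other than the three logarithms cancel.\<close>
  have "(ln Z + ln ZG) / 2 \<le> ln Z'"
  proof -
    define p where "p = ln (pi * t)"
    have "t * (- (1 / t) * ln Z' + d * (1 / t) * (1 + 1 / 2 * p)) \<le>
       t * ((- (1 / t) * ln Z + d * (1 / t) * (1 + 1 / 2 * p) + d / t) / 2)"
      using le t by (intro mult_left_mono) (auto simp: p_def)
    moreover have "t * (- (1 / t) * ln Z' + d * (1 / t) * (1 + 1 / 2 * p)) = - ln Z' + d + d * p / 2"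
      using t by (simp add: distrib_left right_diff_distrib)
    moreover have "t * ((- (1 / t) * ln Z + d * (1 / t) * (1 + 1 / 2 * p) + d / t) / 2) = (- ln Z + d + d * p / 2 + d) / 2"
      using t by (simp add: distrib_left right_diff_distrib)
    ultimately have "- ln Z' + d + d * p / 2 \<le> (- ln Z + d + d * p / 2 + d) / 2"
      by (simp only:)
    moreover have "(u + r / 2) / 2 \<le> v" if "- v + d + r / 2 \<le> (- u + d + r / 2 + d) / 2" for u v r :: real
      using that by (simp add: field_simps)
    ultimately show ?thesis unfolding ZG(2) d_def[symmetric] p_def[symmetric] by blast
  qed
  moreover have Z'pos: "Z' > 0"
    unfolding Z'_def by (rule exp_integral_pos[OF fk_int]) (simp add: fpos k_def)
  moreover have "(ln Z + ln ZG) / 2 = ln (sqrt (Z * ZG))"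
    using Z ZG by (simp add: ln_sqrt ln_mult)
  ultimately have CS: "sqrt (Z * ZG) \<le> Z'"
    using Z ZG by simp
  \<comment> \<open>Equality in Cauchy-Schwarz is read off from the difference of the normalized
    square roots, whose square has integral 2 - 2 Z' / sqrt (Z ZG) \<le> 0.\<close>
  define q where "q x = sqrt (f x / Z) - sqrt (k x / ZG)" for x
  have q2: "(q x)\<^sup>2 = f x / Z + k x / ZG - 2 * (sqrt (f x * k x) / sqrt (Z * ZG))" for x
    using Z ZG fpos[of x] by (simp add: q_def power2_diff power_divide k_def real_sqrt_mult real_sqrt_divide mult.assoc less_imp_le)
  have q2i: "integrable lborel (\<lambda>x. (q x)\<^sup>2)"
    unfolding q2 using fi ki fk_int by simp
  have "(LBINT x. (q x)\<^sup>2) = 1 + 1 - 2 * (Z' / sqrt (Z * ZG))"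
    unfolding q2 using fi ki fk_int Z ZG by (simp add: Z_def[symmetric] Z'_def[symmetric])
  also have "\<dots> \<le> 0" using CS Z ZG by (simp add: le_divide_eq)
  finally have "(LBINT x. (q x)\<^sup>2) = 0"
    by (intro antisym Bochner_Integration.integral_nonneg) auto
  then have "AE x in lborel. (q x)\<^sup>2 = 0"
    using integral_nonneg_eq_0_iff_AE[OF q2i] by simp
  with VV0 have "AE x in lborel. V x = (1 / t\<^sup>2) * (norm (x - c))\<^sup>2 + (ln ZG - ln Z) / t"
  proof eventually_elim
    case (elim x)
    then have "f x / Z = k x / ZG" by (simp add: q_def)
    then have "ln (f x / Z) = ln (k x / ZG)" by simp
    then have "- t * V0 x - ln Z = - t * VG x - ln ZG"
      using Z ZG(1) by (simp add: ln_div f_def k_def)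
    then have "V0 x = VG x + (ln ZG - ln Z) / t" using t by (simp add: field_simps)
    then show ?case using elim(1) by (simp add: VG_def)
  qed
  then have "AE x in lebesgue. V x = (1 / t\<^sup>2) * (norm (x - c))\<^sup>2 + (ln ZG - ln Z) / t"
    by (rule AE_completion)
  then show ?thesis by blast
qed

lemma energy_bound_harmonic:
  fixes V :: "real^'n::finite \<Rightarrow> real"
  assumes t: "t > 0" and [measurable]: "V \<in> borel_measurable lebesgue"
    and V: "AE x in lebesgue. V x = (1 / t\<^sup>2) * (norm (x - c))\<^sup>2 + C"
  shows "energy_bound t V = real CARD('n) / t + C"
proof -
  have "AE x in lborel. V x = (1 / t\<^sup>2) * (norm (x - c))\<^sup>2 + C" using V by (simp add: AE_completion_iff)
  then have "AE x in lborel. exp (- t * V x) = exp (- t * C) * exp (- (norm (x - c))\<^sup>2 / t)"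
    by eventually_elim (use t in \<open>simp add: distrib_left power2_eq_square flip: exp_add\<close>)
  then have "(LINT x|lebesgue. exp (- t * V x)) = (LBINT x. exp (- t * C) * exp (- (norm (x - c))\<^sup>2 / t))"
    by (intro integral_AE_eq_lborel(2)) measurable
  also have "\<dots> = exp (- t * C) * sqrt (pi * t) ^ CARD('n)"
    using harmonic_exp_integral[OF t, of c] by simp
  finally have L: "ln (LINT x|lebesgue. exp (- t * V x)) = - t * C + real CARD('n) * ln (pi * t) / 2"
    using t by (simp add: ln_mult ln_sqrt_power)
  show ?thesis unfolding energy_bound_def L using t by (simp add: field_simps)
qed

theorem mainTheorem2:
  fixes V :: "real^'n::finite \<Rightarrow> real" and t :: real
  assumes "t > 0"
    and "V \<in> borel_measurable lebesgue"
    and "integrable lebesgue (\<lambda>x. exp (- t * V x))"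
  defines "bound \<equiv> - (1 / t) * ln (\<integral>x. exp (- t * V x) \<partial>lebesgue)
                     + real CARD('n) * (1 / t) * (1 + 1 / 2 * ln (pi * t))"
  shows "lowest_eigenvalue V \<ge> ereal bound \<and>
         (lowest_eigenvalue V = ereal bound \<longleftrightarrow>
           (\<exists>b C. AE x in lebesgue. V x = (1 / t\<^sup>2) * (norm (x - b))\<^sup>2 + C))"
proof -
  have bound: "bound = energy_bound t V" by (simp add: bound_def energy_bound_def)
  have ge: "ereal (energy_bound t V) \<le> lowest_eigenvalue V"
    by (rule energy_bound_le_lowest_eigenvalue[OF assms(1-3)])
  \<comment> \<open>For a harmonic potential the energy d / t + C of the Gaussian trial function
    coincides with the lower bound.\<close>
  have "lowest_eigenvalue V = ereal (energy_bound t V)"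
    if "AE x in lebesgue. V x = (1 / t\<^sup>2) * (norm (x - b))\<^sup>2 + C" for b C
    using ge lowest_eigenvalue_harmonic_le[OF assms(1,2) that] energy_bound_harmonic[OF assms(1,2) that]
    by (intro antisym) simp_all
  then show ?thesis
    unfolding bound using ge equality_imp_harmonic[OF assms(1-3)] by blast
qed

end
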